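(* Consider the spatially discrete scheme: find $\rho_h,\tau_h:[0,T]\to\mathbb V$, $\mathbf v_h:[0,T]\to\mathbb V_0^d$, $\mathbf q_h:[0,T]\to\mathbb V_n$ such that $$0=\int_\Omega(\partial_t\rho_h+\operatorname{div}(\rho_h\mathbf v_h))\Psi\,dx-\int_{\mathcal E}[\![\rho_h\mathbf v_h]\!]\{\!\{\Psi\}\!\}\,ds\quad\forall\Psi\in\mathbb V,$$ $$0=\int_\Omega\Big(\rho_h\partial_t\mathbf v_h+\operatorname{div}(\rho_h\mathbf v_h\otimes\mathbf v_h)-\operatorname{div}(\rho_h\mathbf v_h)\mathbf v_h+\rho_h\nabla\tau_h-\tfrac12\rho_h\nabla|\mathbf v_h|^2\Big)^{T}\mathbf X\,dx-\int_{\mathcal E}[\![\tau_h]\!]^T\{\!\{\rho_h\mathbf X\}\!\}\,ds+\mu B_h(\mathbf v_h,\mathbf X)\quad\forall\mathbf X\in\mathbb V_0^d,$$ $$0=\int_\Omega\Big(\tau_h-W'(\rho_h)+\gamma\operatorname{div}\mathbf q_h-\tfrac12|\mathbf v_h|^2\Big)\Xi\,dx-\int_{\mathcal E}\gamma[\![\mathbf q_h]\!]\{\!\{\Xi\}\!\}\,ds\quad\forall\Xi\in\mathbb V,$$ $$0=\int_\Omega(\mathbf q_h-\nabla\rho_h)^{T}\mathbf Z\,dx+\int_{\mathcal E}[\![\rho_h]\!]^T\{\!\{\mathbf Z\}\!\}\,ds\quad\forall\mathbf Z\in\mathbb V_n .$$ (i) For $\mu=0$ the scheme is consistent and conserves mass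 and energy: for its solutions, $\frac{d}{dt}\int_\Omega\rho_h\,dx=0$ and $\frac{d}{dt}\int_\Omega W(\rho_h)+\frac12\rho_h|\mathbf v_h|^2+\frac\gamma2|\mathbf q_h|^2\,dx=0$. (ii) Let $B_h$ be the symmetric interior penalty form $$B_h(\mathbf u,\mathbf w)=\int_\Omega \mathrm D\mathbf u:\mathrm D\mathbf w\,dx-\int_{\mathcal E\cup\partial\Omega}\{\!\{\mathrm D\mathbf w\}\!\}:[\![\mathbf u]\!]_\otimes+\{\!\{\mathrm D\mathbf u\}\!\}:[\![\mathbf w]\!]_\otimes-\frac{\sigma}{h}[\![\mathbf u]\!]_\otimes:[\![\mathbf w]\!]_\otimes\,ds$$ with penalty parameter $\sigma$ large enough that $B_h$ is coercive. Then for $\mu>0$ the scheme is consistent, conserves mass, $\frac{d}{dt}\int_\Omega\rho_h\,dx=0$, and dissipates energy: $$\frac{d}{dt}\int_\Omega W(\rho_h)+\tfrac12\rho_h|\mathbf v_h|^2+\tfrac\gamma2|\mathbf q_h|^2\,dx=-\mu B_h(\mathbf v_h,\mathbf v_h)\le0.$$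
   Context: $\Omega\subset\mathbb R^d$, $d\in\{1,2,3\}$, is a bounded domain with a conforming shape-regular triangulation $\mathcal T$ into open simplices (two closed simplices meet in a common full subsimplex or not at all, and the closed simplices cover $\overline\Omega$). $\mathcal E$ is the set (union) of interior interfaces between elements; $h$ is the meshsize function, $h(x)=\max_{\overline K\ni x}h_K$ with $h_K$ the diameter of $K$. The operators $\operatorname{div}$, $\nabla$ and $\mathrm D$ (Jacobian) are applied elementwise. $H^1(\mathcal T)$ is the broken Sobolev space of functions that are $H^1$ on each $K\in\mathcal T$; $H^1_0(\mathcal T)$ is its subspace of functions with zero trace on $\partial\Omega$; $H^1_n(\mathcal T)$ is the space of vector fields in $H^1(\mathcal T)^d$ with $\mathbf q^T\mathbf n=0$ on $\partial\Omega$ ($\mathbf n$ the outward normal). For a fixed degree $p$, $\mathbb V$ is the space of (discontinuous) piecewise polynomials of degree $p$ on $\mathcal T$; $\mathbb V_0:=\mathbb V\cap H^1_0(\mathcal T)$; $\mathbb V_n:=\mathbb V^d\cap H^1_n(\mathcal T)$. These spaces do not depend on time. On an interior interface shared by $K_1,K_2$ with outward normals $\mathbf n_{K_1},\mathbf n_{K_2}$: averages $\{\!\{\cdot\}\!\}$ of scalar, vector or matrix functions are $\frac12(\cdot|_{K_1}+\cdot|_{K_2})$; the jump of a scalar is the vector $[\![v]\!]=v|_{K_1}\mathbf n_{K_1}+v|_{K_2}\mathbf n_{K_2}$; the jump of a vector field is the scalar $[\![\mathbf v]\!]=\mathbf v|_{K_1}^T\mathbf n_{K_1}+\mathbf v|_{K_2}^T\mathbf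 n_{K_2}$; the tensor jump is $[\![\mathbf v]\!]_\otimes=\mathbf v|_{K_1}\otimes\mathbf n_{K_1}+\mathbf v|_{K_2}\otimes\mathbf n_{K_2}$. On $\partial\Omega$ the average is the trace itself and $[\![v]\!]=v\mathbf n$, $[\![\mathbf v]\!]=\mathbf v^T\mathbf n$, $[\![\mathbf v]\!]_\otimes=\mathbf v\otimes\mathbf n$. $X:Y=\operatorname{trace}(X^TY)$. Consistency: writing the scheme's interface integrands as fluxes $F_1(\rho,\mathbf v,\tau,\mathbf q,\Psi)=-[\![\rho\mathbf v]\!]\{\!\{\Psi\}\!\}$, $F_2(\rho,\mathbf v,\tau,\mathbf q,\mathbf X)=-[\![\tau]\!]^T\{\!\{\rho\mathbf X\}\!\}$, $F_3(\rho,\mathbf v,\tau,\mathbf q,\Xi)=-\gamma[\![\mathbf q]\!]\{\!\{\Xi\}\!\}$, $F_4(\rho,\mathbf v,\tau,\mathbf q,\mathbf Z)=[\![\rho]\!]^T\{\!\{\mathbf Z\}\!\}$, the scheme is called consistent if $F_i(\rho,\mathbf v,\tau,\mathbf q,\cdot)\equiv0$ on $\mathcal E$, $i=1,\dots,4$, for all smooth functions $\rho,\tau\in L^2(0,T;H^1(\Omega))$ and $\mathbf v,\mathbf q\in L^2(0,T;H^1(\Omega))^d$. $W$ is a given (smooth) double-well potential, $\gamma$ is a capillarity coefficient and $\mu\ge 0$ a viscosity coefficient. Coercive means $B_h(\mathbf w,\mathbf w)\ge c\|\mathbf w\|^2$ for all $\mathbf w\in\mathbb V_0^d$, for some $c>0$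 and some norm on $\mathbb V_0^d$. *)

theory Defs
  imports "HOL-Analysis.Analysis"
begin

section \<open>Differential operators\<close>

definition grad :: "(real ^ 'd \<Rightarrow> real) \<Rightarrow> real ^ 'd \<Rightarrow> real ^ 'd" where
  "grad f x = (\<chi> j. frechet_derivative f (at x) (axis j 1))"

definition Jac :: "(real ^ 'd \<Rightarrow> real ^ 'd) \<Rightarrow> real ^ 'd \<Rightarrow> real ^ 'd ^ 'd" where
  "Jac f x = jacobian f (at x)"

definition div_vec :: "(real ^ 'd \<Rightarrow> real ^ 'd) \<Rightarrow> real ^ 'd \<Rightarrow> real" where
  "div_vec f x = trace (Jac f x)"

text \<open>The divergence of a matrix field is taken row by row.\<close>
definition div_mat :: "(real ^ 'd \<Rightarrow> real ^ 'd ^ 'd) \<Rightarrow> real ^ 'd \<Rightarrow> real ^ 'd" where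
  "div_mat A x = (\<chi> i. div_vec (\<lambda>y. A y $ i) x)"

definition tensor :: "real ^ 'd \<Rightarrow> real ^ 'd \<Rightarrow> real ^ 'd ^ 'd" where
  "tensor u w = (\<chi> i j. u $ i * w $ j)"

definition frob :: "real ^ 'd ^ 'd \<Rightarrow> real ^ 'd ^ 'd \<Rightarrow> real" where
  "frob X Y = trace (transpose X ** Y)"

definition time_deriv :: "real \<Rightarrow> (real \<Rightarrow> 'a \<Rightarrow> 'b::real_normed_vector) \<Rightarrow> real \<Rightarrow> 'a \<Rightarrow> 'b" where
  "time_deriv T f t x = vector_derivative (\<lambda>s. f s x) (at t within {0..T})"


section \<open>Smooth functions and Sobolev spaces\<close>

primrec Ck_on :: "nat \<Rightarrow> 'a::euclidean_space set \<Rightarrow> ('a \<Rightarrow> 'b::real_normed_vector) \<Rightarrow> bool" where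
  "Ck_on 0 S f = continuous_on S f"
| "Ck_on (Suc k) S f =
     ((\<forall>x\<in>S. f differentiable (at x)) \<and>
      (\<forall>b\<in>Basis. Ck_on k S (\<lambda>x. frechet_derivative f (at x) b)))"

text \<open>To be used for open \<open>S\<close> only.\<close>
definition smooth_on :: "'a::euclidean_space set \<Rightarrow> ('a \<Rightarrow> 'b::real_normed_vector) \<Rightarrow> bool" where
  "smooth_on S f \<longleftrightarrow> (\<forall>k. Ck_on k S f)"

definition test_function :: "(real ^ 'd) set \<Rightarrow> (real ^ 'd \<Rightarrow> real) \<Rightarrow> bool" where
  "test_function \<Omega> \<phi> \<longleftrightarrow>
     smooth_on UNIV \<phi> \<and> (\<exists>C. compact C \<and> C \<subseteq> \<Omega> \<and> (\<forall>x. x \<notin> C \<longrightarrow> \<phi> x = 0))"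

definition weak_grad :: "(real ^ 'd) set \<Rightarrow> (real ^ 'd \<Rightarrow> real) \<Rightarrow> (real ^ 'd \<Rightarrow> real ^ 'd) \<Rightarrow> bool" where
  "weak_grad \<Omega> f g \<longleftrightarrow>
     (\<forall>\<phi>. test_function \<Omega> \<phi> \<longrightarrow>
        (LINT x:\<Omega>|lebesgue. f x *\<^sub>R grad \<phi> x) = - (LINT x:\<Omega>|lebesgue. \<phi> x *\<^sub>R g x))"

definition L2_on :: "'a::euclidean_space set \<Rightarrow> ('a \<Rightarrow> 'b::euclidean_space) \<Rightarrow> bool" where
  "L2_on S f \<longleftrightarrow>
     set_borel_measurable lebesgue S f \<and> set_integrable lebesgue S (\<lambda>x. (norm (f x))\<^sup>2)"

text \<open>\<open>L\<^sup>2(0,T;H\<^sup>1(\<Omega>))\<close>: the function and its weak spatial gradient are square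
  integrable over the space-time cylinder.\<close>
definition L2H1 :: "real \<Rightarrow> (real ^ 'd) set \<Rightarrow> (real \<Rightarrow> real ^ 'd \<Rightarrow> real) \<Rightarrow> bool" where
  "L2H1 T \<Omega> f \<longleftrightarrow>
     L2_on ({0<..<T} \<times> \<Omega>) (\<lambda>(t, x). f t x) \<and>
     (\<exists>g. L2_on ({0<..<T} \<times> \<Omega>) (\<lambda>(t, x). g t x) \<and>
          (AE t in lebesgue. t \<in> {0<..<T} \<longrightarrow> weak_grad \<Omega> (f t) (g t)))"

definition smooth_L2H1 :: "real \<Rightarrow> (real ^ 'd) set \<Rightarrow> (real \<Rightarrow> real ^ 'd \<Rightarrow> real) \<Rightarrow> bool" where
  "smooth_L2H1 T \<Omega> f \<longleftrightarrow> smooth_on ({0<..<T} \<times> \<Omega>) (\<lambda>(t, x). f t x) \<and> L2H1 T \<Omega> f"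

definition smooth_L2H1_vec :: "real \<Rightarrow> (real ^ 'd) set \<Rightarrow> (real \<Rightarrow> real ^ 'd \<Rightarrow> real ^ 'd) \<Rightarrow> bool" where
  "smooth_L2H1_vec T \<Omega> f \<longleftrightarrow> (\<forall>i. smooth_L2H1 T \<Omega> (\<lambda>t x. f t x $ i))"


section \<open>Meshes\<close>

definition bounded_domain :: "'a::euclidean_space set \<Rightarrow> bool" where
  "bounded_domain \<Omega> \<longleftrightarrow> open \<Omega> \<and> connected \<Omega> \<and> bounded \<Omega> \<and> \<Omega> \<noteq> {}"

text \<open>Elements are open simplices. The library predicate \<^const>\<open>triangulation\<close>, applied to the
  closed elements, is conformity: two closed elements meet in a common (possibly empty) face.\<close>
definition mesh :: "(real ^ 'd) set \<Rightarrow> (real ^ 'd) set set \<Rightarrow> bool" where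
  "mesh \<Omega> \<T> \<longleftrightarrow>
     finite \<T> \<and>
     (\<forall>K\<in>\<T>. K \<subseteq> \<Omega> \<and> (\<exists>S. int CARD('d) simplex S \<and> K = interior S)) \<and>
     triangulation (closure ` \<T>) \<and>
     (\<Union>K\<in>\<T>. closure K) = closure \<Omega>"

definition shape_regular :: "real \<Rightarrow> (real ^ 'd) set set \<Rightarrow> bool" where
  "shape_regular \<kappa> \<T> \<longleftrightarrow> (\<forall>K\<in>\<T>. \<exists>a r. 0 < r \<and> ball a r \<subseteq> K \<and> diameter K \<le> \<kappa> * r)"

definition meshsize :: "(real ^ 'd) set set \<Rightarrow> real ^ 'd \<Rightarrow> real" where
  "meshsize \<T> x = Max (diameter ` {K \<in> \<T>. x \<in> closure K})"

definition facets :: "(real ^ 'd) set set \<Rightarrow> (real ^ 'd) set set" where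
  "facets \<T> = {F. \<exists>K\<in>\<T>. F facet_of closure K}"

definition interfaces :: "(real ^ 'd) set set \<Rightarrow> (real ^ 'd) set set" where
  "interfaces \<T> = {F. \<exists>K\<in>\<T>. \<exists>L\<in>\<T>. K \<noteq> L \<and> F facet_of closure K \<and> F facet_of closure L}"

definition adj :: "(real ^ 'd) set set \<Rightarrow> (real ^ 'd) set \<Rightarrow> (real ^ 'd) set set" where
  "adj \<T> F = {K \<in> \<T>. F facet_of closure K}"

definition outward_normal :: "(real ^ 'd) set \<Rightarrow> (real ^ 'd) set \<Rightarrow> real ^ 'd" where
  "outward_normal K F = (THE n. norm n = 1 \<and> (\<forall>x\<in>K. \<forall>y\<in>F. n \<bullet> x < n \<bullet> y))"


section \<open>Surface integrals\<close>

text \<open>For a hyperplane \<open>H\<close>, the surface measure of \<open>A \<subseteq> H\<close> is the Lebesgue measure of the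
  right cylinder of height 1 over \<open>A\<close>, that is, of the points of the slab of thickness 1 centred
  at \<open>H\<close> whose orthogonal projection to \<open>H\<close> lies in \<open>A\<close>. In dimension one this is the
  counting measure on the one-point set \<open>H\<close>.\<close>
definition hyperplane_measure :: "(real ^ 'd) set \<Rightarrow> (real ^ 'd) measure" where
  "hyperplane_measure H =
     distr (restrict_space lborel {x. infdist x H \<le> 1 / 2}) borel (closest_point H)"

definition facet_measure :: "(real ^ 'd) set \<Rightarrow> (real ^ 'd) measure" where
  "facet_measure F = hyperplane_measure (affine hull F)"

text \<open>The set \<open>\<E>\<close> consists of the points of the interfaces that lie in the open set \<open>\<Omega>\<close>.
  Integrands may depend on the facet, since jumps do.\<close>
definition interface_integral ::
  "(real ^ 'd) set \<Rightarrow> (real ^ 'd) set set \<Rightarrow> ((real ^ 'd) set \<Rightarrow> real ^ 'd \<Rightarrow> real) \<Rightarrow> real" where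
  "interface_integral \<Omega> \<T> g =
     (\<Sum>F\<in>interfaces \<T>. LINT x:F \<inter> \<Omega>|facet_measure F. g F x)"

definition boundary_integral ::
  "(real ^ 'd) set \<Rightarrow> (real ^ 'd) set set \<Rightarrow> ((real ^ 'd) set \<Rightarrow> real ^ 'd \<Rightarrow> real) \<Rightarrow> real" where
  "boundary_integral \<Omega> \<T> g =
     (\<Sum>F\<in>facets \<T>. LINT x:F \<inter> frontier \<Omega>|facet_measure F. g F x)"


section \<open>Traces, averages and jumps\<close>

text \<open>Piecewise polynomials, and smooth functions on \<open>\<Omega>\<close> at points of \<open>\<Omega>\<close>, extend continuously
  from each element to its boundary; the extension is the trace.\<close>
definition tr :: "(real ^ 'd) set \<Rightarrow> (real ^ 'd \<Rightarrow> 'b::t2_space) \<Rightarrow> real ^ 'd \<Rightarrow> 'b" where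
  "tr K f x = Lim (at x within K) f"

text \<open>An interface has exactly two adjacent elements and a boundary facet exactly one, so the
  following sums give the usual averages and jumps on \<open>\<E>\<close> as well as those on \<open>\<partial>\<Omega>\<close>.\<close>
definition avg :: "(real ^ 'd) set set \<Rightarrow> (real ^ 'd) set \<Rightarrow> (real ^ 'd \<Rightarrow> 'b::real_normed_vector) \<Rightarrow> real ^ 'd \<Rightarrow> 'b" where
  "avg \<T> F f x = (\<Sum>K\<in>adj \<T> F. tr K f x) /\<^sub>R real (card (adj \<T> F))"

definition jump :: "(real ^ 'd) set set \<Rightarrow> (real ^ 'd) set \<Rightarrow> (real ^ 'd \<Rightarrow> real) \<Rightarrow> real ^ 'd \<Rightarrow> real ^ 'd" where
  "jump \<T> F f x = (\<Sum>K\<in>adj \<T> F. tr K f x *\<^sub>R outward_normal K F)"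

definition jump_vec :: "(real ^ 'd) set set \<Rightarrow> (real ^ 'd) set \<Rightarrow> (real ^ 'd \<Rightarrow> real ^ 'd) \<Rightarrow> real ^ 'd \<Rightarrow> real" where
  "jump_vec \<T> F f x = (\<Sum>K\<in>adj \<T> F. tr K f x \<bullet> outward_normal K F)"

definition jump_tensor :: "(real ^ 'd) set set \<Rightarrow> (real ^ 'd) set \<Rightarrow> (real ^ 'd \<Rightarrow> real ^ 'd) \<Rightarrow> real ^ 'd \<Rightarrow> real ^ 'd ^ 'd" where
  "jump_tensor \<T> F f x = (\<Sum>K\<in>adj \<T> F. tensor (tr K f x) (outward_normal K F))"


section \<open>Discontinuous finite element spaces\<close>

text \<open>Only the values on the open elements matter: a member of one of these spaces is a
  representative of its class of functions modulo values off the elements.\<close>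

definition polynomial_on :: "nat \<Rightarrow> (real ^ 'd) set \<Rightarrow> (real ^ 'd \<Rightarrow> real) \<Rightarrow> bool" where
  "polynomial_on p K f \<longleftrightarrow>
     (\<exists>c. \<forall>x\<in>K. f x =
        (\<Sum>\<alpha> | (\<Sum>i\<in>UNIV. \<alpha> i) \<le> p. c \<alpha> * (\<Prod>i\<in>UNIV. x $ i ^ (\<alpha> i :: nat))))"

definition DG :: "(real ^ 'd) set set \<Rightarrow> nat \<Rightarrow> (real ^ 'd \<Rightarrow> real) set" where
  "DG \<T> p = {f. \<forall>K\<in>\<T>. polynomial_on p K f}"

definition DG_vec :: "(real ^ 'd) set set \<Rightarrow> nat \<Rightarrow> (real ^ 'd \<Rightarrow> real ^ 'd) set" where
  "DG_vec \<T> p = {f. \<forall>i. (\<lambda>x. f x $ i) \<in> DG \<T> p}"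

text \<open>Boundary conditions hold almost everywhere on \<open>\<partial>\<Omega>\<close> with respect to surface measure. In
  particular an element meeting \<open>\<partial>\<Omega>\<close> in a face of lower dimension only is not constrained.\<close>

definition DG0 :: "(real ^ 'd) set \<Rightarrow> (real ^ 'd) set set \<Rightarrow> nat \<Rightarrow> (real ^ 'd \<Rightarrow> real) set" where
  "DG0 \<Omega> \<T> p = {f \<in> DG \<T> p. \<forall>K\<in>\<T>. \<forall>F. F facet_of closure K \<longrightarrow>
     (AE x in facet_measure F. x \<in> F \<inter> frontier \<Omega> \<longrightarrow> tr K f x = 0)}"

definition DG0_vec :: "(real ^ 'd) set \<Rightarrow> (real ^ 'd) set set \<Rightarrow> nat \<Rightarrow> (real ^ 'd \<Rightarrow> real ^ 'd) set" where
  "DG0_vec \<Omega> \<T> p = {f. \<forall>i. (\<lambda>x. f x $ i) \<in> DG0 \<Omega> \<T> p}"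

definition DGn :: "(real ^ 'd) set \<Rightarrow> (real ^ 'd) set set \<Rightarrow> nat \<Rightarrow> (real ^ 'd \<Rightarrow> real ^ 'd) set" where
  "DGn \<Omega> \<T> p = {f \<in> DG_vec \<T> p. \<forall>K\<in>\<T>. \<forall>F. F facet_of closure K \<longrightarrow>
     (AE x in facet_measure F. x \<in> F \<inter> frontier \<Omega> \<longrightarrow> tr K f x \<bullet> outward_normal K F = 0)}"


section \<open>The scheme\<close>

definition flux1 :: "(real ^ 'd) set set \<Rightarrow> (real ^ 'd \<Rightarrow> real) \<Rightarrow> (real ^ 'd \<Rightarrow> real ^ 'd) \<Rightarrow>
    (real ^ 'd \<Rightarrow> real) \<Rightarrow> (real ^ 'd) set \<Rightarrow> real ^ 'd \<Rightarrow> real" where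
  "flux1 \<T> \<rho> v \<Psi> F x = - (jump_vec \<T> F (\<lambda>y. \<rho> y *\<^sub>R v y) x * avg \<T> F \<Psi> x)"

definition flux2 :: "(real ^ 'd) set set \<Rightarrow> (real ^ 'd \<Rightarrow> real) \<Rightarrow> (real ^ 'd \<Rightarrow> real) \<Rightarrow>
    (real ^ 'd \<Rightarrow> real ^ 'd) \<Rightarrow> (real ^ 'd) set \<Rightarrow> real ^ 'd \<Rightarrow> real" where
  "flux2 \<T> \<rho> \<tau> X F x = - (jump \<T> F \<tau> x \<bullet> avg \<T> F (\<lambda>y. \<rho> y *\<^sub>R X y) x)"

definition flux3 :: "(real ^ 'd) set set \<Rightarrow> real \<Rightarrow> (real ^ 'd \<Rightarrow> real ^ 'd) \<Rightarrow>
    (real ^ 'd \<Rightarrow> real) \<Rightarrow> (real ^ 'd) set \<Rightarrow> real ^ 'd \<Rightarrow> real" where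
  "flux3 \<T> \<gamma> q \<Xi> F x = - (\<gamma> * jump_vec \<T> F q x * avg \<T> F \<Xi> x)"

definition flux4 :: "(real ^ 'd) set set \<Rightarrow> (real ^ 'd \<Rightarrow> real) \<Rightarrow>
    (real ^ 'd \<Rightarrow> real ^ 'd) \<Rightarrow> (real ^ 'd) set \<Rightarrow> real ^ 'd \<Rightarrow> real" where
  "flux4 \<T> \<rho> Z F x = jump \<T> F \<rho> x \<bullet> avg \<T> F Z x"

definition consistent :: "(real ^ 'd) set \<Rightarrow> (real ^ 'd) set set \<Rightarrow> nat \<Rightarrow> real \<Rightarrow> real \<Rightarrow> bool" where
  "consistent \<Omega> \<T> p T \<gamma> \<longleftrightarrow>
     (\<forall>\<rho> \<tau> v q. smooth_L2H1 T \<Omega> \<rho> \<and> smooth_L2H1 T \<Omega> \<tau> \<and>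
                 smooth_L2H1_vec T \<Omega> v \<and> smooth_L2H1_vec T \<Omega> q \<longrightarrow>
       (\<forall>t\<in>{0<..<T}. \<forall>F\<in>interfaces \<T>. \<forall>x\<in>F \<inter> \<Omega>.
          (\<forall>\<Psi>\<in>DG \<T> p. flux1 \<T> (\<rho> t) (v t) \<Psi> F x = 0) \<and>
          (\<forall>X\<in>DG0_vec \<Omega> \<T> p. flux2 \<T> (\<rho> t) (\<tau> t) X F x = 0) \<and>
          (\<forall>\<Xi>\<in>DG \<T> p. flux3 \<T> \<gamma> (q t) \<Xi> F x = 0) \<and>
          (\<forall>Z\<in>DGn \<Omega> \<T> p. flux4 \<T> (\<rho> t) Z F x = 0)))"

text \<open>The viscous form \<open>B\<close> is a parameter. Differentiability in time is required of the two
  unknowns whose time derivative occurs; pointwise differentiability at all points of the elements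
  is that of the curve in the finite-dimensional space of piecewise polynomials.\<close>
definition scheme_solution ::
  "(real ^ 'd) set \<Rightarrow> (real ^ 'd) set set \<Rightarrow> nat \<Rightarrow> real \<Rightarrow> (real \<Rightarrow> real) \<Rightarrow> real \<Rightarrow> real \<Rightarrow>
   ((real ^ 'd \<Rightarrow> real ^ 'd) \<Rightarrow> (real ^ 'd \<Rightarrow> real ^ 'd) \<Rightarrow> real) \<Rightarrow>
   (real \<Rightarrow> real ^ 'd \<Rightarrow> real) \<Rightarrow> (real \<Rightarrow> real ^ 'd \<Rightarrow> real) \<Rightarrow>
   (real \<Rightarrow> real ^ 'd \<Rightarrow> real ^ 'd) \<Rightarrow> (real \<Rightarrow> real ^ 'd \<Rightarrow> real ^ 'd) \<Rightarrow> bool" where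
  "scheme_solution \<Omega> \<T> p T W \<gamma> \<mu> B \<rho> \<tau> v q \<longleftrightarrow>
     (\<forall>t\<in>{0..T}. \<rho> t \<in> DG \<T> p \<and> \<tau> t \<in> DG \<T> p \<and> v t \<in> DG0_vec \<Omega> \<T> p \<and> q t \<in> DGn \<Omega> \<T> p) \<and>
     (\<forall>t\<in>{0..T}. \<forall>x\<in>\<Union>\<T>. (\<lambda>s. \<rho> s x) differentiable (at t within {0..T}) \<and>
                           (\<lambda>s. v s x) differentiable (at t within {0..T})) \<and>
     (\<forall>t\<in>{0..T}.
       (\<forall>\<Psi>\<in>DG \<T> p.
          0 = (LINT x:\<Omega>|lebesgue.
                 (time_deriv T \<rho> t x + div_vec (\<lambda>y. \<rho> t y *\<^sub>R v t y) x) * \<Psi> x)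
              + interface_integral \<Omega> \<T> (flux1 \<T> (\<rho> t) (v t) \<Psi>)) \<and>
       (\<forall>X\<in>DG0_vec \<Omega> \<T> p.
          0 = (LINT x:\<Omega>|lebesgue.
                 (\<rho> t x *\<^sub>R time_deriv T v t x
                  + div_mat (\<lambda>y. \<rho> t y *\<^sub>R tensor (v t y) (v t y)) x
                  - div_vec (\<lambda>y. \<rho> t y *\<^sub>R v t y) x *\<^sub>R v t x
                  + \<rho> t x *\<^sub>R grad (\<tau> t) x
                  - (1 / 2 * \<rho> t x) *\<^sub>R grad (\<lambda>y. (norm (v t y))\<^sup>2) x) \<bullet> X x)
              + interface_integral \<Omega> \<T> (flux2 \<T> (\<rho> t) (\<tau> t) X)
              + \<mu> * B (v t) X) \<and>
       (\<forall>\<Xi>\<in>DG \<T> p.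
          0 = (LINT x:\<Omega>|lebesgue.
                 (\<tau> t x - deriv W (\<rho> t x) + \<gamma> * div_vec (q t) x
                  - 1 / 2 * (norm (v t x))\<^sup>2) * \<Xi> x)
              + interface_integral \<Omega> \<T> (flux3 \<T> \<gamma> (q t) \<Xi>)) \<and>
       (\<forall>Z\<in>DGn \<Omega> \<T> p.
          0 = (LINT x:\<Omega>|lebesgue. (q t x - grad (\<rho> t) x) \<bullet> Z x)
              + interface_integral \<Omega> \<T> (flux4 \<T> (\<rho> t) Z)))"

definition mass :: "(real ^ 'd) set \<Rightarrow> (real ^ 'd \<Rightarrow> real) \<Rightarrow> real" where
  "mass \<Omega> \<rho> = (LINT x:\<Omega>|lebesgue. \<rho> x)"

definition energy :: "(real ^ 'd) set \<Rightarrow> (real \<Rightarrow> real) \<Rightarrow> real \<Rightarrow> (real ^ 'd \<Rightarrow> real) \<Rightarrow>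
    (real ^ 'd \<Rightarrow> real ^ 'd) \<Rightarrow> (real ^ 'd \<Rightarrow> real ^ 'd) \<Rightarrow> real" where
  "energy \<Omega> W \<gamma> \<rho> v q =
     (LINT x:\<Omega>|lebesgue. W (\<rho> x) + 1 / 2 * \<rho> x * (norm (v x))\<^sup>2 + \<gamma> / 2 * (norm (q x))\<^sup>2)"


section \<open>Symmetric interior penalty form\<close>

definition sipg_facet :: "(real ^ 'd) set set \<Rightarrow> real \<Rightarrow> (real ^ 'd \<Rightarrow> real ^ 'd) \<Rightarrow>
    (real ^ 'd \<Rightarrow> real ^ 'd) \<Rightarrow> (real ^ 'd) set \<Rightarrow> real ^ 'd \<Rightarrow> real" where
  "sipg_facet \<T> \<sigma> u w F x =
     frob (avg \<T> F (Jac w) x) (jump_tensor \<T> F u x)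
     + frob (avg \<T> F (Jac u) x) (jump_tensor \<T> F w x)
     - \<sigma> / meshsize \<T> x * frob (jump_tensor \<T> F u x) (jump_tensor \<T> F w x)"

definition sipg :: "(real ^ 'd) set \<Rightarrow> (real ^ 'd) set set \<Rightarrow> real \<Rightarrow>
    (real ^ 'd \<Rightarrow> real ^ 'd) \<Rightarrow> (real ^ 'd \<Rightarrow> real ^ 'd) \<Rightarrow> real" where
  "sipg \<Omega> \<T> \<sigma> u w =
     (LINT x:\<Omega>|lebesgue. frob (Jac u x) (Jac w x))
     - (interface_integral \<Omega> \<T> (sipg_facet \<T> \<sigma> u w)
        + boundary_integral \<Omega> \<T> (sipg_facet \<T> \<sigma> u w))"

text \<open>A norm on a space \<open>V\<close> of piecewise polynomial fields; the zero field is the class of the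
  representatives that vanish on all elements.\<close>
definition norm_on_space :: "(real ^ 'd) set set \<Rightarrow> (real ^ 'd \<Rightarrow> real ^ 'd) set \<Rightarrow>
    ((real ^ 'd \<Rightarrow> real ^ 'd) \<Rightarrow> real) \<Rightarrow> bool" where
  "norm_on_space \<T> V N \<longleftrightarrow>
     (\<forall>u\<in>V. 0 \<le> N u \<and> (N u = 0 \<longleftrightarrow> (\<forall>x\<in>\<Union>\<T>. u x = 0))) \<and>
     (\<forall>a. \<forall>u\<in>V. N (\<lambda>x. a *\<^sub>R u x) = \<bar>a\<bar> * N u) \<and>
     (\<forall>u\<in>V. \<forall>w\<in>V. N (\<lambda>x. u x + w x) \<le> N u + N w)"

definition coercive :: "(real ^ 'd) set \<Rightarrow> (real ^ 'd) set set \<Rightarrow> nat \<Rightarrow>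
    ((real ^ 'd \<Rightarrow> real ^ 'd) \<Rightarrow> (real ^ 'd \<Rightarrow> real ^ 'd) \<Rightarrow> real) \<Rightarrow> bool" where
  "coercive \<Omega> \<T> p B \<longleftrightarrow>
     (\<exists>c>0. \<exists>N. norm_on_space \<T> (DG0_vec \<Omega> \<T> p) N \<and>
        (\<forall>w\<in>DG0_vec \<Omega> \<T> p. B w w \<ge> c * (N w)\<^sup>2))"

end

theory Submission
  imports Defs
begin

text \<open>
  The energy balance is the computation for smooth solutions, repeated with test functions that the
  discrete spaces contain. The mass equation is tested with \<open>\<tau>\<close>, the momentum equation with \<open>v\<close>, the
  equation for \<open>\<tau>\<close> with \<open>\<partial>\<^sub>t\<rho>\<close>, and the equation for \<open>q\<close> enters through the derivative of
  \<open>\<integral> \<bar>q\<bar>\<^sup>2\<close>. The convective terms cancel pointwise (\<open>convective_term_identity\<close>). All remaining volume terms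
  come in pairs \<open>r div w + grad r \<bullet> w\<close>, and the fluxes are chosen such that integration by parts on
  the mesh (\<open>broken_integration_by_parts\<close>) converts each pair into the interface terms of the
  equations: \<open>\<lbrakk>r w\<rbrakk> = \<lbrakk>w\<rbrakk> {r} + \<lbrakk>r\<rbrakk> \<bullet> {w}\<close>. What is left of the time derivative of the energy is
  \<open>- \<mu> B(v, v)\<close>, whatever the form \<open>B\<close>; it is not positive if \<open>B\<close> is coercive. Mass is conserved because
  constants are test functions, and consistency holds because continuous functions have no
  jumps.

  Two points need more than this computation.

  First, the divergence theorem on a simplex, with the surface measure of a facet defined
  through a slab of thickness one. It is derived from the translation of the simplex in a direction
  \<open>e\<close>: the derivative of \<open>\<integral>\<^bsub>S + h e\<^esub> f\<close> at \<open>h = 0\<close> is the integral of the derivative of \<open>f\<close>, and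
  it is also the limit of integrals over thin slabs along the facets
  (\<open>integral_directional_derivative_polytope\<close>). On the mesh, the facet integrals are collected
  by facets. Conformity makes a facet that passes through \<open>\<Omega>\<close> an interface of exactly two
  elements with opposite normals (\<open>interface_two_elements\<close>, \<open>facet_in_domain_is_interface\<close>).

  Second, differentiability in time. A solution is differentiable only pointwise in
  \<open>\<rho>\<close> and \<open>v\<close>, and nothing is required of \<open>q\<close>. Interpolation at finitely many nodes
  (\<open>DG_nodal_basis\<close>) makes the difference quotients of \<open>\<rho>\<close> and \<open>v\<close> uniformly bounded, so that
  the energy may be differentiated under the integral, and it shows that \<open>\<partial>\<^sub>t\<rho>\<close> is a piecewise
  polynomial, hence an admissible test function. The field \<open>q\<close> depends linearly on \<open>\<rho>\<close> through the
  fourth equation; in an orthonormal basis of the test space \<open>\<integral> \<bar>q\<bar>\<^sup>2\<close> becomes a quadratic polynomial in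
  the nodal values of \<open>\<rho>\<close> (\<open>gradient_energy_derivative\<close>).
\<close>

section \<open>Hyperplanes and their surface measure\<close>

definition hyperplane_proj :: "real ^ 'd \<Rightarrow> real \<Rightarrow> real ^ 'd \<Rightarrow> real ^ 'd" where
  "hyperplane_proj n b y = y - (n \<bullet> y - b) *\<^sub>R n"

lemma inner_self_unit: "norm n = 1 \<Longrightarrow> n \<bullet> n = 1" for n :: "real ^ 'd"
  by (simp add: dot_square_norm)

lemma hyperplane_proj_in_hyperplane: "norm n = 1 \<Longrightarrow> n \<bullet> hyperplane_proj n b y = b"
  by (simp add: hyperplane_proj_def inner_diff_right inner_self_unit)

lemma closest_point_hyperplane:
  assumes "norm n = 1"
  shows "closest_point {x. n \<bullet> x = b} y = hyperplane_proj n b y"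
proof (rule closest_point_unique[symmetric])
  show "convex {x. n \<bullet> x = b}" "closed {x. n \<bullet> x = b}"
    by (simp_all add: convex_hyperplane closed_hyperplane)
  show "hyperplane_proj n b y \<in> {x. n \<bullet> x = b}" using hyperplane_proj_in_hyperplane[OF assms] by simp
  show "\<forall>z\<in>{x. n \<bullet> x = b}. dist y (hyperplane_proj n b y) \<le> dist y z"
  proof
    fix z assume "z \<in> {x. n \<bullet> x = b}"
    then have "\<bar>n \<bullet> y - b\<bar> = \<bar>n \<bullet> (y - z)\<bar>" by (simp add: inner_diff_right)
    also have "\<dots> \<le> norm n * norm (y - z)" by (rule Cauchy_Schwarz_ineq2)
    finally show "dist y (hyperplane_proj n b y) \<le> dist y z"
      using assms by (simp add: hyperplane_proj_def dist_norm)
  qed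
qed

lemma infdist_hyperplane:
  fixes n :: "real ^ 'd"
  assumes "norm n = 1"
  shows "infdist y {x. n \<bullet> x = b} = \<bar>n \<bullet> y - b\<bar>"
proof -
  have ne: "{x. n \<bullet> x = b} \<noteq> {}" using hyperplane_proj_in_hyperplane[OF assms] by blast
  have "infdist y {x. n \<bullet> x = b} = setdist {y} {x. n \<bullet> x = b}"
    by (simp add: infdist_eq_setdist)
  also have "\<dots> = dist y (closest_point {x. n \<bullet> x = b} y)"
    using ne closed_hyperplane by (intro setdist_closest_point) auto
  finally show ?thesis
    using assms by (simp add: closest_point_hyperplane hyperplane_proj_def dist_norm)
qed

lemma continuous_hyperplane_proj: "continuous_on A (hyperplane_proj n b)"
  unfolding hyperplane_proj_def by (intro continuous_intros)

lemma hyperplane_proj_measurable [measurable]: "hyperplane_proj n b \<in> borel_measurable borel"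
  using continuous_hyperplane_proj borel_measurable_continuous_onI by blast

lemma hyperplane_proj_shift: "norm n = 1 \<Longrightarrow> hyperplane_proj n b (y + t *\<^sub>R n) = hyperplane_proj n b y"
  by (simp add: hyperplane_proj_def inner_add_right inner_self_unit algebra_simps)

definition slab :: "real ^ 'd \<Rightarrow> real \<Rightarrow> (real ^ 'd) set" where
  "slab n b = {x. \<bar>n \<bullet> x - b\<bar> \<le> 1 / 2}"

lemma slab_borel [measurable]: "slab n b \<in> sets borel"
  unfolding slab_def by measurable

lemma hyperplane_measure_eq:
  assumes "norm n = 1"
  shows "hyperplane_measure {x. n \<bullet> x = b} = distr (restrict_space lborel (slab n b)) borel (hyperplane_proj n b)"
  unfolding hyperplane_measure_def slab_def
  by (simp add: infdist_hyperplane[OF assms] closest_point_hyperplane[OF assms] fun_eq_iff cong: distr_cong)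

lemma hyperplane_proj_measurable_slab [measurable]:
  "hyperplane_proj n b \<in> restrict_space lborel (slab n b) \<rightarrow>\<^sub>M borel"
  by (intro measurable_restrict_space1) simp

text \<open>Surface measure is the image of Lebesgue measure on a slab of thickness one. Hence a surface
  integral is a volume integral over the slab, and the limits taken below are limits of
  volume integrals.\<close>
lemma hyperplane_integral:
  fixes g :: "real ^ 'd \<Rightarrow> real"
  assumes n: "norm n = 1" and g: "g \<in> borel_measurable borel"
  shows "(LINT x|hyperplane_measure {x. n \<bullet> x = b}. g x) =
         (LINT y|lborel. indicator (slab n b) y * g (hyperplane_proj n b y))"
  unfolding hyperplane_measure_eq[OF n]
  by (subst integral_distr) (use g in \<open>simp_all add: integral_restrict_space\<close>)

lemma sets_hyperplane_measure [simp, measurable_cong]: "sets (hyperplane_measure H) = sets borel"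
  by (simp add: hyperplane_measure_def)

lemma space_hyperplane_measure [simp]: "space (hyperplane_measure H) = UNIV"
  by (simp add: hyperplane_measure_def)

lemma hyperplane_measure_bounded:
  fixes n :: "real ^ 'd"
  assumes n: "norm n = 1" and A: "bounded A" "A \<in> sets borel"
  shows "emeasure (hyperplane_measure {x. n \<bullet> x = b}) A < \<infinity>"
proof -
  obtain R where R: "\<And>x. x \<in> A \<Longrightarrow> norm x \<le> R" using A by (auto simp: bounded_iff)
  have "emeasure (hyperplane_measure {x. n \<bullet> x = b}) A
      = emeasure (restrict_space lborel (slab n b)) (hyperplane_proj n b -` A \<inter> slab n b)"
    unfolding hyperplane_measure_eq[OF n] using A
    by (subst emeasure_distr) (simp_all add: space_restrict_space)
  also have "\<dots> = emeasure lborel (hyperplane_proj n b -` A \<inter> slab n b)"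
    by (subst emeasure_restrict_space) (auto)
  also have "\<dots> \<le> emeasure lborel (cball (0::real^'d) (R + 1))"
  proof (rule emeasure_mono)
    show "hyperplane_proj n b -` A \<inter> slab n b \<subseteq> cball 0 (R + 1)"
    proof
      fix y assume y: "y \<in> hyperplane_proj n b -` A \<inter> slab n b"
      have "norm y \<le> norm (hyperplane_proj n b y) + norm ((n \<bullet> y - b) *\<^sub>R n)"
        unfolding hyperplane_proj_def by (metis norm_triangle_sub add.commute)
      also have "\<dots> \<le> R + 1" using R y n by (intro add_mono) (auto simp: slab_def)
      finally show "y \<in> cball 0 (R + 1)" by simp
    qed
  qed simp
  also have "\<dots> < \<infinity>" by (rule emeasure_bounded_finite) simp
  finally show ?thesis .
qed

lemma AE_hyperplane_measure:
  assumes n: "norm n = 1" and "AE y in lborel. Q (hyperplane_proj n b y)" "{x. Q x} \<in> sets borel"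
  shows "AE x in hyperplane_measure {x. n \<bullet> x = b}. Q x"
  unfolding hyperplane_measure_eq[OF n]
  using assms by (subst AE_distr_iff) (auto simp: AE_restrict_space_iff)

section \<open>Integrals over thin slabs\<close>

text \<open>A slab of thickness \<open>N w\<close> consists of \<open>N\<close> translates of a slab of thickness \<open>w\<close>, and
  subtracting the right multiple of \<open>w\<close> from the normal coordinate folds all of them onto the
  first. Rescaling the normal direction would need the transformation rule for linear maps; folding
  needs translation invariance only.\<close>
lemma slab_replication:
  fixes u :: "real ^ 'd \<Rightarrow> real"
  assumes n: "norm n = 1" and w: "w > 0" and u: "u \<in> borel_measurable borel"
    and M: "\<And>x. \<bar>u x\<bar> \<le> M" and R: "\<And>x. norm x > R \<Longrightarrow> u x = 0"
  shows "real N * (LINT x|lborel. indicator {x. 0 \<le> n \<bullet> x - b \<and> n \<bullet> x - b < w} x * u x) =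
    (LINT y|lborel. indicator {y. 0 \<le> n \<bullet> y - b \<and> n \<bullet> y - b < real N * w} y
        * u (y - (w * of_int \<lfloor>(n \<bullet> y - b) / w\<rfloor>) *\<^sub>R n))"
proof -
  let ?v = "\<lambda>x. indicator {x. 0 \<le> n \<bullet> x - b \<and> n \<bullet> x - b < w} x * u x :: real"
  have vint: "integrable lborel ?v"
  proof (rule Bochner_Integration.integrable_bound)
    show "integrable lborel (\<lambda>x. M * indicator (cball (0::real^'d) R) x :: real)"
      by (intro integrable_mult_right integrable_real_indicator) (auto intro: emeasure_bounded_finite[unfolded infinity_ennreal_def])
    show "?v \<in> borel_measurable lborel" using u by measurable
    have "0 \<le> M" using M[of 0] by linarith
    then show "AE x in lborel. norm (?v x) \<le> norm (M * indicator (cball (0::real^'d) R) x :: real)"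
      using M R by (auto intro!: AE_I2 simp: indicator_def not_le)
  qed
  have trans: "(LINT x|lborel. ?v (x - a)) = (LINT x|lborel. ?v x)"
              "integrable lborel (\<lambda>x. ?v (x - a))" for a
  proof -
    have *: "distr lborel borel ((+) (- a)) = (lborel :: (real^'d) measure)" by (rule lborel_distr_plus)
    have "(LINT x|lborel. ?v x) = (LINT x|distr lborel borel ((+) (- a)). ?v x)" by (simp add: *)
    also have "\<dots> = (LINT x|lborel. ?v (- a + x))"
      by (rule integral_distr) (use u in measurable)
    finally show "(LINT x|lborel. ?v (x - a)) = (LINT x|lborel. ?v x)" by (simp add: algebra_simps)
    have "integrable (distr lborel borel ((+) (- a))) ?v" using vint by (simp add: *)
    then have "integrable lborel (\<lambda>x. ?v (- a + x))"
      by (subst (asm) integrable_distr_eq) (use u in measurable)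
    then show "integrable lborel (\<lambda>x. ?v (x - a))" by (simp add: algebra_simps)
  qed
  have split: "(indicator {y. 0 \<le> n \<bullet> y - b \<and> n \<bullet> y - b < real N * w} y
        * u (y - (w * of_int \<lfloor>(n \<bullet> y - b) / w\<rfloor>) *\<^sub>R n) :: real)
     = (\<Sum>j<N. ?v (y - (real j * w) *\<^sub>R n))" for y
  proof -
    let ?s = "n \<bullet> y - b"
    have s: "n \<bullet> (y - (real j * w) *\<^sub>R n) - b = ?s - real j * w" for j
      using n by (simp add: inner_diff_right inner_self_unit)
    have piece: "?v (y - (real j * w) *\<^sub>R n) =
        (if \<lfloor>?s / w\<rfloor> = int j then u (y - (w * of_int \<lfloor>?s / w\<rfloor>) *\<^sub>R n) else 0)" for j
    proof -
      have "(0 \<le> ?s - real j * w \<and> ?s - real j * w < w) \<longleftrightarrow> \<lfloor>?s / w\<rfloor> = int j"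
        using w by (auto simp: floor_eq_iff field_simps)
      then show ?thesis unfolding indicator_def mem_Collect_eq s
        by (auto simp: mult.commute)
    qed
    have rng: "(0 \<le> ?s \<and> ?s < real N * w) \<longleftrightarrow> (\<exists>j<N. \<lfloor>?s / w\<rfloor> = int j)"
    proof
      assume a: "0 \<le> ?s \<and> ?s < real N * w"
      then have "0 \<le> \<lfloor>?s / w\<rfloor>" "\<lfloor>?s / w\<rfloor> < int N"
        using w by (auto simp: floor_less_iff field_simps)
      then show "\<exists>j<N. \<lfloor>?s / w\<rfloor> = int j" by (metis nat_0_le nat_less_iff of_nat_0_le_iff)
    next
      assume "\<exists>j<N. \<lfloor>?s / w\<rfloor> = int j"
      then obtain j where j: "j < N" "\<lfloor>?s / w\<rfloor> = int j" by blast
      then have "0 \<le> \<lfloor>?s / w\<rfloor>" "\<lfloor>?s / w\<rfloor> < int N" by auto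
      then show "0 \<le> ?s \<and> ?s < real N * w"
        using w by (auto simp: floor_less_iff field_simps)
    qed
    show ?thesis
    proof (cases "\<exists>j<N. \<lfloor>?s / w\<rfloor> = int j")
      case True
      then obtain j where j: "j < N" "\<lfloor>?s / w\<rfloor> = int j" by blast
      have "(\<Sum>i<N. ?v (y - (real i * w) *\<^sub>R n)) = (\<Sum>i<N. if i = j then u (y - (w * of_int \<lfloor>?s / w\<rfloor>) *\<^sub>R n) else 0)"
        unfolding piece j(2) by (intro sum.cong) auto
      also have "\<dots> = u (y - (w * of_int \<lfloor>?s / w\<rfloor>) *\<^sub>R n)" using j by simp
      finally show ?thesis using True rng by (simp add: indicator_def)
    next
      case False
      then have "(\<Sum>i<N. ?v (y - (real i * w) *\<^sub>R n)) = 0" unfolding piece by (intro sum.neutral) auto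
      with False rng show ?thesis by (auto simp add: indicator_def)
    qed
  qed
  show ?thesis unfolding split
    by (subst Bochner_Integration.integral_sum) (use trans in simp_all)
qed

lemma AE_not_on_hyperplane:
  assumes "a \<noteq> 0" shows "AE x in lborel. a \<bullet> x \<noteq> (c::real)"
proof -
  have "{x. a \<bullet> x = c} \<in> null_sets lborel"
    using negligible_hyperplane[of a c] assms
    by (simp add: negligible_iff_null_sets null_sets_completion_iff)
  then show ?thesis by (intro AE_I'[of "{x. a \<bullet> x = c}"]) auto
qed

lemma integral_lborel_translate:
  fixes f :: "'a::euclidean_space \<Rightarrow> real"
  assumes [measurable]: "f \<in> borel_measurable borel"
  shows "(LINT x|lborel. f (a + x)) = (LINT x|lborel. f x)"
proof -
  have "(LINT x|lborel. f x) = (LINT x|distr lborel borel ((+) a). f x)" by (simp add: lborel_distr_plus)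
  also have "\<dots> = (LINT x|lborel. f (a + x))" by (rule integral_distr) measurable
  finally show ?thesis by simp
qed

lemma integrable_bounded_support:
  fixes f :: "real ^ 'd \<Rightarrow> real"
  assumes [measurable]: "f \<in> borel_measurable borel" and M: "\<And>x. \<bar>f x\<bar> \<le> M"
    and R: "\<And>x. norm x > R \<Longrightarrow> f x = 0"
  shows "integrable lborel f"
proof (rule Bochner_Integration.integrable_bound)
  show "integrable lborel (\<lambda>x. M * indicator (cball (0::real^'d) R) x :: real)"
    by (intro integrable_mult_right integrable_real_indicator)
      (auto intro: emeasure_bounded_finite[unfolded infinity_ennreal_def])
  have "0 \<le> M" using M[of 0] by linarith
  then show "AE x in lborel. norm (f x) \<le> norm (M * indicator (cball (0::real^'d) R) x :: real)"
    using M R by (auto intro!: AE_I2 simp: indicator_def not_le)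
qed simp

text \<open>A shift by half the normal centres the slab. The half-open slab and the closed one
  differ by a hyperplane.\<close>
lemma unit_slab_integral:
  fixes v :: "real ^ 'd \<Rightarrow> real"
  assumes n: "norm n = 1" and [measurable]: "v \<in> borel_measurable borel"
  shows "(LINT y|lborel. indicator {y. 0 \<le> n \<bullet> y - b \<and> n \<bullet> y - b < 1} y * v (hyperplane_proj n b y)) =
         (LINT x|hyperplane_measure {x. n \<bullet> x = b}. v x)"
proof -
  have "(LINT y|lborel. indicator {y. 0 \<le> n \<bullet> y - b \<and> n \<bullet> y - b < 1} y * v (hyperplane_proj n b y))
      = (LINT y|lborel. indicator {y. 0 \<le> n \<bullet> y - b \<and> n \<bullet> y - b < 1} ((1/2) *\<^sub>R n + y) * v (hyperplane_proj n b ((1/2) *\<^sub>R n + y)))"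
    by (rule integral_lborel_translate[symmetric]) measurable
  also have "\<dots> = (LINT y|lborel. indicator (slab n b) y * v (hyperplane_proj n b y))"
  proof (rule integral_cong_AE)
    have "n \<noteq> 0" using n by auto
    then have "AE y in lborel. n \<bullet> y \<noteq> b + 1/2" by (rule AE_not_on_hyperplane)
    then show "AE y in lborel. indicator {y. 0 \<le> n \<bullet> y - b \<and> n \<bullet> y - b < 1} ((1/2) *\<^sub>R n + y) * v (hyperplane_proj n b ((1/2) *\<^sub>R n + y))
        = indicator (slab n b) y * v (hyperplane_proj n b y)"
    proof eventually_elim
      case (elim y)
      have "hyperplane_proj n b ((1/2) *\<^sub>R n + y) = hyperplane_proj n b y" using hyperplane_proj_shift[OF n] by (simp add: add.commute)
      moreover have "n \<bullet> ((1/2) *\<^sub>R n + y) = n \<bullet> y + 1/2" using n by (simp add: inner_add_right inner_self_unit)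
      moreover have "(0 \<le> n \<bullet> y + 1/2 - b \<and> n \<bullet> y + 1/2 - b < 1) \<longleftrightarrow> \<bar>n \<bullet> y - b\<bar> \<le> 1/2"
        using elim by linarith
      ultimately show ?case unfolding indicator_def slab_def mem_Collect_eq by (auto split: if_splits)
    qed
  qed measurable
  finally show ?thesis using n by (simp add: hyperplane_integral)
qed

text \<open>Repeating the slab of thickness \<open>w\<close> about \<open>1 / w\<close> times gives a slab of
  thickness nearly one, by \<open>slab_replication\<close>. The folded point tends to the projection of the
  original point, so dominated convergence applies. The integrands vary with \<open>k\<close>, so
  their convergence is required along all points that approach the projection from within the
  slabs.\<close>
lemma thin_slab_limit:
  fixes u :: "nat \<Rightarrow> real ^ 'd \<Rightarrow> real"
  assumes n: "norm n = 1" and w: "\<And>k. w k > 0" "w \<longlonglongrightarrow> 0"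
    and [measurable]: "\<And>k. u k \<in> borel_measurable borel" "v \<in> borel_measurable borel"
    and M: "\<And>k x. \<bar>u k x\<bar> \<le> M" and R: "\<And>k x. norm x > R \<Longrightarrow> u k x = 0"
    and conv: "AE y in lborel. \<forall>r. (\<forall>k. 0 \<le> r k \<and> r k < w k) \<longrightarrow>
       (\<lambda>k. u k (hyperplane_proj n b y + r k *\<^sub>R n)) \<longlonglongrightarrow> v (hyperplane_proj n b y)"
  shows "(\<lambda>k. (LINT x|lborel. indicator {x. 0 \<le> n \<bullet> x - b \<and> n \<bullet> x - b < w k} x * u k x) / w k)
      \<longlonglongrightarrow> (LINT x|hyperplane_measure {x. n \<bullet> x = b}. v x)"
proof -
  let ?I = "\<lambda>k. LINT x|lborel. indicator {x. 0 \<le> n \<bullet> x - b \<and> n \<bullet> x - b < w k} x * u k x"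
  define N where "N k = nat \<lfloor>1 / w k\<rfloor>" for k
  have N: "1 - w k < real (N k) * w k" "real (N k) * w k \<le> 1" for k
  proof -
    have "real (N k) = of_int \<lfloor>1 / w k\<rfloor>" using w(1)[of k] by (simp add: N_def)
    moreover have "of_int \<lfloor>1 / w k\<rfloor> \<le> 1 / w k" "1 / w k < of_int \<lfloor>1 / w k\<rfloor> + 1" by linarith+
    ultimately have "real (N k) \<le> 1 / w k" "1 / w k < real (N k) + 1" by simp_all
    then have "real (N k) * w k \<le> 1" "1 < (real (N k) + 1) * w k"
      using w(1)[of k] by (simp_all add: field_simps)
    then show "1 - w k < real (N k) * w k" "real (N k) * w k \<le> 1"
      using w(1)[of k] by (auto simp: algebra_simps)
  qed
  have Nw: "(\<lambda>k. real (N k) * w k) \<longlonglongrightarrow> 1"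
  proof (rule tendsto_sandwich)
    show "(\<lambda>k. 1 - w k) \<longlonglongrightarrow> 1" using tendsto_diff[OF tendsto_const w(2), of 1] by simp
    show "eventually (\<lambda>k. 1 - w k \<le> real (N k) * w k) sequentially" using N(1) by (auto simp: less_imp_le)
  qed (use N in auto)
  let ?s = "\<lambda>y. n \<bullet> y - b"
  have replicate: "real (N k) * ?I k =
    (LINT y|lborel. indicator {y. 0 \<le> ?s y \<and> ?s y < real (N k) * w k} y
        * u k (y - (w k * of_int \<lfloor>?s y / w k\<rfloor>) *\<^sub>R n))" for k
    by (rule slab_replication[OF n w(1) _ M R]) auto
  have "(\<lambda>k. real (N k) * ?I k) \<longlonglongrightarrow>
     (LINT y|lborel. indicator {y. 0 \<le> n \<bullet> y - b \<and> n \<bullet> y - b < 1} y * v (hyperplane_proj n b y))"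
    unfolding replicate
  proof (rule integral_dominated_convergence)
    show "integrable lborel (\<lambda>y. M * indicator (cball (0::real^'d) (R + 1)) y :: real)"
      by (intro integrable_mult_right integrable_real_indicator)
        (auto intro: emeasure_bounded_finite[unfolded infinity_ennreal_def])
    have "0 \<le> M" using M[of 0 0] by linarith
    show "AE y in lborel. norm (indicator {y. 0 \<le> ?s y \<and> ?s y < real (N k) * w k} y *
          u k (y - (w k * of_int \<lfloor>?s y / w k\<rfloor>) *\<^sub>R n)) \<le> M * indicator (cball 0 (R + 1)) y" for k
    proof (rule AE_I2)
      fix y
      show "norm (indicator {y. 0 \<le> ?s y \<and> ?s y < real (N k) * w k} y *
          u k (y - (w k * of_int \<lfloor>?s y / w k\<rfloor>) *\<^sub>R n)) \<le> M * indicator (cball 0 (R + 1)) y"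
      proof (cases "0 \<le> ?s y \<and> ?s y < real (N k) * w k \<and> norm y > R + 1")
        case True
        have "0 \<le> w k * of_int \<lfloor>?s y / w k\<rfloor>" using True w(1)[of k] by (simp add: floor_le_iff)
        moreover have "w k * of_int \<lfloor>?s y / w k\<rfloor> \<le> w k * (?s y / w k)"
          using w(1)[of k] by (intro mult_left_mono) auto
        ultimately have "\<bar>w k * of_int \<lfloor>?s y / w k\<rfloor>\<bar> \<le> 1" using True N(2)[of k] w(1)[of k] by auto
        then have "norm ((w k * of_int \<lfloor>?s y / w k\<rfloor>) *\<^sub>R n) \<le> 1" using n by simp
        then have "norm (y - (w k * of_int \<lfloor>?s y / w k\<rfloor>) *\<^sub>R n) > R"
          using True norm_triangle_ineq2[of y "(w k * of_int \<lfloor>?s y / w k\<rfloor>) *\<^sub>R n"] by linarith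
        then show ?thesis using R \<open>0 \<le> M\<close> by simp
      next
        case False
        then show ?thesis using M \<open>0 \<le> M\<close> by (auto simp: indicator_def)
      qed
    qed
    show "AE y in lborel. (\<lambda>k. indicator {y. 0 \<le> ?s y \<and> ?s y < real (N k) * w k} y *
          u k (y - (w k * of_int \<lfloor>?s y / w k\<rfloor>) *\<^sub>R n))
          \<longlonglongrightarrow> indicator {y. 0 \<le> ?s y \<and> ?s y < 1} y * v (hyperplane_proj n b y)"
      using conv
    proof eventually_elim
      case (elim y)
      \<comment> \<open>The height of the folded point above the hyperplane.\<close>
      define r where "r k = ?s y - w k * of_int \<lfloor>?s y / w k\<rfloor>" for k
      have r: "0 \<le> r k \<and> r k < w k" for k
      proof -
        define q where "q = (of_int \<lfloor>?s y / w k\<rfloor> :: real)"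
        have "q \<le> ?s y / w k" "?s y / w k < q + 1" unfolding q_def by linarith+
        then show ?thesis using w(1)[of k] by (simp add: r_def q_def[symmetric] field_simps)
      qed
      have eq: "y - (w k * of_int \<lfloor>?s y / w k\<rfloor>) *\<^sub>R n = hyperplane_proj n b y + r k *\<^sub>R n" for k
        by (simp add: hyperplane_proj_def r_def algebra_simps)
      have cu: "(\<lambda>k. u k (y - (w k * of_int \<lfloor>?s y / w k\<rfloor>) *\<^sub>R n)) \<longlonglongrightarrow> v (hyperplane_proj n b y)"
        unfolding eq using elim r by blast
      have ci: "eventually (\<lambda>k. (indicator {y. 0 \<le> ?s y \<and> ?s y < real (N k) * w k} y :: real)
             = indicator {y. 0 \<le> ?s y \<and> ?s y < 1} y) sequentially"
      proof (cases "?s y < 1")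
        case True
        then have "eventually (\<lambda>k. ?s y < real (N k) * w k) sequentially"
          using Nw by (intro order_tendstoD)
        then show ?thesis by eventually_elim (use True in \<open>auto simp: indicator_def\<close>)
      next
        case False
        then have "\<not> ?s y < real (N k) * w k" for k using N(2)[of k] by linarith
        then show ?thesis using False by (auto simp: indicator_def)
      qed
      have "(\<lambda>k. indicator {y. 0 \<le> ?s y \<and> ?s y < real (N k) * w k} y :: real)
          \<longlonglongrightarrow> indicator {y. 0 \<le> ?s y \<and> ?s y < 1} y"
        using ci by (rule tendsto_eventually)
      then show ?case using cu by (rule tendsto_mult)
    qed
  qed measurable
  then have "(\<lambda>k. real (N k) * ?I k / (real (N k) * w k)) \<longlonglongrightarrow>
     (LINT x|hyperplane_measure {x. n \<bullet> x = b}. v x) / 1"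
    using Nw unfolding unit_slab_integral[OF n assms(5)] by (intro tendsto_divide) auto
  moreover have "eventually (\<lambda>k. real (N k) * ?I k / (real (N k) * w k) = ?I k / w k) sequentially"
  proof -
    have "eventually (\<lambda>k. 0 < real (N k) * w k) sequentially"
      using Nw by (rule order_tendstoD) simp
    then show ?thesis by eventually_elim (auto simp: field_simps)
  qed
  ultimately show ?thesis by (auto intro: Lim_transform_eventually)
qed

text \<open>The factors \<open>b\<close> are replaced by the factors \<open>a\<close> one at a time. \<open>Q i j\<close> says that factor \<open>j\<close>
  has been replaced before factor \<open>i\<close>; only its existence matters, which makes an enumeration of
  \<open>I\<close> superfluous.\<close>
lemma prod_difference_telescopes:
  fixes a b :: "'i \<Rightarrow> 'x \<Rightarrow> real"
  assumes "finite I"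
  shows "\<exists>Q. \<forall>a b :: 'i \<Rightarrow> real. (\<Prod>i\<in>I. a i) - (\<Prod>i\<in>I. b i) =
    (\<Sum>i\<in>I. (a i - b i) * (\<Prod>j\<in>I - {i}. if Q i j then a j else b j))"
  using assms
proof (induction I)
  case empty then show ?case by simp
next
  case (insert k I)
  then obtain Q where Q: "\<And>a b :: 'i \<Rightarrow> real. (\<Prod>i\<in>I. a i) - (\<Prod>i\<in>I. b i) =
    (\<Sum>i\<in>I. (a i - b i) * (\<Prod>j\<in>I - {i}. if Q i j then a j else b j))" by blast
  define Q' where "Q' i j \<longleftrightarrow> (if i = k then True else if j = k then False else Q i j)" for i j
  show ?case
  proof (intro exI[of _ Q'] allI)
    fix a b :: "'i \<Rightarrow> real"
    have 1: "(\<Prod>j\<in>I. if Q' k j then a j else b j) = (\<Prod>j\<in>I. a j)"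
      using insert.hyps by (intro prod.cong) (auto simp: Q'_def)
    have 2: "(\<Prod>j\<in>insert k I - {i}. if Q' i j then a j else b j)
        = b k * (\<Prod>j\<in>I - {i}. if Q i j then a j else b j)" if "i \<in> I" for i
    proof -
      have "insert k I - {i} = insert k (I - {i})" using that insert.hyps by auto
      moreover have "(\<Prod>j\<in>I - {i}. if Q' i j then a j else b j) = (\<Prod>j\<in>I - {i}. if Q i j then a j else b j)"
        using that insert.hyps by (intro prod.cong) (auto simp: Q'_def)
      ultimately show ?thesis using insert.hyps that by (auto simp: Q'_def)
    qed
    have "(\<Sum>i\<in>insert k I. (a i - b i) * (\<Prod>j\<in>insert k I - {i}. if Q' i j then a j else b j))
       = (a k - b k) * (\<Prod>j\<in>I. a j) + b k * ((\<Prod>i\<in>I. a i) - (\<Prod>i\<in>I. b i))"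
      using insert.hyps unfolding Q sum_distrib_left
      by (simp add: 1 2 ac_simps cong: sum.cong)
    also have "\<dots> = (\<Prod>i\<in>insert k I. a i) - (\<Prod>i\<in>insert k I. b i)"
      using insert.hyps by (simp add: algebra_simps)
    finally show "(\<Prod>i\<in>insert k I. a i) - (\<Prod>i\<in>insert k I. b i) =
      (\<Sum>i\<in>insert k I. (a i - b i) * (\<Prod>j\<in>insert k I - {i}. if Q' i j then a j else b j))" by simp
  qed
qed

section \<open>The Gauss formula for an intersection of half-spaces\<close>

definition C1 :: "(real ^ 'd \<Rightarrow> real) \<Rightarrow> bool" where
  "C1 f \<longleftrightarrow> (\<forall>x. f differentiable (at x)) \<and>
     (\<forall>e. continuous_on UNIV (\<lambda>x. frechet_derivative f (at x) e))"

lemma C1_continuous_on: "C1 f \<Longrightarrow> continuous_on A f"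
  unfolding C1_def by (meson continuous_at_imp_continuous_on differentiable_imp_continuous_within)

lemma directional_mean_value:
  fixes f :: "real ^ 'd \<Rightarrow> real"
  assumes f: "C1 f" and h: "h > 0"
  obtains \<xi> where "0 < \<xi>" "\<xi> < h"
    "f (x + h *\<^sub>R e) - f x = h * frechet_derivative f (at (x + \<xi> *\<^sub>R e)) e"
proof -
  have fd: "(f has_derivative frechet_derivative f (at y)) (at y)" for y
    using f by (simp add: C1_def frechet_derivative_works)
  have "((\<lambda>t. f (x + t *\<^sub>R e)) has_real_derivative frechet_derivative f (at (x + t *\<^sub>R e)) e) (at t)" for t
  proof -
    have "((\<lambda>t. f (x + t *\<^sub>R e)) has_derivative (\<lambda>s. frechet_derivative f (at (x + t *\<^sub>R e)) (s *\<^sub>R e))) (at t)"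
      by (rule has_derivative_compose[OF _ fd]) (auto intro!: derivative_eq_intros)
    moreover have "frechet_derivative f (at y) (s *\<^sub>R e) = frechet_derivative f (at y) e * s" for y s
      using f by (simp add: C1_def linear_frechet_derivative linear_scale)
    ultimately show ?thesis by (simp add: has_field_derivative_def)
  qed
  then have "\<exists>\<xi>>0. \<xi> < h \<and>
    f (x + h *\<^sub>R e) - f (x + 0 *\<^sub>R e) = (h - 0) * frechet_derivative f (at (x + \<xi> *\<^sub>R e)) e"
    using h by (intro MVT2) auto
  then show ?thesis using that by auto
qed

text \<open>By the mean value theorem the difference quotient is the derivative at an intermediate
  point. This gives both the pointwise limit and the bound for dominated convergence.\<close>
lemma difference_quotient_integral_limit:
  fixes f :: "real ^ 'd \<Rightarrow> real"
  assumes f: "C1 f" and S: "bounded S" "S \<in> sets borel" and h: "\<And>k. 0 < h k" "\<And>k. h k \<le> 1" "h \<longlonglongrightarrow> 0"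
  shows "(\<lambda>k. LINT x|lborel. indicator S x * ((f (x + h k *\<^sub>R e) - f x) / h k))
     \<longlonglongrightarrow> (LINT x|lborel. indicator S x * frechet_derivative f (at x) e)"
proof -
  let ?D = "\<lambda>x. frechet_derivative f (at x) e"
  obtain R where R: "\<And>x. x \<in> S \<Longrightarrow> norm x \<le> R" using S by (auto simp: bounded_iff)
  have cD: "continuous_on UNIV ?D" and cf: "continuous_on UNIV f"
    using f C1_continuous_on by (auto simp: C1_def)
  note [measurable] = borel_measurable_continuous_onI[OF cD] borel_measurable_continuous_onI[OF cf] S(2)
  have "bounded (?D ` cball 0 (R + norm e))"
    by (intro compact_imp_bounded compact_continuous_image continuous_on_subset[OF cD]) auto
  then obtain M where "\<forall>y\<in>?D ` cball 0 (R + norm e). norm y \<le> M" unfolding bounded_iff by blast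
  then have M: "\<And>x. x \<in> cball 0 (R + norm e) \<Longrightarrow> \<bar>?D x\<bar> \<le> M" by auto
  have mv: "\<exists>\<xi>. 0 < \<xi> \<and> \<xi> < h k \<and> (f (x + h k *\<^sub>R e) - f x) / h k = ?D (x + \<xi> *\<^sub>R e)" for k x
    using h(1)[of k] by (rule directional_mean_value[OF f, of "h k" x e]) (auto simp: field_simps)
  show ?thesis
  proof (rule integral_dominated_convergence)
    show "integrable lborel (\<lambda>y. M * indicator (cball (0::real^'d) R) y :: real)"
      by (intro integrable_mult_right integrable_real_indicator)
        (auto intro: emeasure_bounded_finite[unfolded infinity_ennreal_def])
    show "AE x in lborel. norm (indicator S x * ((f (x + h k *\<^sub>R e) - f x) / h k)) \<le> M * indicator (cball 0 R) x" for k
    proof (rule AE_I2)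
      fix x
      obtain \<xi> where \<xi>: "0 < \<xi>" "\<xi> < h k" "(f (x + h k *\<^sub>R e) - f x) / h k = ?D (x + \<xi> *\<^sub>R e)" using mv by blast
      show "norm (indicator S x * ((f (x + h k *\<^sub>R e) - f x) / h k)) \<le> M * indicator (cball 0 R) x"
      proof (cases "x \<in> S")
        case True
        have "norm (\<xi> *\<^sub>R e) \<le> norm e" using \<xi> h(2)[of k] by (simp add: mult_left_le_one_le)
        then have "norm (x + \<xi> *\<^sub>R e) \<le> R + norm e" using R[OF True] norm_triangle_ineq[of x "\<xi> *\<^sub>R e"] by linarith
        then show ?thesis using True R[OF True] M \<xi>(3) by simp
      next
        case False
        have "0 \<le> M \<or> R < 0" using M[of 0] by fastforce
        moreover have "R < 0 \<Longrightarrow> indicator (cball 0 R) x = (0::real)"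
          using norm_ge_zero[of x] by (auto simp: indicator_def simp del: norm_ge_zero)
        ultimately show ?thesis using False by (cases "R < 0") (auto simp: indicator_def)
      qed
    qed
    show "AE x in lborel. (\<lambda>k. indicator S x * ((f (x + h k *\<^sub>R e) - f x) / h k)) \<longlonglongrightarrow> indicator S x * ?D x"
    proof (rule AE_I2, rule tendsto_mult_left)
      fix x
      have "\<exists>\<xi>. \<forall>k. 0 < \<xi> k \<and> \<xi> k < h k \<and> (f (x + h k *\<^sub>R e) - f x) / h k = ?D (x + \<xi> k *\<^sub>R e)"
        using mv by (intro choice allI)
      then obtain \<xi> where \<xi>: "\<And>k. 0 < \<xi> k" "\<And>k. \<xi> k < h k" "\<And>k. (f (x + h k *\<^sub>R e) - f x) / h k = ?D (x + \<xi> k *\<^sub>R e)"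
        by blast
      have "\<xi> \<longlonglongrightarrow> 0"
        by (rule tendsto_sandwich[OF _ _ tendsto_const h(3)]) (use \<xi> in \<open>auto simp: less_imp_le\<close>)
      then have "(\<lambda>k. x + \<xi> k *\<^sub>R e) \<longlonglongrightarrow> x + 0 *\<^sub>R e" by (intro tendsto_intros)
      then have "(\<lambda>k. ?D (x + \<xi> k *\<^sub>R e)) \<longlonglongrightarrow> ?D (x + 0 *\<^sub>R e)"
        using cD by (intro continuous_on_tendsto_compose[OF cD]) auto
      then show "(\<lambda>k. (f (x + h k *\<^sub>R e) - f x) / h k) \<longlonglongrightarrow> ?D x" by (simp add: \<xi>(3))
    qed
  qed measurable
qed

text \<open>The condition on \<open>y\<close> involves only the component of \<open>m\<close> orthogonal to \<open>n\<close>. If this component is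
  nonzero, the exceptional points form a hyperplane. If it vanishes, then \<open>m = - n\<close> and the two
  hyperplanes are parallel and distinct.\<close>
lemma AE_projection_off_hyperplane:
  assumes "norm n = 1" "norm m = 1" "m \<noteq> n" "m = - n \<Longrightarrow> c \<noteq> - b"
  shows "AE y in lborel. m \<bullet> hyperplane_proj n b y \<noteq> (c::real)"
proof (cases "m - (n \<bullet> m) *\<^sub>R n = 0")
  case True
  then have m: "m = (n \<bullet> m) *\<^sub>R n" by simp
  then have "norm m = \<bar>n \<bullet> m\<bar> * norm n" by (metis norm_scaleR)
  then have "n \<bullet> m = 1 \<or> n \<bullet> m = -1" using assms by auto
  then have "m = - n" using m assms(3) by auto
  then show ?thesis using assms hyperplane_proj_in_hyperplane[OF assms(1)] by simp
next
  case False
  then have "AE y in lborel. (m - (n \<bullet> m) *\<^sub>R n) \<bullet> y \<noteq> c - b * (n \<bullet> m)" by (rule AE_not_on_hyperplane)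
  then show ?thesis
    by eventually_elim (auto simp: hyperplane_proj_def inner_diff_left inner_diff_right inner_commute[of m n] algebra_simps)
qed

text \<open>The left-hand side is the limit of the difference quotients
  \<open>(\<integral>\<^bsub>S + h e\<^esub> f - \<integral>\<^bsub>S\<^esub> f) / h\<close>. The indicator of \<open>S\<close> is the product of
  the indicators of the half-spaces. Moving the half-spaces one after the other, as in
  \<open>prod_difference_telescopes\<close>, leaves for each \<open>i\<close> an integral over a slab of thickness
  \<open>h \<bar>n i \<bullet> e\<bar>\<close> along the \<open>i\<close>-th hyperplane, weighted by the indicators of the other
  half-spaces, some of which are already moved. By \<open>thin_slab_limit\<close> it tends to the integral over
  the \<open>i\<close>-th facet, because almost no point of the \<open>i\<close>-th hyperplane lies on another one.\<close>
proposition integral_directional_derivative_polytope: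
  fixes f :: "real ^ 'd \<Rightarrow> real" and n :: "'i \<Rightarrow> real ^ 'd"
  assumes I: "finite I" and n: "\<And>i. i \<in> I \<Longrightarrow> norm (n i) = 1"
    and S: "S = {x. \<forall>i\<in>I. n i \<bullet> x \<le> b i}" "bounded S"
    and ne: "\<And>i j. i \<in> I \<Longrightarrow> j \<in> I \<Longrightarrow> i \<noteq> j \<Longrightarrow> n j \<noteq> n i"
    and op: "\<And>i j. i \<in> I \<Longrightarrow> j \<in> I \<Longrightarrow> n j = - n i \<Longrightarrow> b j \<noteq> - b i"
    and f: "C1 f"
  shows "(LINT x|lborel. indicator S x * frechet_derivative f (at x) e) =
    (\<Sum>i\<in>I. (n i \<bullet> e) * (LINT x|hyperplane_measure {x. n i \<bullet> x = b i}. indicator S x * f x))"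
proof -
  define h where "h k = 1 / real (Suc k)" for k
  have h: "\<And>k. 0 < h k" "\<And>k. h k \<le> 1" "h \<longlonglongrightarrow> 0"
    unfolding h_def using LIMSEQ_inverse_real_of_nat by (simp_all add: inverse_eq_divide)
  obtain R0 where R0: "\<And>x. x \<in> S \<Longrightarrow> norm x \<le> R0" using S by (auto simp: bounded_iff)
  define R where "R = R0 + norm e + 1"
  have cf: "continuous_on A f" for A using f C1_continuous_on by blast
  note [measurable] = borel_measurable_continuous_onI[OF cf]
  have clS: "closed S" unfolding S(1)
    by (simp add: Collect_ball_eq closed_INT closed_halfspace_le)
  then have Sm[measurable]: "S \<in> sets borel" by simp
  define H where "H j x = (indicator {x. n j \<bullet> x \<le> b j} x :: real)" for j and x :: "real^'d"
  have [measurable]: "H j \<in> borel_measurable borel" for j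
  proof -
    have "{x. n j \<bullet> x \<le> b j} \<in> sets borel" by (simp add: closed_halfspace_le)
    then show ?thesis unfolding H_def by simp
  qed
  have indS: "indicator S x = (\<Prod>j\<in>I. H j x)" for x
  proof (cases "x \<in> S")
    case True
    then show ?thesis by (simp add: S(1) H_def)
  next
    case False
    then obtain j where "j \<in> I" "\<not> n j \<bullet> x \<le> b j" by (auto simp: S(1))
    then have "(\<Prod>j\<in>I. H j x) = 0" using I by (intro prod_zero bexI[of _ j]) (auto simp: H_def)
    then show ?thesis using False by simp
  qed
  have H01: "\<bar>H j x\<bar> \<le> 1" for j x by (simp add: H_def indicator_def)
  \<comment> \<open>The slabs are unbounded. Near \<open>S\<close> the cut-off changes nothing, since both \<open>S\<close> and its translates lie inside the ball.\<close>
  define g where "g x = f x * indicator (cball 0 R) x" for x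
  have [measurable]: "g \<in> borel_measurable borel" unfolding g_def
    by (intro borel_measurable_times borel_measurable_indicator) auto
  have "bounded (f ` cball 0 R)"
    by (intro compact_imp_bounded compact_continuous_image cf) auto
  then obtain M0 where "\<forall>y\<in>f ` cball 0 R. norm y \<le> M0" unfolding bounded_iff by blast
  then have M0: "\<And>x. x \<in> cball 0 R \<Longrightarrow> \<bar>f x\<bar> \<le> M0" by auto
  define M where "M = max M0 0"
  have M: "\<bar>g x\<bar> \<le> M" "norm x > R \<Longrightarrow> g x = 0" for x
    using M0[of x] by (auto simp: g_def M_def indicator_def max_def)
  obtain Q where Q: "\<And>a b :: 'i \<Rightarrow> real. (\<Prod>i\<in>I. a i) - (\<Prod>i\<in>I. b i) =
    (\<Sum>i\<in>I. (a i - b i) * (\<Prod>j\<in>I - {i}. if Q i j then a j else b j))"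
    using prod_difference_telescopes[OF I] by blast
  define u where "u i k x = g x * (\<Prod>j\<in>I - {i}. if Q i j then H j (x - h k *\<^sub>R e) else H j x)" for i k x
  have um[measurable]: "u i k \<in> borel_measurable borel" for i k
    unfolding u_def using I
  proof -
    have "(\<lambda>x. if Q i j then H j (x - h k *\<^sub>R e) else H j x) \<in> borel_measurable borel" for j
      by (cases "Q i j") simp_all
    then show "(\<lambda>x. g x * (\<Prod>j\<in>I - {i}. if Q i j then H j (x - h k *\<^sub>R e) else H j x)) \<in> borel_measurable borel"
      by (intro borel_measurable_times borel_measurable_prod) auto
  qed
  have uM: "\<bar>u i k x\<bar> \<le> M" for i k x
  proof -
    have "\<bar>\<Prod>j\<in>I - {i}. if Q i j then H j (x - h k *\<^sub>R e) else H j x\<bar> \<le> 1"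
      unfolding abs_prod by (rule prod_le_1) (simp add: H01)
    then have "\<bar>u i k x\<bar> \<le> M * 1"
      unfolding u_def abs_mult using M(1)[of x] by (intro mult_mono) auto
    then show ?thesis by simp
  qed
  have uR: "norm x > R \<Longrightarrow> u i k x = 0" for i k x using M(2) by (simp add: u_def)
  have uint: "integrable lborel (\<lambda>x. (H i (x - h k *\<^sub>R e) - H i x) * u i k x)" for i k
  proof (rule integrable_bounded_support[where R=R])
    have "\<bar>H i (x - h k *\<^sub>R e) - H i x\<bar> \<le> 1" for x by (simp add: H_def indicator_def)
    then have "\<bar>(H i (x - h k *\<^sub>R e) - H i x) * u i k x\<bar> \<le> 1 * M" for x
      unfolding abs_mult using uM by (intro mult_mono) auto
    then show "\<bar>(H i (x - h k *\<^sub>R e) - H i x) * u i k x\<bar> \<le> M" for x by simp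
    show "(H i (x - h k *\<^sub>R e) - H i x) * u i k x = 0" if "norm x > R" for x
      by (simp only: uR[OF that] mult_zero_right)
  qed measurable

  have quot: "(LINT x|lborel. indicator S x * ((f (x + h k *\<^sub>R e) - f x) / h k)) =
      (\<Sum>i\<in>I. (LINT x|lborel. (H i (x - h k *\<^sub>R e) - H i x) * u i k x) / h k)" for k
  proof -
    let ?t = "h k *\<^sub>R e"
    have te: "norm ?t \<le> norm e" using h(1,2)[of k] by (simp add: less_imp_le mult_left_le_one_le)
    have in1: "indicator S (x - ?t) * f x = indicator S (x - ?t) * g x"
         and in2: "indicator S x * f x = indicator S x * g x" for x
    proof -
      have "x - ?t \<in> S \<Longrightarrow> norm x \<le> R"
        using R0[of "x - ?t"] te norm_triangle_sub[of x ?t] by (simp add: R_def)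
      then show "indicator S (x - ?t) * f x = indicator S (x - ?t) * g x" by (auto simp: g_def indicator_def)
      have "x \<in> S \<Longrightarrow> norm x \<le> R" using R0[of x] norm_ge_zero[of e] unfolding R_def by linarith
      then show "indicator S x * f x = indicator S x * g x" by (auto simp: g_def indicator_def)
    qed
    have iM: "\<bar>indicator A y * g x\<bar> \<le> M" for A x and y :: "real^'d"
      using M(1)[of x] by (cases "y \<in> A") auto
    have gR: "integrable lborel (\<lambda>x. indicator S (x - ?t) * g x)" "integrable lborel (\<lambda>x. indicator S x * g x)"
      by (rule integrable_bounded_support[where R=R and M=M, OF _ iM]; simp add: M(2))+
    have sh: "integrable lborel (\<lambda>x. indicator S x * f (x + ?t))"
      "(LINT x|lborel. indicator S x * f (x + ?t)) = (LINT x|lborel. indicator S (x - ?t) * g x)"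
    proof -
      have fe: "(\<lambda>x. indicator S x * f (x + ?t)) = (\<lambda>x. indicator S ((?t + x) - ?t) * g (?t + x))"
      proof
        fix x
        show "indicator S x * f (x + ?t) = indicator S ((?t + x) - ?t) * g (?t + x)"
          unfolding in1[of "?t + x", symmetric] by (simp add: add.commute)
      qed
      have "(LINT x|lborel. indicator S ((?t + x) - ?t) * g (?t + x)) = (LINT x|lborel. indicator S (x - ?t) * g x)"
        by (rule integral_lborel_translate) measurable
      moreover have "integrable lborel (\<lambda>x. indicator S ((?t + x) - ?t) * g (?t + x))"
      proof (rule integrable_bounded_support[where R="R + norm e" and M=M, OF _ iM])
        fix x :: "real^'d" assume "norm x > R + norm e"
        then have "norm (?t + x) > R" using te norm_diff_ineq[of x ?t] by (simp add: add.commute)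
        then show "indicator S (?t + x - ?t) * g (?t + x) = 0" using M(2) by simp
      qed measurable
      ultimately show "integrable lborel (\<lambda>x. indicator S x * f (x + ?t))"
        "(LINT x|lborel. indicator S x * f (x + ?t)) = (LINT x|lborel. indicator S (x - ?t) * g x)" unfolding fe by blast+
    qed
    have "(LINT x|lborel. indicator S x * ((f (x + ?t) - f x) / h k))
        = (LINT x|lborel. (indicator S x * f (x + ?t) - indicator S x * g x) / h k)"
      unfolding in2[symmetric] by (simp add: right_diff_distrib)
    also have "\<dots> = ((LINT x|lborel. indicator S (x - ?t) * g x) - (LINT x|lborel. indicator S x * g x)) / h k"
      using sh gR by simp
    also have "\<dots> = (LINT x|lborel. indicator S (x - ?t) * g x - indicator S x * g x) / h k"
      using gR by simp
    also have "(\<lambda>x. indicator S (x - ?t) * g x - indicator S x * g x) = (\<lambda>x. \<Sum>i\<in>I. (H i (x - ?t) - H i x) * u i k x)"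
    proof
      fix x
      have "indicator S (x - ?t) * g x - indicator S x * g x = g x * ((\<Prod>j\<in>I. H j (x - ?t)) - (\<Prod>j\<in>I. H j x))"
        by (simp add: indS algebra_simps)
      then show "indicator S (x - ?t) * g x - indicator S x * g x = (\<Sum>i\<in>I. (H i (x - ?t) - H i x) * u i k x)"
        unfolding Q u_def by (simp add: sum_distrib_left ac_simps)
    qed
    finally show ?thesis using uint by (simp add: sum_divide_distrib)
  qed

  let ?v = "\<lambda>x. indicator S x * f x"
  have conv: "AE y in lborel. \<forall>x. x \<longlonglongrightarrow> hyperplane_proj (n i) (b i) y \<longrightarrow> (\<lambda>k. u i k (x k)) \<longlonglongrightarrow> ?v (hyperplane_proj (n i) (b i) y)"
    if i: "i \<in> I" for i
  proof -
    have "AE y in lborel. \<forall>j\<in>I - {i}. n j \<bullet> hyperplane_proj (n i) (b i) y \<noteq> b j"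
      by (rule AE_finite_allI) (use I i n ne op in \<open>auto intro!: AE_projection_off_hyperplane\<close>)
    then show ?thesis
    proof (eventually_elim, intro allI impI)
      case (elim y)
      fix x assume x: "x \<longlonglongrightarrow> hyperplane_proj (n i) (b i) y"
      let ?z = "hyperplane_proj (n i) (b i) y"
      have x': "(\<lambda>k. x k - h k *\<^sub>R e) \<longlonglongrightarrow> ?z"
        using tendsto_diff[OF x tendsto_scaleR[OF h(3) tendsto_const]] by simp
      have zi: "n i \<bullet> ?z = b i" using n i by (simp add: hyperplane_proj_in_hyperplane)
      have in_lim: "eventually (\<lambda>k. n j \<bullet> x k < b j \<and> n j \<bullet> (x k - h k *\<^sub>R e) < b j) sequentially"
        if "n j \<bullet> ?z < b j" for j
        using that by (intro eventually_conj order_tendstoD(2)[OF tendsto_inner[OF tendsto_const x]]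
              order_tendstoD(2)[OF tendsto_inner[OF tendsto_const x']])
      have out_lim: "eventually (\<lambda>k. n j \<bullet> x k > b j \<and> n j \<bullet> (x k - h k *\<^sub>R e) > b j) sequentially"
        if "n j \<bullet> ?z > b j" for j
        using that by (intro eventually_conj order_tendstoD(1)[OF tendsto_inner[OF tendsto_const x]]
              order_tendstoD(1)[OF tendsto_inner[OF tendsto_const x']])
      show "(\<lambda>k. u i k (x k)) \<longlonglongrightarrow> ?v ?z"
      proof (cases "?z \<in> S")
        case True
        then have "\<forall>j\<in>I - {i}. n j \<bullet> ?z < b j" using elim by (force simp: S(1))
        then have "eventually (\<lambda>k. \<forall>j\<in>I - {i}. n j \<bullet> x k < b j \<and> n j \<bullet> (x k - h k *\<^sub>R e) < b j) sequentially"
          using in_lim I by (intro eventually_ball_finite) auto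
        moreover have "norm ?z < R" using R0[OF True] norm_ge_zero[of e] unfolding R_def by linarith
        then have "eventually (\<lambda>k. norm (x k) < R) sequentially"
          using x by (intro order_tendstoD(2)[OF tendsto_norm])
        ultimately have "eventually (\<lambda>k. f (x k) = u i k (x k)) sequentially"
        proof eventually_elim
          case (elim k)
          then have "(\<Prod>j\<in>I - {i}. if Q i j then H j (x k - h k *\<^sub>R e) else H j (x k)) = 1"
            by (intro prod.neutral) (auto simp: H_def less_imp_le)
          then show ?case using elim by (simp add: u_def g_def)
        qed
        moreover have "(\<lambda>k. f (x k)) \<longlonglongrightarrow> f ?z"
          using x by (intro continuous_on_tendsto_compose[OF cf[of UNIV]]) auto
        ultimately show ?thesis using True by (auto intro: Lim_transform_eventually)
      next
        case False
        then obtain j where j: "j \<in> I" "n j \<bullet> ?z > b j" by (auto simp: S(1) not_le)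
        then have "j \<in> I - {i}" using zi by auto
        have "eventually (\<lambda>k. u i k (x k) = 0) sequentially"
          using out_lim[OF j(2)]
        proof eventually_elim
          case (elim k)
          then have "(\<Prod>j\<in>I - {i}. if Q i j then H j (x k - h k *\<^sub>R e) else H j (x k)) = 0"
            using I \<open>j \<in> I - {i}\<close> by (intro prod_zero bexI[of _ j]) (auto simp: H_def)
          then show ?case by (simp add: u_def)
        qed
        then show ?thesis using False by (auto intro: tendsto_eventually)
      qed
    qed
  qed
  have vm: "?v \<in> borel_measurable borel" by measurable

  have lim: "(\<lambda>k. (LINT x|lborel. (H i (x - h k *\<^sub>R e) - H i x) * u i k x) / h k) \<longlonglongrightarrow>
      (n i \<bullet> e) * (LINT x|hyperplane_measure {x. n i \<bullet> x = b i}. ?v x)" if i: "i \<in> I" for i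
  proof -
    let ?c = "n i \<bullet> e"
    have Hs: "H i (x - h k *\<^sub>R e) = indicator {x. n i \<bullet> x \<le> b i + h k * ?c} x" for x k
      by (simp add: H_def indicator_def inner_diff_right algebra_simps)
    have rlim: "(\<lambda>k. hyperplane_proj (n i) (b i) y + r k *\<^sub>R m) \<longlonglongrightarrow> hyperplane_proj (n i) (b i) y"
      if r: "\<forall>k. 0 \<le> r k \<and> r k < h k * \<bar>?c\<bar>" for r and y m :: "real^'d"
    proof -
      have "(\<lambda>k. h k * \<bar>?c\<bar>) \<longlonglongrightarrow> 0 * \<bar>?c\<bar>" by (intro tendsto_intros h)
      then have "r \<longlonglongrightarrow> 0"
        by (intro tendsto_sandwich[OF _ _ tendsto_const, of 0 r _ "\<lambda>k. h k * \<bar>?c\<bar>"])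
          (use r in \<open>auto simp: less_imp_le\<close>)
      then have "(\<lambda>k. hyperplane_proj (n i) (b i) y + r k *\<^sub>R m) \<longlonglongrightarrow> hyperplane_proj (n i) (b i) y + 0 *\<^sub>R m"
        by (intro tendsto_intros)
      then show ?thesis by simp
    qed
    have wlim: "(\<lambda>k. h k * \<bar>?c\<bar>) \<longlonglongrightarrow> 0" using tendsto_mult[OF h(3) tendsto_const] by auto
    \<comment> \<open>If \<open>?c < 0\<close> the half-space shrinks. The slab then lies on its inner side, and reversing the normal reduces this case to the previous one.\<close>
    consider "?c = 0" | "?c > 0" | "?c < 0" by linarith
    then show ?thesis
    proof cases
      case 1 then show ?thesis by (simp add: Hs) (simp add: H_def)
    next
      case 2
      have "(\<lambda>k. (LINT x|lborel. indicator {x. 0 \<le> n i \<bullet> x - b i \<and> n i \<bullet> x - b i < h k * \<bar>?c\<bar>} x * u i k x) / (h k * \<bar>?c\<bar>))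
        \<longlonglongrightarrow> (LINT x|hyperplane_measure {x. n i \<bullet> x = b i}. ?v x)"
      proof (rule thin_slab_limit[OF n[OF i] _ wlim um vm uM uR])
        show "0 < h k * \<bar>?c\<bar>" for k using h 2 by simp
        show "AE y in lborel. \<forall>r. (\<forall>k. 0 \<le> r k \<and> r k < h k * \<bar>?c\<bar>) \<longrightarrow>
          (\<lambda>k. u i k (hyperplane_proj (n i) (b i) y + r k *\<^sub>R n i)) \<longlonglongrightarrow> ?v (hyperplane_proj (n i) (b i) y)"
          using conv[OF i] proof eventually_elim
            case (elim y)
            show ?case by (intro allI impI, rule elim[rule_format, OF rlim])
          qed
      qed
      then have "(\<lambda>k. ?c * ((LINT x|lborel. indicator {x. 0 \<le> n i \<bullet> x - b i \<and> n i \<bullet> x - b i < h k * \<bar>?c\<bar>} x * u i k x) / (h k * \<bar>?c\<bar>)))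
        \<longlonglongrightarrow> ?c * (LINT x|hyperplane_measure {x. n i \<bullet> x = b i}. ?v x)" by (rule tendsto_mult_left)
      moreover have "(LINT x|lborel. indicator {x. 0 \<le> n i \<bullet> x - b i \<and> n i \<bullet> x - b i < h k * \<bar>?c\<bar>} x * u i k x)
         = (LINT x|lborel. (H i (x - h k *\<^sub>R e) - H i x) * u i k x)" for k
      proof (rule integral_cong_AE)
        have "n i \<noteq> 0" using n[OF i] by auto
        then have "AE x in lborel. n i \<bullet> x \<noteq> b i" "AE x in lborel. n i \<bullet> x \<noteq> b i + h k * ?c" by (rule AE_not_on_hyperplane)+
        then show "AE x in lborel. indicator {x. 0 \<le> n i \<bullet> x - b i \<and> n i \<bullet> x - b i < h k * \<bar>?c\<bar>} x * u i k x =
          (H i (x - h k *\<^sub>R e) - H i x) * u i k x"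
        proof eventually_elim
          case (elim x)
          have "0 < h k * ?c" using 2 h by simp
          then have "indicator {x. 0 \<le> n i \<bullet> x - b i \<and> n i \<bullet> x - b i < h k * \<bar>?c\<bar>} x = H i (x - h k *\<^sub>R e) - H i x"
            using elim 2 unfolding Hs by (auto simp: H_def indicator_def)
          then show ?case by simp
        qed
      qed measurable
      moreover have "?c * (I / (h k * \<bar>?c\<bar>)) = I / h k" for I k using 2 h(1)[of k] by simp
      ultimately show ?thesis by simp
    next
      case 3
      have hyp: "{x. - n i \<bullet> x = - b i} = {x. n i \<bullet> x = b i}" by auto
      have pr: "hyperplane_proj (- n i) (- b i) = hyperplane_proj (n i) (b i)" by (simp add: hyperplane_proj_def fun_eq_iff algebra_simps)
      have "(\<lambda>k. (LINT x|lborel. indicator {x. 0 \<le> - n i \<bullet> x - - b i \<and> - n i \<bullet> x - - b i < h k * \<bar>?c\<bar>} x * u i k x) / (h k * \<bar>?c\<bar>))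
        \<longlonglongrightarrow> (LINT x|hyperplane_measure {x. - n i \<bullet> x = - b i}. ?v x)"
      proof (rule thin_slab_limit[OF _ _ wlim um vm uM uR])
        show "norm (- n i) = 1" using n i by simp
        show "0 < h k * \<bar>?c\<bar>" for k by (rule mult_pos_pos) (use h(1) 3 in auto)
        show "AE y in lborel. \<forall>r. (\<forall>k. 0 \<le> r k \<and> r k < h k * \<bar>?c\<bar>) \<longrightarrow>
          (\<lambda>k. u i k (hyperplane_proj (- n i) (- b i) y + r k *\<^sub>R (- n i))) \<longlonglongrightarrow> ?v (hyperplane_proj (- n i) (- b i) y)"
          unfolding pr using conv[OF i] proof eventually_elim
            case (elim y)
            show ?case by (intro allI impI, rule elim[rule_format, OF rlim])
          qed
      qed
      then have "(\<lambda>k. ?c * ((LINT x|lborel. indicator {x. 0 \<le> - n i \<bullet> x - - b i \<and> - n i \<bullet> x - - b i < h k * \<bar>?c\<bar>} x * u i k x) / (h k * \<bar>?c\<bar>)))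
        \<longlonglongrightarrow> ?c * (LINT x|hyperplane_measure {x. n i \<bullet> x = b i}. ?v x)" unfolding hyp by (rule tendsto_mult_left)
      moreover have "indicator {x. 0 \<le> - n i \<bullet> x - - b i \<and> - n i \<bullet> x - - b i < h k * \<bar>?c\<bar>} x * u i k x
         = - ((H i (x - h k *\<^sub>R e) - H i x) * u i k x)" for k x
      proof -
        have "h k * ?c < 0" using 3 h(1)[of k] by (simp add: mult_pos_neg)
        then have eq: "indicator {x. 0 \<le> - n i \<bullet> x - - b i \<and> - n i \<bullet> x - - b i < h k * \<bar>?c\<bar>} x = H i x - H i (x - h k *\<^sub>R e)"
          using 3 unfolding Hs by (auto simp: H_def indicator_def)
        show ?thesis unfolding eq by (simp add: algebra_simps)
      qed
      moreover have "?c * (- I / (h k * \<bar>?c\<bar>)) = I / h k" for I k using 3 h(1)[of k] by simp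
      ultimately show ?thesis by simp
    qed
  qed
  have "(\<lambda>k. LINT x|lborel. indicator S x * ((f (x + h k *\<^sub>R e) - f x) / h k)) \<longlonglongrightarrow>
     (\<Sum>i\<in>I. (n i \<bullet> e) * (LINT x|hyperplane_measure {x. n i \<bullet> x = b i}. ?v x))"
    unfolding quot by (intro tendsto_sum lim)
  moreover have "(\<lambda>k. LINT x|lborel. indicator S x * ((f (x + h k *\<^sub>R e) - f x) / h k)) \<longlonglongrightarrow>
     (LINT x|lborel. indicator S x * frechet_derivative f (at x) e)"
    by (rule difference_quotient_integral_limit[OF f S(2) Sm h])
  ultimately show ?thesis by (rule LIMSEQ_unique[rotated])
qed

section \<open>Facets of polytopes and meshes\<close>

text \<open>The properties of open simplices on which the geometry of facets rests.\<close>
definition open_polytope :: "(real ^ 'd) set \<Rightarrow> bool" where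
  "open_polytope K \<longleftrightarrow> polytope (closure K) \<and> K = interior (closure K) \<and> K \<noteq> {}"

lemma open_polytopeD:
  assumes "open_polytope K"
  shows "polytope (closure K)" "interior (closure K) = K" "K \<noteq> {}" "open K"
proof -
  show "polytope (closure K)" "interior (closure K) = K" "K \<noteq> {}"
    using assms unfolding open_polytope_def by auto
  then show "open K" using open_interior[of "closure K"] by simp
qed

text \<open>The outward normal is constant on its facet, so any point of the facet may be chosen.\<close>
definition facet_level :: "(real ^ 'd) set \<Rightarrow> (real ^ 'd) set \<Rightarrow> real" where
  "facet_level K F = outward_normal K F \<bullet> (SOME y. y \<in> F)"

lemma interior_halfspace_strict:
  fixes a :: "'a::euclidean_space"
  assumes "S \<subseteq> {x. a \<bullet> x \<le> b}" "a \<noteq> 0" "x \<in> interior S"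
  shows "a \<bullet> x < b"
  using interior_mono[OF assms(1)] assms(2,3) by (auto simp: interior_halfspace_le)

lemma unit_normals_of_hyperplane:
  fixes m n :: "'a::euclidean_space"
  assumes "norm m = 1" "norm n = 1" "{x. n \<bullet> x = b} \<subseteq> {x. m \<bullet> x = c}"
  shows "m = n \<or> m = - n"
proof -
  have nn: "n \<bullet> n = 1" using assms by (simp add: dot_square_norm)
  define z where "z = m - (m \<bullet> n) *\<^sub>R n"
  have nz: "n \<bullet> z = 0" by (simp add: z_def inner_diff_right nn inner_commute)
  have "b *\<^sub>R n \<in> {x. n \<bullet> x = b}" "b *\<^sub>R n + z \<in> {x. n \<bullet> x = b}"
    by (auto simp: inner_add_right nz nn)
  then have "m \<bullet> (b *\<^sub>R n) = c" "m \<bullet> (b *\<^sub>R n + z) = c" using assms(3) by blast+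
  then have "m \<bullet> z = 0" by (simp add: inner_add_right)
  then have "z \<bullet> z = 0" using nz by (subst (1) z_def) (simp add: inner_diff_left)
  then have m: "m = (m \<bullet> n) *\<^sub>R n" by (simp add: z_def)
  then have "norm m = \<bar>m \<bullet> n\<bar> * norm n" by (metis norm_scaleR)
  then have "m \<bullet> n = 1 \<or> m \<bullet> n = -1" using assms by auto
  then show ?thesis using m by (metis scaleR_minus1_left scaleR_one)
qed

lemma affine_hull_facet:
  fixes F :: "(real ^ 'd) set"
  assumes "open_polytope K" "F facet_of closure K" "norm n = 1" "F \<subseteq> {x. n \<bullet> x = b}"
  shows "affine hull F = {x. n \<bullet> x = b}"
proof -
  have "interior (closure K) \<noteq> {}" using open_polytopeD[OF assms(1)] by simp
  then have "aff_dim (closure K) = DIM(real^'d)" by (rule aff_dim_nonempty_interior)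
  then have dF: "aff_dim F = DIM(real^'d) - 1" using assms(2) by (simp add: facet_of_def)
  have "n \<noteq> 0" using assms(3) by auto
  then have dH: "aff_dim {x. n \<bullet> x = b} = DIM(real^'d) - 1" by (rule aff_dim_hyperplane)
  have "F \<noteq> {}" using assms(2) by (auto simp: facet_of_def)
  moreover have "affine hull F \<subseteq> {x. n \<bullet> x = b}" using assms(4) by (intro hull_minimal affine_hyperplane)
  ultimately show ?thesis
    using dF dH by (intro affine_dim_equal) (auto simp: affine_hyperplane)
qed

text \<open>A supporting hyperplane of the facet provides a candidate. A vector that separates \<open>K\<close> from \<open>F\<close>
  weakly separates the closure from \<open>F\<close> as well, hence is constant on \<open>F\<close> and normal to its affine
  hull; the sign is fixed by any point of \<open>K\<close>. So the description in the definition is unique and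
  the candidate is the outward normal.\<close>
lemma outward_normal_facet:
  fixes K :: "(real ^ 'd) set"
  assumes K: "open_polytope K" and F: "F facet_of closure K"
  defines "n \<equiv> outward_normal K F" and "b \<equiv> facet_level K F"
  shows "norm n = 1" "\<And>x. x \<in> K \<Longrightarrow> n \<bullet> x < b" "\<And>x. x \<in> closure K \<Longrightarrow> n \<bullet> x \<le> b"
    "F = closure K \<inter> {x. n \<bullet> x = b}" "affine hull F = {x. n \<bullet> x = b}"
proof -
  let ?S = "closure K"
  have S: "polytope ?S" "K = interior ?S" "K \<noteq> {}" using open_polytopeD[OF K] by simp_all
  obtain a c where a: "a \<noteq> 0" "?S \<subseteq> {x. a \<bullet> x \<le> c}" "F = ?S \<inter> {x. a \<bullet> x = c}"
    using facet_of_polyhedron[OF polytope_imp_polyhedron[OF S(1)] F] by blast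
  define m where "m = a /\<^sub>R norm a"
  have ma: "m \<bullet> x = (a \<bullet> x) / norm a" for x by (simp add: m_def divide_inverse)
  have m: "norm m = 1" using a(1) by (simp add: m_def)
  have ineq: "m \<bullet> x < m \<bullet> y" if "x \<in> K" "y \<in> F" for x y
  proof -
    have "a \<bullet> x < c" using that(1) S(2) a(1,2) by (intro interior_halfspace_strict[of ?S]) auto
    moreover have "a \<bullet> y = c" using that(2) a(3) by auto
    ultimately show ?thesis using a(1) by (simp add: ma divide_strict_right_mono)
  qed
  obtain x0 where x0: "x0 \<in> K" using S(3) by blast
  obtain y0 where y0: "y0 \<in> F" using F by (auto simp: facet_of_def)
  have FH: "F \<subseteq> {x. m \<bullet> x = c / norm a}" using a(3) by (auto simp: ma)
  have aff: "affine hull F = {x. m \<bullet> x = c / norm a}" by (rule affine_hull_facet[OF K F m FH])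
  have uniq: "m' = m" if m': "norm m' = 1" "\<And>x y. x \<in> K \<Longrightarrow> y \<in> F \<Longrightarrow> m' \<bullet> x < m' \<bullet> y" for m'
  proof -
    have le: "m' \<bullet> x \<le> m' \<bullet> y" if "x \<in> ?S" "y \<in> F" for x y
      using that(1)
    proof (rule continuous_le_on_closure[where f="\<lambda>x. m' \<bullet> x", rotated])
      show "continuous_on ?S (\<lambda>x. m' \<bullet> x)" by (intro continuous_intros)
    qed (use m'(2)[OF _ that(2)] in \<open>simp add: less_imp_le\<close>)
    have "m' \<bullet> y = m' \<bullet> y0" if "y \<in> F" for y
      using le[of y y0] le[of y0 y] that y0 a(3) by (intro antisym) auto
    then have FH': "F \<subseteq> {x. m' \<bullet> x = m' \<bullet> y0}" by blast
    then have "{x. m \<bullet> x = c / norm a} = {x. m' \<bullet> x = m' \<bullet> y0}"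
      using aff affine_hull_facet[OF K F m'(1) FH'] by simp
    then have "m' = m \<or> m' = - m" by (intro unit_normals_of_hyperplane[OF m'(1) m]) auto
    moreover have "m' \<noteq> - m"
      using ineq[OF x0 y0] m'(2)[OF x0 y0] by auto
    ultimately show ?thesis by blast
  qed
  have n: "n = m"
    unfolding n_def outward_normal_def
  proof (rule the_equality)
    show "norm m = 1 \<and> (\<forall>x\<in>K. \<forall>y\<in>F. m \<bullet> x < m \<bullet> y)" using m ineq by simp
    fix m' assume "norm m' = 1 \<and> (\<forall>x\<in>K. \<forall>y\<in>F. m' \<bullet> x < m' \<bullet> y)"
    then show "m' = m" by (intro uniq) auto
  qed
  have "(SOME y. y \<in> F) \<in> F" using y0 by (rule someI)
  then have b: "b = c / norm a"
    unfolding b_def facet_level_def n_def[symmetric] n using FH by blast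
  show "norm n = 1" using m n by simp
  show "affine hull F = {x. n \<bullet> x = b}" using aff n b by simp
  show "n \<bullet> x \<le> b" if "x \<in> ?S" for x
    using that a(1,2) unfolding n b ma by (auto intro: divide_right_mono)
  show "F = ?S \<inter> {x. n \<bullet> x = b}" unfolding n b ma a(3) using a(1) by auto
  show "n \<bullet> x < b" if "x \<in> K" for x
    using ineq[OF that y0] FH y0 unfolding n b by auto
qed

text \<open>In a representation of the polytope by a minimal set of half-spaces each of them cuts out a
  facet, whose outward normal is the normal of the half-space.\<close>
lemma closure_eq_facet_halfspaces:
  fixes K :: "(real ^ 'd) set"
  assumes K: "open_polytope K"
  shows "closure K = {x. \<forall>F\<in>{F. F facet_of closure K}. outward_normal K F \<bullet> x \<le> facet_level K F}"
proof
  show "closure K \<subseteq> {x. \<forall>F\<in>{F. F facet_of closure K}. outward_normal K F \<bullet> x \<le> facet_level K F}"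
    using outward_normal_facet(3)[OF K] by blast
  let ?S = "closure K"
  have S: "polytope ?S" "interior ?S \<noteq> {}" using open_polytopeD[OF K] by simp_all
  have UN: "affine hull ?S = UNIV"
    using affine_hull_nonempty_interior S(2) by blast
  obtain H where H: "finite H" "?S = affine hull ?S \<inter> \<Inter>H"
     "\<forall>h\<in>H. \<exists>a b. a \<noteq> 0 \<and> h = {x. a \<bullet> x \<le> b}" "\<forall>F'. F' \<subset> H \<longrightarrow> ?S \<subset> (affine hull ?S) \<inter> \<Inter>F'"
    using iffD1[OF polyhedron_Int_affine_minimal polytope_imp_polyhedron[OF S(1)]] by (elim exE conjE)
  obtain a where "\<forall>h\<in>H. \<exists>b. a h \<noteq> 0 \<and> h = {x. a h \<bullet> x \<le> b}"
    using bchoice[OF H(3)] by (elim exE)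
  from bchoice[OF this] obtain b where ab': "\<forall>h\<in>H. a h \<noteq> 0 \<and> h = {x. a h \<bullet> x \<le> b h}"
    by (elim exE)
  then have ab: "\<And>h. h \<in> H \<Longrightarrow> a h \<noteq> 0 \<and> h = {x. a h \<bullet> x \<le> b h}" by (rule bspec)
  have Hmin: "\<And>F'. F' \<subset> H \<Longrightarrow> ?S \<subset> (affine hull ?S) \<inter> \<Inter>F'" using H(4) by simp
  show "{x. \<forall>F\<in>{F. F facet_of closure K}. outward_normal K F \<bullet> x \<le> facet_level K F} \<subseteq> closure K"
  proof
    fix x assume x: "x \<in> {x. \<forall>F\<in>{F. F facet_of closure K}. outward_normal K F \<bullet> x \<le> facet_level K F}"
    have "x \<in> h" if h: "h \<in> H" for h
    proof -
      define F where "F = ?S \<inter> {x. a h \<bullet> x = b h}"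
      have F: "F facet_of ?S"
        unfolding F_def by (rule iffD2[OF facet_of_polyhedron_explicit[OF H(1,2) ab Hmin]])
          (assumption, assumption, rule exI[of _ h], simp add: h)
      obtain y where y: "y \<in> F" using F by (auto simp: facet_of_def)
      let ?m = "a h /\<^sub>R norm (a h)"
      have nz: "a h \<noteq> 0" using ab[OF h] by (rule conjunct1)
      have hH: "h = {x. a h \<bullet> x \<le> b h}" using ab[OF h] by (rule conjunct2)
      have m: "norm ?m = 1" using nz by simp
      have mx: "?m \<bullet> x = (a h \<bullet> x) / norm (a h)" for x by (simp add: divide_inverse)
      have FH: "F \<subseteq> {x. ?m \<bullet> x = b h / norm (a h)}" unfolding mx F_def by auto
      have "{x. outward_normal K F \<bullet> x = facet_level K F} = {x. ?m \<bullet> x = b h / norm (a h)}"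
        using outward_normal_facet(5)[OF K F] affine_hull_facet[OF K F m FH] by simp
      then have "?m = outward_normal K F \<or> ?m = - outward_normal K F"
        by (intro unit_normals_of_hyperplane[OF m outward_normal_facet(1)[OF K F]]) auto
      moreover have "?m \<noteq> - outward_normal K F"
      proof
        assume *: "?m = - outward_normal K F"
        obtain x0 where x0: "x0 \<in> interior ?S" using S(2) by blast
        have "?S \<subseteq> h" using H(2) h by blast
        then have "a h \<bullet> x0 < b h" using nz x0 by (intro interior_halfspace_strict[of ?S]) (subst hH[symmetric])
        then have "?m \<bullet> x0 < ?m \<bullet> y" using y nz unfolding mx F_def by (auto intro: divide_strict_right_mono)
        moreover have "outward_normal K F \<bullet> x0 < outward_normal K F \<bullet> y"
        proof -
          have "x0 \<in> K" using x0 open_polytopeD(2)[OF K] by simp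
          moreover have "outward_normal K F \<bullet> y = facet_level K F" using outward_normal_facet(4)[OF K F] y by blast
          ultimately show ?thesis using outward_normal_facet(2)[OF K F] by simp
        qed
        ultimately show False unfolding * by simp
      qed
      ultimately have m_eq: "?m = outward_normal K F" by blast
      have "?m \<bullet> y = b h / norm (a h)" using FH y by blast
      moreover have "outward_normal K F \<bullet> y = facet_level K F" using outward_normal_facet(4)[OF K F] y by blast
      ultimately have "facet_level K F = b h / norm (a h)" using m_eq by simp
      moreover have "outward_normal K F \<bullet> x \<le> facet_level K F" using x F by blast
      ultimately have "(a h \<bullet> x) / norm (a h) \<le> b h / norm (a h)" unfolding m_eq[symmetric] mx by simp
      then have "a h \<bullet> x \<le> b h" using nz by (simp add: divide_le_cancel)
      then show ?thesis by (subst hH) simp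
    qed
    then have "x \<in> affine hull ?S \<inter> \<Inter>H" using UN by simp
    then show "x \<in> closure K" using H(2) by blast
  qed
qed

lemma facet_eq_of_normal_eq:
  fixes K :: "(real ^ 'd) set"
  assumes K: "open_polytope K" and F: "F facet_of closure K" and G: "G facet_of closure K"
    and eq: "outward_normal K F = outward_normal K G"
  shows "F = G"
proof -
  obtain y z where yz: "y \<in> F" "z \<in> G" using F G by (auto simp: facet_of_def)
  note f = outward_normal_facet[OF K F] and g = outward_normal_facet[OF K G]
  have y: "y \<in> closure K \<inter> {x. outward_normal K F \<bullet> x = facet_level K F}" using f(4) yz(1) by blast
  have z: "z \<in> closure K \<inter> {x. outward_normal K G \<bullet> x = facet_level K G}" using g(4) yz(2) by blast
  have "facet_level K F = outward_normal K F \<bullet> y" "facet_level K G = outward_normal K G \<bullet> z" "y \<in> closure K" "z \<in> closure K"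
    using y z by simp_all
  then have "facet_level K F = facet_level K G" using f(3)[of z] g(3)[of y] eq by simp
  then show ?thesis using f(4) g(4) eq by simp
qed

text \<open>Otherwise a point of \<open>K\<close> would lie strictly on both sides of one hyperplane.\<close>
lemma opposite_facets_not_coplanar:
  fixes K :: "(real ^ 'd) set"
  assumes K: "open_polytope K" and F: "F facet_of closure K" and G: "G facet_of closure K"
    and eq: "outward_normal K F = - outward_normal K G"
  shows "facet_level K F \<noteq> - facet_level K G"
proof -
  obtain x where "x \<in> K" using K by (auto simp: open_polytope_def)
  then show ?thesis
    using outward_normal_facet(2)[OF K F] outward_normal_facet(2)[OF K G] eq by fastforce
qed

text \<open>A face that contains a relative interior point of \<open>F\<close> contains \<open>F\<close>, and two facets have the
  same dimension.\<close>
lemma rel_interior_facet_only: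
  fixes K :: "(real ^ 'd) set"
  assumes K: "open_polytope K" and F: "F facet_of closure K" and G: "G facet_of closure K"
    and x: "x \<in> rel_interior F" and ne: "F \<noteq> G"
  shows "outward_normal K G \<bullet> x < facet_level K G"
proof (rule ccontr)
  assume "\<not> outward_normal K G \<bullet> x < facet_level K G"
  moreover have xS: "x \<in> F" "x \<in> closure K"
    using x rel_interior_subset F facet_of_imp_subset by blast+
  ultimately have "x \<in> G" using outward_normal_facet(3,4)[OF K G] by force
  have Gf: "G face_of closure K" and Ff: "F face_of closure K" using F G facet_of_imp_face_of by blast+
  have "F \<subseteq> G"
    by (rule subset_of_face_of[OF Gf]) (use x \<open>x \<in> G\<close> F facet_of_imp_subset in blast)+
  moreover have "aff_dim F = aff_dim G" using F G by (simp add: facet_of_def)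
  moreover have "affine hull F \<subseteq> affine hull G" using \<open>F \<subseteq> G\<close> by (rule hull_mono)
  ultimately have "affine hull F = affine hull G" using xS by (intro affine_dim_equal) auto
  then have "F = G"
    using outward_normal_facet(4,5)[OF K F] outward_normal_facet(4,5)[OF K G] by simp
  then show False using ne by simp
qed

lemma finite_facets_of: "open_polytope K \<Longrightarrow> finite {F. F facet_of closure K}"
  by (simp add: finite_polytope_facets open_polytope_def)

lemma inward_of_facet_in_polytope:
  fixes K :: "(real ^ 'd) set"
  assumes K: "open_polytope K" and F: "F facet_of closure K" and x: "x \<in> rel_interior F"
  shows "eventually (\<lambda>t. x - t *\<^sub>R outward_normal K F \<in> K) (at_right 0)"
proof -
  let ?n = "outward_normal K" and ?b = "facet_level K" and ?I = "{F. F facet_of closure K}"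
  have "eventually (\<lambda>t. \<forall>G\<in>?I. ?n G \<bullet> (x - t *\<^sub>R ?n F) < ?b G) (at_right 0)"
  proof (rule eventually_ball_finite[OF finite_facets_of[OF K]], rule ballI)
    fix G assume G: "G \<in> ?I"
    show "eventually (\<lambda>t. ?n G \<bullet> (x - t *\<^sub>R ?n F) < ?b G) (at_right 0)"
    proof (cases "G = F")
      case True
      have "?n F \<bullet> x = ?b F" using outward_normal_facet(4)[OF K F] x rel_interior_subset by blast
      moreover have "?n F \<bullet> ?n F = 1" using outward_normal_facet(1)[OF K F] by (rule inner_self_unit)
      ultimately have "?n G \<bullet> (x - t *\<^sub>R ?n F) = ?b G - t" for t using True by (simp add: inner_diff_right)
      then show ?thesis by (auto simp: eventually_at_right_less)
    next
      case False
      have "((\<lambda>t. ?n G \<bullet> (x - t *\<^sub>R ?n F)) \<longlongrightarrow> ?n G \<bullet> (x - 0 *\<^sub>R ?n F)) (at_right 0)"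
        by (intro tendsto_intros)
      then show ?thesis
        using rel_interior_facet_only[OF K F _ x] G False by (intro order_tendstoD(2)) auto
    qed
  qed
  moreover have "y \<in> K" if "\<forall>G\<in>?I. ?n G \<bullet> y < ?b G" for y
  proof -
    have "open (\<Inter>G\<in>?I. {z. ?n G \<bullet> z < ?b G})"
      using finite_facets_of[OF K] by (intro open_INT) (auto intro: open_halfspace_lt)
    moreover have "(\<Inter>G\<in>?I. {z. ?n G \<bullet> z < ?b G}) \<subseteq> closure K"
      by (subst closure_eq_facet_halfspaces[OF K]) (auto simp: less_imp_le)
    ultimately have "(\<Inter>G\<in>?I. {z. ?n G \<bullet> z < ?b G}) \<subseteq> interior (closure K)" by (rule interior_maximal[rotated])
    then show ?thesis using that open_polytopeD(2)[OF K] by auto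
  qed
  ultimately show ?thesis by (rule eventually_mono)
qed

text \<open>A small step from the facet against the common normal leads into both elements.\<close>
lemma common_normal_elements_intersect:
  fixes K L :: "(real ^ 'd) set"
  assumes K: "open_polytope K" and L: "open_polytope L"
    and F: "F facet_of closure K" "F facet_of closure L"
    and eq: "outward_normal K F = outward_normal L F"
  shows "K \<inter> L \<noteq> {}"
proof -
  have "F \<noteq> {}" "convex F" using F(1) K by (auto simp: facet_of_def intro: face_of_imp_convex)
  then obtain x where x: "x \<in> rel_interior F" using rel_interior_eq_empty by blast
  have "eventually (\<lambda>t. x - t *\<^sub>R outward_normal K F \<in> K \<and> x - t *\<^sub>R outward_normal K F \<in> L) (at_right 0)"
    using inward_of_facet_in_polytope[OF K F(1) x] inward_of_facet_in_polytope[OF L F(2) x] eq by (auto intro: eventually_conj)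
  then obtain t where "x - t *\<^sub>R outward_normal K F \<in> K \<and> x - t *\<^sub>R outward_normal K F \<in> L"
    using eventually_happens'[OF trivial_limit_at_right_real] by blast
  then show ?thesis by blast
qed

lemma normal_same_or_opposite:
  fixes K L :: "(real ^ 'd) set"
  assumes K: "open_polytope K" and L: "open_polytope L"
    and F: "F facet_of closure K" "F facet_of closure L"
  shows "outward_normal L F = outward_normal K F \<or> outward_normal L F = - outward_normal K F"
proof -
  have "{x. outward_normal K F \<bullet> x = facet_level K F} = {x. outward_normal L F \<bullet> x = facet_level L F}"
    using outward_normal_facet(5)[OF K F(1)] outward_normal_facet(5)[OF L F(2)] by simp
  then show ?thesis
    by (intro unit_normals_of_hyperplane[OF outward_normal_facet(1)[OF L F(2)] outward_normal_facet(1)[OF K F(1)]]) auto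
qed

lemma mesh_open_polytope:
  fixes \<T> :: "(real ^ 'd) set set"
  assumes "mesh \<Omega> \<T>" "K \<in> \<T>"
  shows "open_polytope K"
proof -
  obtain S where S: "int CARD('d) simplex S" "K = interior S" using assms by (auto simp: mesh_def)
  have "polytope S" using S(1) simplex_imp_polytope by blast
  have cS: "convex S" "closed S" using S(1) convex_simplex closed_simplex by blast+
  have "aff_dim S = DIM(real^'d)" using S(1) aff_dim_simplex by auto
  then have UN: "affine hull S = UNIV" by (rule iffD1[OF aff_dim_eq_full])
  then have "S \<noteq> {}" by auto
  then have "rel_interior S \<noteq> {}" using rel_interior_eq_empty[OF cS(1)] by blast
  then have "interior S \<noteq> {}" using rel_interior_interior[OF UN] by simp
  moreover have "closure K = S" using convex_closure_interior[OF cS(1) calculation] cS(2) S(2) by simp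
  ultimately show ?thesis using \<open>polytope S\<close> S(2) by (simp add: open_polytope_def)
qed

lemma mesh_finite: "mesh \<Omega> \<T> \<Longrightarrow> finite \<T>" by (simp add: mesh_def)

lemma mesh_face:
  assumes m: "mesh \<Omega> \<T>" and "K \<in> \<T>" "L \<in> \<T>"
  shows "closure K \<inter> closure L face_of closure K" "closure K \<inter> closure L face_of closure L"
proof -
  have "A \<inter> B face_of A" if "A \<in> closure ` \<T>" "B \<in> closure ` \<T>" for A B
    using m that unfolding mesh_def triangulation_def by blast
  from this[of "closure K" "closure L"] this[of "closure L" "closure K"] assms
  show "closure K \<inter> closure L face_of closure K" "closure K \<inter> closure L face_of closure L"
    by (simp_all add: Int_commute)
qed

lemma open_polytope_face_interior:
  assumes K: "open_polytope K" and G: "G face_of closure K" "G \<inter> K \<noteq> {}"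
  shows "G = closure K"
proof (rule ccontr)
  assume "G \<noteq> closure K"
  then have "G \<inter> rel_interior (closure K) = {}" using G(1) by (intro face_of_disjoint_rel_interior)
  moreover have "rel_interior (closure K) = K" using open_polytopeD[OF K] by (simp add: rel_interior_nonempty_interior)
  ultimately show False using G(2) by simp
qed

text \<open>The closures meet in a common face, and a proper face misses the interior.\<close>
lemma mesh_disjoint:
  fixes \<T> :: "(real ^ 'd) set set"
  assumes m: "mesh \<Omega> \<T>" and KL: "K \<in> \<T>" "L \<in> \<T>" "K \<noteq> L"
  shows "K \<inter> L = {}"
proof (rule ccontr)
  assume ne: "K \<inter> L \<noteq> {}"
  note K = mesh_open_polytope[OF m KL(1)] and L = mesh_open_polytope[OF m KL(2)]
  have "closure K \<inter> closure L \<inter> K \<noteq> {}" "closure K \<inter> closure L \<inter> L \<noteq> {}"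
    using ne closure_subset[of K] closure_subset[of L] by auto
  then have "closure K \<inter> closure L = closure K" "closure K \<inter> closure L = closure L"
    using open_polytope_face_interior[OF K] open_polytope_face_interior[OF L] mesh_face[OF m KL(1,2)] by blast+
  then have "closure K = closure L" by simp
  then show False using open_polytopeD(2)[OF K] open_polytopeD(2)[OF L] KL(3) by simp
qed

text \<open>Two elements with the same facet and the same outward normal would overlap, so the normals of
  different elements at the facet are opposite. A third element would leave two of them equal.\<close>
lemma interface_two_elements:
  fixes \<T> :: "(real ^ 'd) set set"
  assumes m: "mesh \<Omega> \<T>" and F: "F \<in> interfaces \<T>"
  obtains K L where "K \<in> \<T>" "L \<in> \<T>" "K \<noteq> L" "F facet_of closure K" "F facet_of closure L" "adj \<T> F = {K, L}"
    "outward_normal L F = - outward_normal K F"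
proof -
  obtain K L where KL: "K \<in> \<T>" "L \<in> \<T>" "K \<noteq> L" "F facet_of closure K" "F facet_of closure L"
    using F by (auto simp: interfaces_def)
  have opp: "outward_normal B F = - outward_normal A F"
    if "A \<in> \<T>" "B \<in> \<T>" "A \<noteq> B" "F facet_of closure A" "F facet_of closure B" for A B
  proof -
    have "outward_normal A F \<noteq> outward_normal B F"
      using common_normal_elements_intersect[OF mesh_open_polytope[OF m that(1)] mesh_open_polytope[OF m that(2)] that(4,5)]
        mesh_disjoint[OF m that(1-3)] by blast
    then show ?thesis
      using normal_same_or_opposite[OF mesh_open_polytope[OF m that(1)] mesh_open_polytope[OF m that(2)] that(4,5)] by auto
  qed
  have nz: "norm (outward_normal K F) = 1" using outward_normal_facet(1)[OF mesh_open_polytope[OF m KL(1)] KL(4)] .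
  have "M = K \<or> M = L" if M: "M \<in> \<T>" "F facet_of closure M" for M
  proof (rule ccontr)
    assume "\<not> (M = K \<or> M = L)"
    then have "outward_normal M F = - outward_normal K F" "outward_normal M F = - outward_normal L F"
      "outward_normal L F = - outward_normal K F"
      using opp KL M by metis+
    then have "outward_normal K F = - outward_normal K F" by simp
    then have "outward_normal K F = 0" by (auto simp: vec_eq_iff)
    then show False using nz by simp
  qed
  then have "adj \<T> F = {K, L}" using KL by (auto simp: adj_def)
  then show ?thesis using that KL opp[OF KL] by blast
qed

lemma rel_interior_facetI:
  fixes K :: "(real ^ 'd) set"
  assumes K: "open_polytope K" and F: "F facet_of closure K" and x: "x \<in> F"
    and strict: "\<And>G. G facet_of closure K \<Longrightarrow> G \<noteq> F \<Longrightarrow> outward_normal K G \<bullet> x < facet_level K G"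
  shows "x \<in> rel_interior F"
proof -
  let ?I = "{G. G facet_of closure K} - {F}"
  let ?T = "\<Inter>G\<in>?I. {z. outward_normal K G \<bullet> z < facet_level K G}"
  have "open ?T" using finite_facets_of[OF K] by (intro open_INT) (auto intro: open_halfspace_lt)
  moreover have "x \<in> ?T \<inter> F" using x strict by auto
  moreover have "?T \<inter> affine hull F \<subseteq> F"
  proof
    fix y assume y: "y \<in> ?T \<inter> affine hull F"
    then have yF: "outward_normal K F \<bullet> y = facet_level K F" using outward_normal_facet(5)[OF K F] by blast
    have "y \<in> closure K"
    proof (subst closure_eq_facet_halfspaces[OF K], safe)
      fix G assume "G facet_of closure K"
      then show "outward_normal K G \<bullet> y \<le> facet_level K G"
        using y yF by (cases "G = F") (auto simp: less_imp_le)
    qed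
    then show "y \<in> F" using yF outward_normal_facet(4)[OF K F] by blast
  qed
  ultimately show ?thesis unfolding mem_rel_interior by blast
qed

text \<open>Points just beyond the facet belong to the domain, hence to closed elements, and one closed
  element contains infinitely many of them. It contains \<open>x\<close>, and by conformity it meets the closure of
  \<open>K\<close> in a proper face that contains the facet, that is, in the facet. The domain may lie on both
  sides of an interface without containing it (a slit), so the converse is false; on such
  interfaces the boundary conditions apply on either side.\<close>
lemma facet_in_domain_is_interface:
  fixes \<T> :: "(real ^ 'd) set set"
  assumes \<Omega>: "open \<Omega>" and m: "mesh \<Omega> \<T>" and K: "K \<in> \<T>" and F: "F facet_of closure K"
    and x: "x \<in> rel_interior F" "x \<in> \<Omega>"
  shows "F \<in> interfaces \<T>"
proof -
  note P = mesh_open_polytope[OF m K]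
  let ?n = "outward_normal K F"
  let ?y = "\<lambda>k. x + (1 / real (Suc k)) *\<^sub>R ?n"
  have lim: "?y \<longlonglongrightarrow> x"
  proof -
    have "(\<lambda>k. 1 / real (Suc k)) \<longlonglongrightarrow> 0" using LIMSEQ_inverse_real_of_nat by (simp add: inverse_eq_divide)
    then have "?y \<longlonglongrightarrow> x + 0 *\<^sub>R ?n" by (intro tendsto_intros)
    then show ?thesis by simp
  qed
  have xF: "x \<in> F" using x(1) rel_interior_subset by blast
  have nx: "?n \<bullet> x = facet_level K F" using xF outward_normal_facet(4)[OF P F] by blast
  have out: "?y k \<notin> closure K" for k
  proof
    assume "?y k \<in> closure K"
    then have "?n \<bullet> ?y k \<le> facet_level K F" by (rule outward_normal_facet(3)[OF P F])
    then show False
      using nx inner_self_unit[OF outward_normal_facet(1)[OF P F]] by (simp add: inner_add_right)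
  qed
  have "eventually (\<lambda>k. ?y k \<in> \<Omega>) sequentially" using lim \<Omega> x(2) by (rule topological_tendstoD)
  then have "eventually (\<lambda>k. \<exists>L\<in>\<T>. ?y k \<in> closure L) sequentially"
  proof eventually_elim
    case (elim k)
    then have "?y k \<in> closure \<Omega>" using closure_subset by blast
    then show ?case using m by (auto simp: mesh_def)
  qed
  then have "\<exists>L\<in>\<T>. frequently (\<lambda>k. ?y k \<in> closure L) sequentially"
    by (intro frequently_bex_finite mesh_finite[OF m] eventually_frequently sequentially_bot)
  then obtain L where L: "L \<in> \<T>" "frequently (\<lambda>k. ?y k \<in> closure L) sequentially" by blast
  have "L \<noteq> K" using L(2) out by auto
  have xL: "x \<in> closure L"
  proof (rule ccontr)
    assume "x \<notin> closure L"
    then have "eventually (\<lambda>k. ?y k \<in> - closure L) sequentially"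
      using lim by (intro topological_tendstoD) auto
    then show False using L(2) by (simp add: frequently_def)
  qed
  let ?G = "closure K \<inter> closure L"
  have G: "?G face_of closure K" "?G face_of closure L" using mesh_face[OF m K L(1)] .
  have "F \<subseteq> ?G"
    by (rule subset_of_face_of[OF G(1)]) (use F facet_of_imp_subset xL x(1) xF in blast)+
  have "?G \<noteq> closure K"
  proof
    assume "?G = closure K"
    then have "K \<subseteq> closure L" using closure_subset by blast
    moreover have "open K" using open_polytopeD(4)[OF P] .
    ultimately have "K \<subseteq> L" using interior_maximal[of K "closure L"] open_polytopeD(2)[OF mesh_open_polytope[OF m L(1)]] by simp
    then show False using mesh_disjoint[OF m K L(1)] \<open>L \<noteq> K\<close> P by (auto simp: open_polytope_def)
  qed
  have full: "aff_dim (closure A) = DIM(real^'d)" if "A \<in> \<T>" for A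
    using open_polytopeD(2,3)[OF mesh_open_polytope[OF m that]] aff_dim_nonempty_interior[of "closure A"] by simp
  have "convex (closure K)" using P by (auto simp: open_polytope_def polytope_imp_convex)
  then have "aff_dim ?G < aff_dim (closure K)"
    using G(1) \<open>?G \<noteq> closure K\<close> by (intro face_of_aff_dim_lt)
  moreover have "aff_dim F \<le> aff_dim ?G" using \<open>F \<subseteq> ?G\<close> by (rule aff_dim_subset)
  moreover have dF: "aff_dim F = aff_dim (closure K) - 1" using F by (simp add: facet_of_def)
  ultimately have "aff_dim F = aff_dim ?G" by simp
  have GK: "?G facet_of closure K"
    using G(1) dF \<open>aff_dim F = aff_dim ?G\<close> \<open>F \<subseteq> ?G\<close> xF by (auto simp: facet_of_def)
  have "F = ?G"
  proof (rule ccontr)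
    assume "F \<noteq> ?G"
    then have "outward_normal K ?G \<bullet> x < facet_level K ?G" by (rule rel_interior_facet_only[OF P F GK x(1)])
    moreover have "x \<in> ?G" using xF \<open>F \<subseteq> ?G\<close> by blast
    then have "outward_normal K ?G \<bullet> x = facet_level K ?G" using outward_normal_facet(4)[OF P GK] by blast
    ultimately show False by simp
  qed
  then have "F facet_of closure L"
    using G(2) dF full K L(1) xF by (auto simp: facet_of_def)
  then show ?thesis using F K L(1) \<open>L \<noteq> K\<close> by (auto simp: interfaces_def)
qed

section \<open>Differential identities\<close>

lemma frechet_derivative_component:
  fixes u :: "real ^ 'd \<Rightarrow> real ^ 'm"
  assumes "u differentiable (at x)"
  shows "frechet_derivative (\<lambda>y. u y $ i) (at x) e = frechet_derivative u (at x) e $ i"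
proof -
  have "((\<lambda>y. u y $ i) has_derivative (\<lambda>h. frechet_derivative u (at x) h $ i)) (at x)"
    using assms frechet_derivative_works by (intro bounded_linear.has_derivative[OF bounded_linear_vec_nth]) blast
  then show ?thesis by (metis frechet_derivative_at)
qed

lemma differentiable_vec_iff:
  fixes u :: "real ^ 'd \<Rightarrow> real ^ 'm"
  shows "u differentiable (at x) \<longleftrightarrow> (\<forall>i. (\<lambda>y. u y $ i) differentiable (at x))"
  by (subst differentiable_componentwise_within) (auto simp: Basis_vec_def inner_axis)

lemma div_vec_eq_sum_partials:
  fixes u :: "real ^ 'd \<Rightarrow> real ^ 'd"
  assumes "u differentiable (at x)"
  shows "div_vec u x = (\<Sum>i\<in>UNIV. frechet_derivative (\<lambda>y. u y $ i) (at x) (axis i 1))"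
  unfolding div_vec_def Jac_def jacobian_def trace_def matrix_def
  by (simp add: frechet_derivative_component[OF assms])

lemma frechet_derivative_unique:
  "(f has_derivative f') (at x) \<Longrightarrow> frechet_derivative f (at x) = f'"
  by (rule frechet_derivative_at[symmetric])

lemma has_derivative_frechet:
  "f differentiable (at x) \<Longrightarrow> (f has_derivative frechet_derivative f (at x)) (at x)"
  by (simp add: frechet_derivative_works)

lemma frechet_mult:
  fixes f g :: "real ^ 'd \<Rightarrow> real"
  assumes "f differentiable (at x)" "g differentiable (at x)"
  shows "frechet_derivative (\<lambda>y. f y * g y) (at x) e =
     f x * frechet_derivative g (at x) e + frechet_derivative f (at x) e * g x"
  by (subst frechet_derivative_unique[OF has_derivative_mult[OF has_derivative_frechet[OF assms(1)] has_derivative_frechet[OF assms(2)]]]) simp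

lemma frechet_sum:
  fixes f :: "'i \<Rightarrow> real ^ 'd \<Rightarrow> real"
  assumes "\<And>i. i \<in> I \<Longrightarrow> f i differentiable (at x)"
  shows "frechet_derivative (\<lambda>y. \<Sum>i\<in>I. f i y) (at x) e = (\<Sum>i\<in>I. frechet_derivative (f i) (at x) e)"
  by (subst frechet_derivative_unique[OF has_derivative_sum[OF has_derivative_frechet[OF assms]]]) auto

lemma div_scaleR:
  fixes u :: "real ^ 'd \<Rightarrow> real ^ 'd"
  assumes r: "r differentiable (at x)" and u: "u differentiable (at x)"
  shows "div_vec (\<lambda>y. r y *\<^sub>R u y) x = r x * div_vec u x + grad r x \<bullet> u x"
proof -
  have ui: "(\<lambda>y. u y $ i) differentiable (at x)" for i using u by (simp add: differentiable_vec_iff)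
  have "(\<lambda>y. r y *\<^sub>R u y) differentiable (at x)" using r u by (rule differentiable_scaleR)
  then have "div_vec (\<lambda>y. r y *\<^sub>R u y) x = (\<Sum>i\<in>UNIV. frechet_derivative (\<lambda>y. r y * u y $ i) (at x) (axis i 1))"
    by (subst div_vec_eq_sum_partials) simp_all
  also have "\<dots> = r x * div_vec u x + grad r x \<bullet> u x"
    unfolding frechet_mult[OF r ui] div_vec_eq_sum_partials[OF u] inner_vec_def grad_def
    by (simp add: sum.distrib sum_distrib_left)
  finally show ?thesis .
qed

text \<open>Row by row, \<open>div (r v \<otimes> v) = div (r v) v + r (Dv) v\<close>, and \<open>v \<bullet> (Dv) v\<close> is half of
  \<open>grad \<bar>v\<bar>\<^sup>2 \<bullet> v\<close>. This is why the convective part of the momentum equation does no work.\<close>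
lemma convective_term_identity:
  fixes v :: "real ^ 'd \<Rightarrow> real ^ 'd"
  assumes r: "r differentiable (at x)" and v: "v differentiable (at x)"
  shows "(div_mat (\<lambda>y. r y *\<^sub>R tensor (v y) (v y)) x - div_vec (\<lambda>y. r y *\<^sub>R v y) x *\<^sub>R v x
       - (1 / 2 * r x) *\<^sub>R grad (\<lambda>y. (norm (v y))\<^sup>2) x) \<bullet> v x = 0"
proof -
  have vi: "(\<lambda>y. v y $ i) differentiable (at x)" for i using v by (simp add: differentiable_vec_iff)
  have rv: "(\<lambda>y. r y *\<^sub>R v y) differentiable (at x)" using r v by (rule differentiable_scaleR)
  let ?D = "\<lambda>i j. frechet_derivative (\<lambda>y. v y $ i) (at x) (axis j 1)"
  have rows: "(\<lambda>y. (r y *\<^sub>R tensor (v y) (v y)) $ i) = (\<lambda>y. v y $ i *\<^sub>R (r y *\<^sub>R v y))" for i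
    by (simp add: tensor_def vec_eq_iff fun_eq_iff)
  have dm: "div_mat (\<lambda>y. r y *\<^sub>R tensor (v y) (v y)) x $ i =
      v x $ i * div_vec (\<lambda>y. r y *\<^sub>R v y) x + (\<Sum>j\<in>UNIV. ?D i j * (r x * v x $ j))" for i
  proof -
    have "div_mat (\<lambda>y. r y *\<^sub>R tensor (v y) (v y)) x $ i = div_vec (\<lambda>y. v y $ i *\<^sub>R (r y *\<^sub>R v y)) x"
      by (simp only: div_mat_def vec_lambda_beta rows)
    then show ?thesis unfolding div_scaleR[OF vi rv] by (simp add: inner_vec_def grad_def)
  qed
  have g: "grad (\<lambda>y. (norm (v y))\<^sup>2) x $ j = (\<Sum>i\<in>UNIV. 2 * v x $ i * ?D i j)" for j
  proof -
    have "(\<lambda>y. (norm (v y))\<^sup>2) = (\<lambda>y. \<Sum>i\<in>UNIV. v y $ i * v y $ i)"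
      by (simp add: power2_norm_eq_inner inner_vec_def)
    then show ?thesis
      by (simp add: grad_def) (subst frechet_sum, auto simp: vi frechet_mult[OF vi vi] intro!: sum.cong)
  qed
  have 1: "div_mat (\<lambda>y. r y *\<^sub>R tensor (v y) (v y)) x \<bullet> v x =
     div_vec (\<lambda>y. r y *\<^sub>R v y) x * (v x \<bullet> v x) + r x * (\<Sum>i\<in>UNIV. \<Sum>j\<in>UNIV. v x $ i * ?D i j * v x $ j)"
    by (simp add: inner_vec_def dm algebra_simps sum.distrib sum_distrib_left sum_distrib_right)
  have 2: "grad (\<lambda>y. (norm (v y))\<^sup>2) x \<bullet> v x = 2 * (\<Sum>i\<in>UNIV. \<Sum>j\<in>UNIV. v x $ i * ?D i j * v x $ j)"
  proof -
    have "grad (\<lambda>y. (norm (v y))\<^sup>2) x \<bullet> v x = (\<Sum>j\<in>UNIV. \<Sum>i\<in>UNIV. 2 * (v x $ i * ?D i j * v x $ j))"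
      by (simp add: inner_vec_def g sum_distrib_right mult.assoc)
    also have "\<dots> = (\<Sum>i\<in>UNIV. \<Sum>j\<in>UNIV. 2 * (v x $ i * ?D i j * v x $ j))" by (rule sum.swap)
    finally show ?thesis by (simp only: sum_distrib_left)
  qed
  show ?thesis by (simp add: inner_diff_left 1 2)
qed

lemma C1_differentiable: "C1 f \<Longrightarrow> f differentiable (at x)"
  by (simp add: C1_def)

lemma C1_const: "C1 (\<lambda>x. c)"
  by (simp add: C1_def)

lemma C1_coord: "C1 (\<lambda>x :: real ^ 'd. x $ i)"
proof -
  have d: "((\<lambda>x. x $ i) has_derivative (\<lambda>h. h $ i)) (at x)" for x :: "real^'d"
    by (rule bounded_linear.has_derivative[OF bounded_linear_vec_nth]) (rule has_derivative_ident)
  show ?thesis unfolding C1_def frechet_derivative_unique[OF d]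
    using d differentiable_def by auto
qed

lemma C1_add: "C1 f \<Longrightarrow> C1 g \<Longrightarrow> C1 (\<lambda>x. f x + g x)"
proof -
  assume fg: "C1 f" "C1 g"
  have d: "frechet_derivative (\<lambda>x. f x + g x) (at x) = (\<lambda>e. frechet_derivative f (at x) e + frechet_derivative g (at x) e)" for x
    by (intro frechet_derivative_unique has_derivative_add has_derivative_frechet C1_differentiable fg)
  show ?thesis unfolding C1_def d using fg by (auto simp: C1_def intro!: continuous_intros)
qed

lemma C1_mult: "C1 f \<Longrightarrow> C1 g \<Longrightarrow> C1 (\<lambda>x. f x * g x)"
proof -
  assume fg: "C1 f" "C1 g"
  show ?thesis unfolding C1_def frechet_mult[OF C1_differentiable[OF fg(1)] C1_differentiable[OF fg(2)]]
    using fg C1_continuous_on[OF fg(1)] C1_continuous_on[OF fg(2)]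
    by (auto simp: C1_def intro!: continuous_intros)
qed

lemma C1_sum: "(\<And>i. i \<in> I \<Longrightarrow> C1 (f i)) \<Longrightarrow> C1 (\<lambda>x. \<Sum>i\<in>I. f i x)"
  by (induction I rule: infinite_finite_induct) (auto simp: C1_const C1_add)

lemma C1_prod: "(\<And>i. i \<in> I \<Longrightarrow> C1 (f i)) \<Longrightarrow> C1 (\<lambda>x. \<Prod>i\<in>I. f i x)"
  by (induction I rule: infinite_finite_induct) (auto simp: C1_const C1_mult)

lemma C1_power: "C1 f \<Longrightarrow> C1 (\<lambda>x. f x ^ k)"
  by (induction k) (auto simp: C1_const C1_mult)

section \<open>The divergence theorem on an element\<close>

lemma facet_measure_eq:
  assumes "open_polytope K" "F facet_of closure K"
  shows "facet_measure F = hyperplane_measure {x. outward_normal K F \<bullet> x = facet_level K F}"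
  unfolding facet_measure_def outward_normal_facet(5)[OF assms] ..

lemma sets_facet_measure [simp, measurable_cong]: "sets (facet_measure F) = sets borel"
  by (simp add: facet_measure_def)

lemma space_facet_measure [simp]: "space (facet_measure F) = UNIV"
  by (simp add: facet_measure_def)

lemma open_polytope_convex: "open_polytope K \<Longrightarrow> convex (closure K)"
  using open_polytopeD(1) polytope_imp_convex by blast

lemma open_polytope_bounded: "open_polytope K \<Longrightarrow> bounded (closure K)"
  using open_polytopeD(1) polytope_imp_bounded by blast

lemma lebesgue_integral_element:
  fixes f :: "real ^ 'd \<Rightarrow> real"
  assumes K: "open_polytope K" and f: "continuous_on UNIV f"
  shows "(LINT x:K|lebesgue. f x) = (LINT x|lborel. indicator (closure K) x * f x)"
proof -
  have Kb: "K \<in> sets borel" using open_polytopeD(4)[OF K] by simp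
  have fm: "f \<in> borel_measurable borel" using f by (rule borel_measurable_continuous_onI)
  have "(LINT x:K|lebesgue. f x) = (LINT x|lborel. indicator K x * f x)"
    unfolding set_lebesgue_integral_def using Kb fm by (subst integral_completion) auto
  also have "\<dots> = (LINT x|lborel. indicator (closure K) x * f x)"
  proof (rule integral_cong_AE)
    have "frontier (closure K) = closure K - K"
      using open_polytopeD(2)[OF K] by (simp add: frontier_def)
    then have "negligible (closure K - K)"
      using negligible_convex_frontier[OF open_polytope_convex[OF K]] by simp
    then have "closure K - K \<in> null_sets lborel"
      using Kb by (simp add: negligible_iff_null_sets null_sets_completion_iff)
    then have "AE x in lborel. x \<notin> closure K - K" by (rule AE_not_in)
    then show "AE x in lborel. indicator K x * f x = indicator (closure K) x * f x"
      by eventually_elim (use closure_subset[of K] in \<open>auto simp: indicator_def\<close>)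
  qed (use Kb fm in measurable)
  finally show ?thesis .
qed

lemma facet_integral_indicator:
  fixes f :: "real ^ 'd \<Rightarrow> real"
  assumes K: "open_polytope K" and F: "F facet_of closure K" and f: "f \<in> borel_measurable borel"
  shows "(LINT x|hyperplane_measure {x. outward_normal K F \<bullet> x = facet_level K F}. indicator (closure K) x * f x)
      = (LINT x:F|facet_measure F. f x)"
proof -
  let ?n = "outward_normal K F" and ?b = "facet_level K F"
  note fn = outward_normal_facet[OF K F]
  have Fc: "closed F" using fn(4) by (metis closed_Int closed_closure closed_hyperplane)
  have "indicator (closure K) (hyperplane_proj ?n ?b y) = (indicator F (hyperplane_proj ?n ?b y) :: real)" for y
    using fn(4) hyperplane_proj_in_hyperplane[OF fn(1), of ?b y] by (auto simp: indicator_def)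
  then have "(LINT y|lborel. indicator (slab ?n ?b) y * (indicator (closure K) (hyperplane_proj ?n ?b y) * f (hyperplane_proj ?n ?b y)))
     = (LINT y|lborel. indicator (slab ?n ?b) y * (indicator F (hyperplane_proj ?n ?b y) * f (hyperplane_proj ?n ?b y)))"
    by simp
  then show ?thesis
    unfolding facet_measure_eq[OF K F] set_lebesgue_integral_def real_scaleR_def
    using f Fc by (subst (1 2) hyperplane_integral[OF fn(1)]) (auto intro!: borel_measurable_times borel_measurable_indicator)
qed

lemma emeasure_facet_bounded:
  assumes K: "open_polytope K" and F: "F facet_of closure K" and A: "bounded A" "A \<in> sets borel"
  shows "emeasure (facet_measure F) A < \<infinity>"
  unfolding facet_measure_eq[OF K F] by (rule hyperplane_measure_bounded[OF outward_normal_facet(1)[OF K F] A])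

lemma facet_compact: "open_polytope K \<Longrightarrow> F facet_of closure K \<Longrightarrow> compact F"
  using facet_of_imp_face_of face_of_imp_compact open_polytope_convex open_polytope_bounded
  by (metis closed_closure compact_eq_bounded_closed)

lemma facet_set_integrable:
  fixes f :: "real ^ 'd \<Rightarrow> real"
  assumes K: "open_polytope K" and F: "F facet_of closure K" and A: "A \<in> sets borel" "A \<subseteq> F"
    and f: "continuous_on UNIV f"
  shows "set_integrable (facet_measure F) A f"
proof -
  have cF: "compact F" using facet_compact[OF K F] .
  have "compact (f ` F)" using f cF by (intro compact_continuous_image) (auto intro: continuous_on_subset)
  then obtain M where "\<forall>y\<in>f ` F. norm y \<le> M" using compact_imp_bounded bounded_iff by metis
  then have M: "\<And>x. x \<in> F \<Longrightarrow> \<bar>f x\<bar> \<le> M" by auto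
  have fm: "f \<in> borel_measurable borel" using f by (rule borel_measurable_continuous_onI)
  show ?thesis unfolding set_integrable_def
  proof (rule Bochner_Integration.integrable_bound)
    have "bounded A" using A(2) cF bounded_subset compact_imp_bounded by blast
    then show "integrable (facet_measure F) (\<lambda>x. M * indicator A x :: real)"
      using emeasure_facet_bounded[OF K F _ A(1)] A(1)
      by (intro integrable_mult_right integrable_real_indicator) auto
    show "(\<lambda>x. indicator A x *\<^sub>R f x) \<in> borel_measurable (facet_measure F)"
      using fm A(1) by measurable
    show "AE x in facet_measure F. norm (indicator A x *\<^sub>R f x) \<le> norm (M * indicator A x :: real)"
      using M A(2) by (intro AE_I2) (force simp: indicator_def)
  qed
qed

text \<open>Sum of the Gauss formulas for the components, each in its own coordinate direction.\<close>
lemma divergence_polytope: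
  fixes g :: "real ^ 'd \<Rightarrow> real ^ 'd"
  assumes K: "open_polytope K" and g: "\<And>i. C1 (\<lambda>x. g x $ i)"
  shows "(LINT x:K|lebesgue. div_vec g x) =
    (\<Sum>F | F facet_of closure K. LINT x:F|facet_measure F. g x \<bullet> outward_normal K F)"
proof -
  let ?I = "{F. F facet_of closure K}" and ?n = "outward_normal K" and ?b = "facet_level K"
  let ?D = "\<lambda>i x. frechet_derivative (\<lambda>y. g y $ i) (at x) (axis i 1)"
  have gd: "g differentiable (at x)" for x using C1_differentiable[OF g] by (simp add: differentiable_vec_iff)
  have cg: "continuous_on UNIV (\<lambda>x. g x $ i)" for i using C1_continuous_on[OF g] .
  have cD: "continuous_on UNIV (?D i)" for i using g[of i] by (simp add: C1_def)
  have Sc: "closure K \<in> sets borel" by simp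
  obtain R where R: "\<And>x. x \<in> closure K \<Longrightarrow> norm x \<le> R" using open_polytope_bounded[OF K] by (auto simp: bounded_iff)
  have Dint: "integrable lborel (\<lambda>x. indicator (closure K) x * ?D i x)" for i
  proof -
    have "compact (closure K)" using open_polytope_bounded[OF K] by (simp add: compact_eq_bounded_closed)
    then have "set_integrable lborel (closure K) (?D i)"
      using borel_integrable_compact[of "closure K" "?D i"] cD[of i] continuous_on_subset
      by (auto simp: set_integrable_def indicator_scaleR_eq_if)
    then show ?thesis by (simp add: set_integrable_def)
  qed
  have part: "(LINT x|lborel. indicator (closure K) x * ?D i x) =
     (\<Sum>F\<in>?I. ?n F $ i * (LINT x:F|facet_measure F. g x $ i))" for i
  proof -
    have "(LINT x|lborel. indicator (closure K) x * ?D i x) =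
     (\<Sum>F\<in>?I. (?n F \<bullet> axis i 1) * (LINT x|hyperplane_measure {x. ?n F \<bullet> x = ?b F}. indicator (closure K) x * g x $ i))"
    proof (rule integral_directional_derivative_polytope[OF finite_facets_of[OF K] _ closure_eq_facet_halfspaces[OF K] open_polytope_bounded[OF K] _ _ g])
      show "norm (?n F) = 1" if "F \<in> ?I" for F using that outward_normal_facet(1)[OF K] by blast
      show "?n G \<noteq> ?n F" if "F \<in> ?I" "G \<in> ?I" "F \<noteq> G" for F G using that facet_eq_of_normal_eq[OF K] by force
      show "?b G \<noteq> - ?b F" if "F \<in> ?I" "G \<in> ?I" "?n G = - ?n F" for F G using that opposite_facets_not_coplanar[OF K] by blast
    qed
    also have "\<dots> = (\<Sum>F\<in>?I. ?n F $ i * (LINT x:F|facet_measure F. g x $ i))"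
      using facet_integral_indicator[OF K _ borel_measurable_continuous_onI[OF cg]]
      by (intro sum.cong) (auto simp: inner_axis)
    finally show ?thesis .
  qed
  have cdiv: "continuous_on UNIV (div_vec g)" unfolding div_vec_eq_sum_partials[OF gd] by (intro continuous_on_sum cD)
  have "(LINT x:K|lebesgue. div_vec g x) = (LINT x|lborel. indicator (closure K) x * div_vec g x)"
    by (rule lebesgue_integral_element[OF K cdiv])
  also have "\<dots> = (LINT x|lborel. (\<Sum>i\<in>UNIV. indicator (closure K) x * ?D i x))"
    unfolding div_vec_eq_sum_partials[OF gd] sum_distrib_left ..
  also have "\<dots> = (\<Sum>i\<in>UNIV. \<Sum>F\<in>?I. ?n F $ i * (LINT x:F|facet_measure F. g x $ i))"
    unfolding part[symmetric] by (rule Bochner_Integration.integral_sum) (rule Dint)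
  also have "\<dots> = (\<Sum>F\<in>?I. \<Sum>i\<in>UNIV. ?n F $ i * (LINT x:F|facet_measure F. g x $ i))" by (rule sum.swap)
  also have "\<dots> = (\<Sum>F\<in>?I. LINT x:F|facet_measure F. g x \<bullet> ?n F)"
  proof (rule sum.cong)
    fix F assume "F \<in> ?I"
    then have F: "F facet_of closure K" by blast
    have FS: "F \<in> sets borel" using facet_compact[OF K F] by (simp add: compact_imp_closed)
    have gi: "set_integrable (facet_measure F) F (\<lambda>x. g x $ i)" for i
      by (rule facet_set_integrable[OF K F FS order_refl cg])
    have "(LINT x:F|facet_measure F. g x \<bullet> ?n F) = (LINT x|facet_measure F. (\<Sum>i\<in>UNIV. ?n F $ i * (indicator F x * g x $ i)))"
      unfolding set_lebesgue_integral_def inner_vec_def by (simp add: sum_distrib_left ac_simps)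
    also have "\<dots> = (\<Sum>i\<in>UNIV. ?n F $ i * (LINT x:F|facet_measure F. g x $ i))"
      using gi unfolding set_lebesgue_integral_def set_integrable_def by simp
    finally show "(\<Sum>i\<in>UNIV. ?n F $ i * (LINT x:F|facet_measure F. g x $ i)) = (LINT x:F|facet_measure F. g x \<bullet> ?n F)" ..
  qed simp
  finally show ?thesis .
qed

section \<open>Piecewise regular functions and their traces\<close>

text \<open>A function of this kind extends continuously from each element, so it has traces.\<close>
definition PC0 :: "(real ^ 'd) set set \<Rightarrow> (real ^ 'd \<Rightarrow> 'b::real_normed_vector) \<Rightarrow> bool" where
  "PC0 \<T> f \<longleftrightarrow> (\<forall>K\<in>\<T>. \<exists>g. continuous_on UNIV g \<and> (\<forall>x\<in>K. f x = g x))"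

definition PC1 :: "(real ^ 'd) set set \<Rightarrow> (real ^ 'd \<Rightarrow> real) \<Rightarrow> bool" where
  "PC1 \<T> f \<longleftrightarrow> (\<forall>K\<in>\<T>. \<exists>g. C1 g \<and> (\<forall>x\<in>K. f x = g x))"

abbreviation PC1_vec :: "(real ^ 'd) set set \<Rightarrow> (real ^ 'd \<Rightarrow> real ^ 'd) \<Rightarrow> bool" where
  "PC1_vec \<T> u \<equiv> \<forall>i. PC1 \<T> (\<lambda>x. u x $ i)"

lemma PC0_cong: "PC0 \<T> g \<Longrightarrow> (\<And>x. x \<in> \<Union>\<T> \<Longrightarrow> f x = g x) \<Longrightarrow> PC0 \<T> f"
  unfolding PC0_def by (metis UnionI)

lemma PC0_const: "PC0 \<T> (\<lambda>x. c)"
  unfolding PC0_def by (intro ballI exI[of _ "\<lambda>x. c"]) simp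

lemma PC0_compose2:
  assumes h: "continuous_on UNIV (\<lambda>(a, b). h a b)" and f: "PC0 \<T> f" and g: "PC0 \<T> g"
  shows "PC0 \<T> (\<lambda>x. h (f x) (g x))"
  unfolding PC0_def
proof
  fix K assume "K \<in> \<T>"
  then obtain f' g' where *: "continuous_on UNIV f'" "\<forall>x\<in>K. f x = f' x" "continuous_on UNIV g'" "\<forall>x\<in>K. g x = g' x"
    using f g unfolding PC0_def by metis
  have "continuous_on UNIV (\<lambda>x. (\<lambda>(a, b). h a b) (f' x, g' x))"
    by (rule continuous_on_compose2[OF h continuous_on_Pair[OF *(1,3)]]) simp
  then show "\<exists>g'. continuous_on UNIV g' \<and> (\<forall>x\<in>K. h (f x) (g x) = g' x)"
    using * by (intro exI[of _ "\<lambda>x. h (f' x) (g' x)"]) simp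
qed

lemma PC0_compose: "continuous_on UNIV h \<Longrightarrow> PC0 \<T> f \<Longrightarrow> PC0 \<T> (\<lambda>x. h (f x))"
  unfolding PC0_def using continuous_on_compose2 by (metis subset_UNIV)

lemma PC0_add: "PC0 \<T> f \<Longrightarrow> PC0 \<T> g \<Longrightarrow> PC0 \<T> (\<lambda>x. f x + g x)"
  by (rule PC0_compose2) (auto simp: case_prod_beta' intro!: continuous_intros)
lemma PC0_diff: "PC0 \<T> f \<Longrightarrow> PC0 \<T> g \<Longrightarrow> PC0 \<T> (\<lambda>x. f x - g x)"
  by (rule PC0_compose2) (auto simp: case_prod_beta' intro!: continuous_intros)
lemma PC0_mult: "PC0 \<T> f \<Longrightarrow> PC0 \<T> g \<Longrightarrow> PC0 \<T> (\<lambda>x. f x * g x :: real)"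
  by (rule PC0_compose2) (auto simp: case_prod_beta' intro!: continuous_intros)
lemma PC0_scaleR: "PC0 \<T> f \<Longrightarrow> PC0 \<T> g \<Longrightarrow> PC0 \<T> (\<lambda>x. f x *\<^sub>R g x)"
  by (rule PC0_compose2) (auto simp: case_prod_beta' intro!: continuous_intros)
lemma PC0_inner: "PC0 \<T> f \<Longrightarrow> PC0 \<T> g \<Longrightarrow> PC0 \<T> (\<lambda>x. f x \<bullet> g x)"
  by (rule PC0_compose2) (auto simp: case_prod_beta' intro!: continuous_intros)
lemma PC0_norm: "PC0 \<T> f \<Longrightarrow> PC0 \<T> (\<lambda>x. norm (f x))"
  by (rule PC0_compose) (auto intro!: continuous_intros)
lemma PC0_power: "PC0 \<T> f \<Longrightarrow> PC0 \<T> (\<lambda>x. f x ^ k :: real)"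
  by (rule PC0_compose) (auto intro!: continuous_intros)
lemma PC0_sum: "(\<And>i. i \<in> I \<Longrightarrow> PC0 \<T> (f i)) \<Longrightarrow> PC0 \<T> (\<lambda>x. \<Sum>i\<in>I. f i x)"
  by (induction I rule: infinite_finite_induct) (auto simp: PC0_const PC0_add)

lemma PC0_vec:
  assumes "\<And>i. PC0 \<T> (\<lambda>x. u x $ i)" shows "PC0 \<T> (u :: real ^ 'd \<Rightarrow> real ^ 'm)"
  unfolding PC0_def
proof
  fix K assume "K \<in> \<T>"
  then have "\<forall>i. \<exists>g. continuous_on UNIV g \<and> (\<forall>x\<in>K. u x $ i = g x)" using assms unfolding PC0_def by blast
  then obtain g where "\<And>i. continuous_on UNIV (g i)" "\<And>i. \<forall>x\<in>K. u x $ i = g i x" by metis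
  then show "\<exists>g. continuous_on UNIV g \<and> (\<forall>x\<in>K. u x = g x)"
    by (intro exI[of _ "\<lambda>x. \<chi> i. g i x"]) (auto simp: vec_eq_iff intro!: continuous_on_vec_lambda)
qed

lemma PC1_imp_PC0: "PC1 \<T> f \<Longrightarrow> PC0 \<T> f"
  unfolding PC0_def PC1_def using C1_continuous_on by blast

lemma PC1_vec_imp_PC0: "PC1_vec \<T> u \<Longrightarrow> PC0 \<T> u"
  by (intro PC0_vec PC1_imp_PC0) blast

lemma PC1_const: "PC1 \<T> (\<lambda>x. c)"
  unfolding PC1_def using C1_const by blast

lemma PC1_mult:
  assumes "PC1 \<T> f" "PC1 \<T> g" shows "PC1 \<T> (\<lambda>x. f x * g x)"
  unfolding PC1_def
proof
  fix K assume "K \<in> \<T>"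
  then obtain a b where "C1 a" "\<forall>x\<in>K. f x = a x" "C1 b" "\<forall>x\<in>K. g x = b x" using assms unfolding PC1_def by metis
  then show "\<exists>h. C1 h \<and> (\<forall>x\<in>K. f x * g x = h x)" by (intro exI[of _ "\<lambda>x. a x * b x"]) (auto intro: C1_mult)
qed

lemma PC1_scaleR_vec: "PC1 \<T> r \<Longrightarrow> PC1_vec \<T> w \<Longrightarrow> PC1_vec \<T> (\<lambda>y. r y *\<^sub>R w y)"
  by (simp add: PC1_mult)

lemma PC1_differentiable:
  assumes "PC1 \<T> f" "mesh \<Omega> \<T>" "x \<in> \<Union>\<T>"
  shows "f differentiable (at x)"
proof -
  obtain K where K: "K \<in> \<T>" "x \<in> K" using assms by blast
  obtain g where g: "C1 g" "\<forall>x\<in>K. f x = g x" using assms K unfolding PC1_def by blast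
  have "open K" using open_polytopeD(4)[OF mesh_open_polytope[OF assms(2) K(1)]] .
  then show ?thesis
    using has_derivative_transform_within_open[OF has_derivative_frechet[OF C1_differentiable[OF g(1)]], of K x f] g(2) K(2)
    by (auto simp: differentiable_def)
qed

lemma PC1_vec_differentiable:
  assumes "PC1_vec \<T> u" "mesh \<Omega> \<T>" "x \<in> \<Union>\<T>"
  shows "u differentiable (at x)"
  using assms PC1_differentiable by (subst differentiable_vec_iff) blast

lemma PC0_frechet:
  assumes "PC1 \<T> f" "mesh \<Omega> \<T>"
  shows "PC0 \<T> (\<lambda>x. frechet_derivative f (at x) e)"
  unfolding PC0_def
proof
  fix K assume K: "K \<in> \<T>"
  obtain g where g: "C1 g" "\<forall>x\<in>K. f x = g x" using assms K unfolding PC1_def by blast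
  have oK: "open K" using open_polytopeD(4)[OF mesh_open_polytope[OF assms(2) K(1)]] .
  have "frechet_derivative f (at x) e = frechet_derivative g (at x) e" if x: "x \<in> K" for x
    using frechet_derivative_transform_within_open[OF C1_differentiable[OF g(1)] oK x, of f] g(2) by simp
  then show "\<exists>h. continuous_on UNIV h \<and> (\<forall>x\<in>K. frechet_derivative f (at x) e = h x)"
    using g(1) by (intro exI[of _ "\<lambda>x. frechet_derivative g (at x) e"]) (auto simp: C1_def)
qed

lemma PC0_grad: "PC1 \<T> f \<Longrightarrow> mesh \<Omega> \<T> \<Longrightarrow> PC0 \<T> (grad f)"
  by (rule PC0_vec) (simp add: grad_def PC0_frechet)

lemma PC0_div_vec:
  assumes "PC1_vec \<T> u" "mesh \<Omega> \<T>" shows "PC0 \<T> (div_vec u)"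
proof (rule PC0_cong)
  show "PC0 \<T> (\<lambda>x. \<Sum>i\<in>UNIV. frechet_derivative (\<lambda>y. u y $ i) (at x) (axis i 1))"
    using assms by (intro PC0_sum PC0_frechet) auto
  show "\<And>x. x \<in> \<Union>\<T> \<Longrightarrow> div_vec u x = (\<Sum>i\<in>UNIV. frechet_derivative (\<lambda>y. u y $ i) (at x) (axis i 1))"
    by (rule div_vec_eq_sum_partials[OF PC1_vec_differentiable[OF assms]])
qed

lemma at_within_element_nontrivial:
  fixes K :: "(real ^ 'd) set"
  assumes "open_polytope K" "x \<in> closure K"
  shows "at x within K \<noteq> bot"
proof -
  have "x islimpt K"
    using assms(2) open_polytopeD(4)[OF assms(1)] interior_limit_point[of x K]
    by (auto simp: closure_def interior_open)
  then show ?thesis by (simp add: trivial_limit_within)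
qed

lemma tr_eqI:
  assumes "open_polytope K" "x \<in> closure K" "(f \<longlongrightarrow> l) (at x within K)"
  shows "tr K f x = l"
  unfolding tr_def using at_within_element_nontrivial[OF assms(1,2)] assms(3) by (intro tendsto_Lim) auto

lemma PC0_trace_extension:
  assumes "PC0 \<T> f" "mesh \<Omega> \<T>" "K \<in> \<T>"
  shows "\<exists>g. continuous_on UNIV g \<and> (\<forall>x\<in>K. f x = g x) \<and>
    (\<forall>x\<in>closure K. tr K f x = g x \<and> (f \<longlongrightarrow> g x) (at x within K))"
proof -
  note P = mesh_open_polytope[OF assms(2,3)]
  obtain g where g: "continuous_on UNIV g" "\<forall>x\<in>K. f x = g x" using assms unfolding PC0_def by blast
  have lim: "(f \<longlongrightarrow> g x) (at x within K)" for x
  proof (rule Lim_transform_within[of g _ _ _ 1])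
    have "isCont g x" using g(1) by (rule continuous_on_interior) simp
    then show "(g \<longlongrightarrow> g x) (at x within K)" unfolding isCont_def by (rule Lim_at_imp_Lim_at_within)
    show "g y = f y" if "y \<in> K" for y using bspec[OF g(2) that] by (rule sym)
  qed (rule zero_less_one)
  show ?thesis
  proof (rule exI[of _ g], rule conjI[OF g(1)], rule conjI[OF g(2)], rule ballI, rule conjI)
    fix x assume "x \<in> closure K"
    then show "tr K f x = g x" by (rule tr_eqI[OF P _ lim])
    show "(f \<longlongrightarrow> g x) (at x within K)" by (rule lim)
  qed
qed

lemma tendsto_tr:
  assumes "PC0 \<T> f" "mesh \<Omega> \<T>" "K \<in> \<T>" "x \<in> closure K"
  shows "(f \<longlongrightarrow> tr K f x) (at x within K)"
proof -
  obtain g where g: "continuous_on UNIV g" "\<forall>x\<in>K. f x = g x"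
    "\<forall>x\<in>closure K. tr K f x = g x \<and> (f \<longlongrightarrow> g x) (at x within K)"
    using PC0_trace_extension[OF assms(1-3)] by (elim exE conjE)
  show ?thesis using g(3) assms(4) by simp
qed

lemma tr_scaleR:
  assumes "PC0 \<T> r" "PC0 \<T> w" "mesh \<Omega> \<T>" "K \<in> \<T>" "x \<in> closure K"
  shows "tr K (\<lambda>y. r y *\<^sub>R w y) x = tr K r x *\<^sub>R tr K w x"
  using assms by (intro tr_eqI[OF mesh_open_polytope[OF assms(3,4)] assms(5)] tendsto_scaleR tendsto_tr)

lemma tr_sum:
  assumes "\<And>i. i \<in> I \<Longrightarrow> PC0 \<T> (f i)" "mesh \<Omega> \<T>" "K \<in> \<T>" "x \<in> closure K"
  shows "tr K (\<lambda>y. \<Sum>i\<in>I. f i y) x = (\<Sum>i\<in>I. tr K (f i) x)"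
  using assms by (intro tr_eqI[OF mesh_open_polytope[OF assms(2,3)] assms(4)] tendsto_sum tendsto_tr)

lemma tr_vec_nth:
  fixes u :: "real ^ 'd \<Rightarrow> real ^ 'm"
  assumes "PC0 \<T> u" "mesh \<Omega> \<T>" "K \<in> \<T>" "x \<in> closure K"
  shows "tr K (\<lambda>y. u y $ i) x = tr K u x $ i"
  using assms by (intro tr_eqI[OF mesh_open_polytope[OF assms(2,3)] assms(4)] tendsto_vec_nth tendsto_tr)

lemma tr_cong:
  assumes "\<And>y. y \<in> K \<Longrightarrow> f y = g y"
  shows "tr K f x = tr K g x"
proof -
  have "((f \<longlongrightarrow> l) (at x within K)) = ((g \<longlongrightarrow> l) (at x within K))" for l
    by (rule Lim_cong_within) (use assms in auto)
  then have "(\<lambda>l. (f \<longlongrightarrow> l) (at x within K)) = (\<lambda>l. (g \<longlongrightarrow> l) (at x within K))" by (rule ext)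
  then show ?thesis unfolding tr_def t2_space_class.Lim_def by (rule arg_cong)
qed

lemma adj_facet: "K \<in> adj \<T> F \<Longrightarrow> K \<in> \<T> \<and> F facet_of closure K \<and> F \<subseteq> closure K"
  by (auto simp: adj_def dest: facet_of_imp_subset)

text \<open>With opposite normals this is
  \<open>a p - b q = (p - q) (a + b) / 2 + (a - b) (p + q) / 2\<close>.\<close>
lemma jump_vec_product:
  assumes m: "mesh \<Omega> \<T>" and F: "F \<in> interfaces \<T>" "x \<in> F" and r: "PC0 \<T> r" and w: "PC0 \<T> w"
  shows "jump_vec \<T> F (\<lambda>y. r y *\<^sub>R w y) x = jump_vec \<T> F w x * avg \<T> F r x + jump \<T> F r x \<bullet> avg \<T> F w x"
proof -
  obtain K L where KL: "K \<in> \<T>" "L \<in> \<T>" "K \<noteq> L" "F facet_of closure K" "F facet_of closure L" "adj \<T> F = {K, L}"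
    "outward_normal L F = - outward_normal K F"
    using interface_two_elements[OF m F(1)] by blast
  have x: "x \<in> closure K" "x \<in> closure L" using F(2) KL(4,5) facet_of_imp_subset by blast+
  have two: "(\<Sum>A\<in>{K, L}. h A) = h K + h L" for h :: "_ \<Rightarrow> 'x::comm_monoid_add" using KL(3) by simp
  have card: "card {K, L} = 2" using KL(3) by simp
  have alg: "(a *\<^sub>R p) \<bullet> n + (b *\<^sub>R q) \<bullet> (- n) = (p \<bullet> n + q \<bullet> (- n)) * ((a + b) /\<^sub>R 2) + (a *\<^sub>R n + b *\<^sub>R (- n)) \<bullet> ((p + q) /\<^sub>R 2)"
    for a b :: real and p q n :: "real ^ 'd"
    proof -
    have "n \<bullet> p = p \<bullet> n" "n \<bullet> q = q \<bullet> n" by (rule inner_commute)+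
    then show ?thesis by (simp add: inner_add_right inner_diff_left inner_add_left field_simps)
  qed
  show ?thesis
    unfolding jump_vec_def jump_def avg_def KL(6) two card KL(7)
      tr_scaleR[OF r w m KL(1) x(1)] tr_scaleR[OF r w m KL(2) x(2)] of_nat_numeral
    by (rule alg)
qed

section \<open>Integrals over the domain and over facets\<close>

lemma negligible_off_elements:
  assumes m: "mesh \<Omega> \<T>"
  shows "negligible (\<Omega> - \<Union>\<T>)"
proof -
  have "negligible (closure K - K)" if "K \<in> \<T>" for K
  proof -
    note P = mesh_open_polytope[OF m that]
    have "frontier (closure K) = closure K - K" using open_polytopeD(2)[OF P] by (simp add: frontier_def)
    then show ?thesis using negligible_convex_frontier[OF open_polytope_convex[OF P]] by simp
  qed
  then have "negligible (\<Union>K\<in>\<T>. closure K - K)"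
    using mesh_finite[OF m] by (intro negligible_Union) auto
  moreover have "\<Omega> - \<Union>\<T> \<subseteq> (\<Union>K\<in>\<T>. closure K - K)"
  proof
    fix x assume x: "x \<in> \<Omega> - \<Union>\<T>"
    then have "x \<in> (\<Union>K\<in>\<T>. closure K)" using m closure_subset[of \<Omega>] by (auto simp: mesh_def)
    then show "x \<in> (\<Union>K\<in>\<T>. closure K - K)" using x by auto
  qed
  ultimately show ?thesis by (rule negligible_subset)
qed

lemma indicator_scaleR_cong:
  "\<forall>x\<in>A. f x = g x \<Longrightarrow> (\<lambda>x. indicator A x *\<^sub>R f x) = (\<lambda>x. indicator A x *\<^sub>R (g x :: real))"
  by (auto simp: indicator_def fun_eq_iff)

lemma PC0_integrable_element:
  fixes f :: "real ^ 'd \<Rightarrow> real"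
  assumes m: "mesh \<Omega> \<T>" and K: "K \<in> \<T>" and f: "PC0 \<T> f"
  shows "set_integrable lebesgue K f"
proof -
  note P = mesh_open_polytope[OF m K]
  obtain g where g: "continuous_on UNIV g" "\<forall>x\<in>K. f x = g x" using f K unfolding PC0_def by blast
  have Kb: "K \<in> sets borel" using open_polytopeD(4)[OF P] by simp
  have "compact (closure K)" using open_polytope_bounded[OF P] by (simp add: compact_eq_bounded_closed)
  then have "set_integrable lborel (closure K) g"
    unfolding set_integrable_def by (rule borel_integrable_compact[OF _ continuous_on_subset[OF g(1)]]) simp
  then have "set_integrable lborel K g"
    by (rule set_integrable_subset) (use Kb closure_subset in auto)
  then have "set_integrable lebesgue K g"
    unfolding set_integrable_def using Kb borel_measurable_continuous_onI[OF g(1)]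
    by (subst integrable_completion) auto
  then show ?thesis
    using indicator_scaleR_cong[OF g(2)] unfolding set_integrable_def by simp
qed

text \<open>The points of \<open>\<Omega>\<close> outside the elements lie on the boundaries of finitely many convex sets, so
  they form a null set, where the values of \<open>f\<close> are irrelevant.\<close>
lemma PC0_integral:
  fixes f :: "real ^ 'd \<Rightarrow> real"
  assumes m: "mesh \<Omega> \<T>" and f: "PC0 \<T> f"
  shows "set_integrable lebesgue \<Omega> f" "(LINT x:\<Omega>|lebesgue. f x) = (\<Sum>K\<in>\<T>. LINT x:K|lebesgue. f x)"
proof -
  have Ks: "K \<in> sets lebesgue" if "K \<in> \<T>" for K
    using open_polytopeD(4)[OF mesh_open_polytope[OF m that]] by simp
  have disj: "disjoint_family_on (\<lambda>K. K) \<T>" using mesh_disjoint[OF m] by (auto simp: disjoint_family_on_def)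
  have U: "set_integrable lebesgue (\<Union>K\<in>\<T>. K) f"
    by (rule set_integrable_UN) (use mesh_finite[OF m] PC0_integrable_element[OF m _ f] Ks in auto)
  have Usub: "(\<Union>K\<in>\<T>. K) \<subseteq> \<Omega>" using m by (auto simp: mesh_def)
  have neg: "negligible (\<Omega> - (\<Union>K\<in>\<T>. K))" using negligible_off_elements[OF m] by simp
  have neg': "negligible {x \<in> (\<Union>K\<in>\<T>. K) - \<Omega>. f x \<noteq> 0}" "negligible {x \<in> \<Omega> - (\<Union>K\<in>\<T>. K). f x \<noteq> 0}"
    using Usub by (auto intro: negligible_subset[OF neg] negligible_subset[OF negligible_empty])
  show I: "set_integrable lebesgue \<Omega> f" by (rule absolutely_integrable_spike_set[OF U neg'])
  have "(LINT x:\<Omega>|lebesgue. f x) = integral \<Omega> f" using I by (rule set_lebesgue_integral_eq_integral)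
  also have "\<dots> = integral (\<Union>K\<in>\<T>. K) f" by (rule integral_spike_set) (use neg' in auto)
  also have "\<dots> = (LINT x:(\<Union>K\<in>\<T>. K)|lebesgue. f x)" using U by (rule set_lebesgue_integral_eq_integral(2)[symmetric])
  also have "\<dots> = (\<Sum>K\<in>\<T>. LINT x:K|lebesgue. f x)"
    by (rule set_integral_finite_Union) (use mesh_finite[OF m] disj PC0_integrable_element[OF m _ f] Ks in auto)
  finally show "(LINT x:\<Omega>|lebesgue. f x) = (\<Sum>K\<in>\<T>. LINT x:K|lebesgue. f x)" .
qed

lemma domain_integral_cong:
  fixes f g :: "real ^ 'd \<Rightarrow> real"
  assumes m: "mesh \<Omega> \<T>" and g: "PC0 \<T> g" and eq: "\<And>x. x \<in> \<Union>\<T> \<Longrightarrow> f x = g x"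
  shows "(LINT x:\<Omega>|lebesgue. f x) = (LINT x:\<Omega>|lebesgue. g x)"
proof -
  have "(LINT x:K|lebesgue. f x) = (LINT x:K|lebesgue. g x)" if "K \<in> \<T>" for K
    using open_polytopeD(4)[OF mesh_open_polytope[OF m that]] that eq
    by (intro set_lebesgue_integral_cong) auto
  then have "(\<Sum>K\<in>\<T>. LINT x:K|lebesgue. f x) = (\<Sum>K\<in>\<T>. LINT x:K|lebesgue. g x)" by (intro sum.cong) auto
  moreover have "PC0 \<T> f" by (rule PC0_cong[OF g]) (rule eq)
  ultimately show ?thesis using PC0_integral(2)[OF m, of f] PC0_integral(2)[OF m g] by simp
qed

definition facet_continuous :: "(real ^ 'd) set \<Rightarrow> (real ^ 'd \<Rightarrow> 'b::real_normed_vector) \<Rightarrow> bool" where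
  "facet_continuous F f \<longleftrightarrow> (\<exists>g. continuous_on UNIV g \<and> (\<forall>x\<in>F. f x = g x))"

lemma facet_continuous_PC0: "facet_continuous F f \<longleftrightarrow> PC0 {F} f"
  by (simp add: facet_continuous_def PC0_def)

lemma facet_continuous_tr:
  assumes "PC0 \<T> f" "mesh \<Omega> \<T>" "K \<in> \<T>" "F \<subseteq> closure K"
  shows "facet_continuous F (tr K f)"
  proof -
  obtain g where g: "continuous_on UNIV g" "\<forall>x\<in>K. f x = g x"
    "\<forall>x\<in>closure K. tr K f x = g x \<and> (f \<longlongrightarrow> g x) (at x within K)"
    using PC0_trace_extension[OF assms(1-3)] by (elim exE conjE)
  show ?thesis using g(1,3) assms(4) unfolding facet_continuous_def by (intro exI[of _ g]) auto
qed

lemma PC0_facet_tr: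
  assumes "PC0 \<T> f" "mesh \<Omega> \<T>" "K \<in> adj \<T> F"
  shows "PC0 {F} (tr K f)"
  unfolding facet_continuous_PC0[symmetric]
  using adj_facet[OF assms(3)] by (intro facet_continuous_tr[OF assms(1,2)]) auto

lemma facet_continuous_jump_vec:
  assumes "PC0 \<T> u" "mesh \<Omega> \<T>"
  shows "facet_continuous F (jump_vec \<T> F u)"
  unfolding jump_vec_def[abs_def] facet_continuous_PC0
  by (intro PC0_sum PC0_inner PC0_const PC0_facet_tr[OF assms])

lemma facet_continuous_jump:
  assumes "PC0 \<T> f" "mesh \<Omega> \<T>"
  shows "facet_continuous F (jump \<T> F f)"
  unfolding jump_def[abs_def] facet_continuous_PC0
  by (intro PC0_sum PC0_scaleR PC0_const PC0_facet_tr[OF assms])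

lemma facet_continuous_avg:
  assumes "PC0 \<T> f" "mesh \<Omega> \<T>"
  shows "facet_continuous F (avg \<T> F f)"
  unfolding avg_def[abs_def] facet_continuous_PC0
  by (intro PC0_scaleR PC0_const PC0_sum PC0_facet_tr[OF assms])

lemma facet_continuous_integrable:
  fixes f :: "real ^ 'd \<Rightarrow> real"
  assumes K: "open_polytope K" "F facet_of closure K" and A: "A \<in> sets borel" and f: "facet_continuous F f"
  shows "set_integrable (facet_measure F) (F \<inter> A) f"
proof -
  obtain g where g: "continuous_on UNIV g" "\<forall>x\<in>F. f x = g x" using f by (auto simp: facet_continuous_def)
  have "F \<in> sets borel" using facet_compact[OF K] by (simp add: compact_imp_closed)
  then have "set_integrable (facet_measure F) (F \<inter> A) g"
    using A by (intro facet_set_integrable[OF K _ _ g(1)]) auto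
  moreover have "(\<lambda>x. indicator (F \<inter> A) x *\<^sub>R f x) = (\<lambda>x. indicator (F \<inter> A) x *\<^sub>R g x)"
    by (rule indicator_scaleR_cong) (use g(2) in simp)
  ultimately show ?thesis unfolding set_integrable_def by simp
qed

lemma interface_facet:
  assumes "mesh \<Omega> \<T>" "F \<in> interfaces \<T>"
  shows "\<exists>K\<in>\<T>. open_polytope K \<and> F facet_of closure K"
  using assms(2) mesh_open_polytope[OF assms(1)] by (auto simp: interfaces_def)

lemma interface_integral_add:
  assumes m: "mesh \<Omega> \<T>" and \<Omega>: "open \<Omega>"
    and f: "\<And>F. F \<in> interfaces \<T> \<Longrightarrow> facet_continuous F (f F)"
    and g: "\<And>F. F \<in> interfaces \<T> \<Longrightarrow> facet_continuous F (g F)"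
  shows "interface_integral \<Omega> \<T> (\<lambda>F x. f F x + g F x) = interface_integral \<Omega> \<T> f + interface_integral \<Omega> \<T> g"
proof -
  have "(LINT x:F \<inter> \<Omega>|facet_measure F. f F x + g F x) =
      (LINT x:F \<inter> \<Omega>|facet_measure F. f F x) + (LINT x:F \<inter> \<Omega>|facet_measure F. g F x)" if F: "F \<in> interfaces \<T>" for F
  proof -
    obtain K where K: "open_polytope K" "F facet_of closure K" using interface_facet[OF m F] by blast
    show ?thesis
      using facet_continuous_integrable[OF K _ f[OF F], of \<Omega>] facet_continuous_integrable[OF K _ g[OF F], of \<Omega>] \<Omega>
      by (intro set_integral_add) auto
  qed
  then show ?thesis unfolding interface_integral_def by (simp add: sum.distrib)
qed

lemma interface_integral_cmult: "interface_integral \<Omega> \<T> (\<lambda>F x. c * f F x) = c * interface_integral \<Omega> \<T> f"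
  by (simp add: interface_integral_def sum_distrib_left set_integral_mult_right)

lemma interface_integral_sum:
  assumes m: "mesh \<Omega> \<T>" and \<Omega>: "open \<Omega>" and fin: "finite I"
    and f: "\<And>F i. F \<in> interfaces \<T> \<Longrightarrow> i \<in> I \<Longrightarrow> facet_continuous F (f i F)"
  shows "interface_integral \<Omega> \<T> (\<lambda>F x. \<Sum>i\<in>I. f i F x) = (\<Sum>i\<in>I. interface_integral \<Omega> \<T> (f i))"
  using fin f
proof (induction I)
  case empty then show ?case by (simp add: interface_integral_def)
next
  case (insert i I)
  have "facet_continuous F (\<lambda>x. \<Sum>i\<in>I. f i F x)" if "F \<in> interfaces \<T>" for F
    unfolding facet_continuous_PC0
    by (rule PC0_sum) (use insert.prems[OF that] in \<open>auto simp: facet_continuous_PC0\<close>)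
  then show ?case using insert by (simp add: interface_integral_add[OF m \<Omega>])
qed

lemma interface_integral_cong:
  assumes m: "mesh \<Omega> \<T>" and \<Omega>: "open \<Omega>"
    and "\<And>F x. F \<in> interfaces \<T> \<Longrightarrow> x \<in> F \<Longrightarrow> f F x = g F x"
  shows "interface_integral \<Omega> \<T> f = interface_integral \<Omega> \<T> g"
  unfolding interface_integral_def
proof (rule sum.cong[OF refl])
  fix F assume F: "F \<in> interfaces \<T>"
  obtain K where K: "open_polytope K" "F facet_of closure K" using interface_facet[OF m F] by blast
  have "F \<inter> \<Omega> \<in> sets borel" using facet_compact[OF K] \<Omega> by (auto simp: compact_imp_closed)
  then show "(LINT x:F \<inter> \<Omega>|facet_measure F. f F x) = (LINT x:F \<inter> \<Omega>|facet_measure F. g F x)"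
    using assms(3)[OF F] by (intro set_lebesgue_integral_cong) auto
qed

section \<open>Integration by parts on a mesh\<close>

lemma AE_facet_rel_interior:
  assumes K: "open_polytope K" and F: "F facet_of closure K"
  shows "AE x in facet_measure F. x \<in> F \<longrightarrow> x \<in> rel_interior F"
proof -
  let ?n = "outward_normal K" and ?b = "facet_level K" and ?I = "{G. G facet_of closure K} - {F}"
  have fin: "finite ?I" using finite_facets_of[OF K] by simp
  have "AE x in facet_measure F. \<forall>G\<in>?I. ?n G \<bullet> x \<noteq> ?b G"
    unfolding facet_measure_eq[OF K F]
  proof (rule AE_finite_allI[OF fin])
    fix G assume G: "G \<in> ?I"
    have G': "G facet_of closure K" "G \<noteq> F" using G by auto
    have "AE y in lborel. ?n G \<bullet> hyperplane_proj (?n F) (?b F) y \<noteq> ?b G"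
    proof (rule AE_projection_off_hyperplane)
      show "norm (?n F) = 1" "norm (?n G) = 1" using outward_normal_facet(1)[OF K] F G' by blast+
      show "?n G \<noteq> ?n F" using facet_eq_of_normal_eq[OF K G'(1) F] G'(2) by blast
      show "?b G \<noteq> - ?b F" if "?n G = - ?n F" by (rule opposite_facets_not_coplanar[OF K G'(1) F that])
    qed
    then show "AE x in hyperplane_measure {x. ?n F \<bullet> x = ?b F}. ?n G \<bullet> x \<noteq> ?b G"
      by (intro AE_hyperplane_measure outward_normal_facet(1)[OF K F]) simp_all
  qed
  then show ?thesis
  proof eventually_elim
    case (elim x)
    show ?case
    proof
      assume x: "x \<in> F"
      then have "x \<in> closure K" using F facet_of_imp_subset by blast
      show "x \<in> rel_interior F"
      proof (intro rel_interior_facetI[OF K F x])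
        fix G assume G: "G facet_of closure K" "G \<noteq> F"
        have "?n G \<bullet> x \<le> ?b G" by (rule outward_normal_facet(3)[OF K G(1) \<open>x \<in> closure K\<close>])
        moreover have "?n G \<bullet> x \<noteq> ?b G" using elim G by blast
        ultimately show "?n G \<bullet> x < ?b G" by simp
      qed
    qed
  qed
qed

lemma PC1_vec_element_extension:
  assumes "PC1_vec \<T> u" "K \<in> \<T>"
  shows "\<exists>g. (\<forall>i. C1 (\<lambda>x. g x $ i)) \<and> (\<forall>x\<in>K. u x = g x)"
proof -
  have "\<forall>i. \<exists>g. C1 g \<and> (\<forall>x\<in>K. u x $ i = g x)" using assms unfolding PC1_def by simp
  from choice[OF this] obtain g where g: "\<forall>i. C1 (g i) \<and> (\<forall>x\<in>K. u x $ i = g i x)" by (elim exE)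
  show ?thesis by (rule exI[of _ "\<lambda>x. \<chi> i. g i x"]) (use g in \<open>simp add: vec_eq_iff\<close>)
qed

lemma finite_facets: "mesh \<Omega> \<T> \<Longrightarrow> finite (facets \<T>)"
proof -
  assume m: "mesh \<Omega> \<T>"
  have "facets \<T> = (\<Union>K\<in>\<T>. {F. F facet_of closure K})" by (auto simp: facets_def)
  then show ?thesis using mesh_finite[OF m] finite_facets_of[OF mesh_open_polytope[OF m]] by simp
qed

lemma interfaces_subset_facets: "interfaces \<T> \<subseteq> facets \<T>"
  by (auto simp: interfaces_def facets_def)

lemma divergence_element:
  fixes u :: "real ^ 'd \<Rightarrow> real ^ 'd"
  assumes m: "mesh \<Omega> \<T>" and K: "K \<in> \<T>" and u: "PC1_vec \<T> u"
  shows "(LINT x:K|lebesgue. div_vec u x) =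
    (\<Sum>F | F facet_of closure K. LINT x:F|facet_measure F. tr K u x \<bullet> outward_normal K F)"
proof -
  note P = mesh_open_polytope[OF m K]
  have oK: "open K" by (rule open_polytopeD(4)[OF P])
  obtain g where g: "\<forall>i. C1 (\<lambda>x. g x $ i)" "\<forall>x\<in>K. u x = g x"
    using PC1_vec_element_extension[OF u K] by (elim exE conjE)
  have gd: "g differentiable (at x)" for x using g(1) C1_differentiable by (subst differentiable_vec_iff) blast
  have gc: "continuous_on UNIV g"
    using g(1) C1_continuous_on by (subst continuous_on_componentwise) (auto simp: Basis_vec_def inner_axis)
  have "frechet_derivative u (at x) = frechet_derivative g (at x)" if "x \<in> K" for x
    by (rule frechet_derivative_transform_within_open[OF gd oK that, symmetric]) (use g(2) in simp)
  then have "div_vec u x = div_vec g x" if "x \<in> K" for x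
    using that by (simp add: div_vec_def Jac_def jacobian_def)
  then have "(LINT x:K|lebesgue. div_vec u x) = (LINT x:K|lebesgue. div_vec g x)"
    using oK by (intro set_lebesgue_integral_cong) auto
  also have "\<dots> = (\<Sum>F | F facet_of closure K. LINT x:F|facet_measure F. g x \<bullet> outward_normal K F)"
    using g(1) by (intro divergence_polytope[OF P]) blast
  also have "\<dots> = (\<Sum>F | F facet_of closure K. LINT x:F|facet_measure F. tr K u x \<bullet> outward_normal K F)"
  proof (rule sum.cong[OF refl])
    fix F assume "F \<in> {F. F facet_of closure K}"
    then have F: "F facet_of closure K" by simp
    have tg: "tr K u x = g x" if "x \<in> closure K" for x
    proof (rule tr_eqI[OF P that], rule Lim_transform_within[of g _ _ _ 1])
      have "isCont g x" using gc by (rule continuous_on_interior) simp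
      then show "(g \<longlongrightarrow> g x) (at x within K)" unfolding isCont_def by (rule Lim_at_imp_Lim_at_within)
      show "g y = u y" if "y \<in> K" for y using bspec[OF g(2) that] by (rule sym)
    qed (rule zero_less_one)
    have "F \<in> sets borel" using facet_compact[OF P F] by (simp add: compact_imp_closed)
    then show "(LINT x:F|facet_measure F. g x \<bullet> outward_normal K F) = (LINT x:F|facet_measure F. tr K u x \<bullet> outward_normal K F)"
      using facet_of_imp_subset[OF F] tg by (intro set_lebesgue_integral_cong) auto
  qed
  finally show ?thesis .
qed

text \<open>Summing over the elements yields every facet once for each adjacent element. The part of a
  facet on \<open>\<partial>\<Omega>\<close> contributes nothing by the boundary condition. The part inside \<open>\<Omega>\<close> is a null set
  unless the facet is an interface, and on an interface the sum over the adjacent elements is the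
  jump.\<close>
theorem divergence_mesh:
  fixes u :: "real ^ 'd \<Rightarrow> real ^ 'd"
  assumes \<Omega>: "open \<Omega>" and m: "mesh \<Omega> \<T>" and u: "PC1_vec \<T> u"
    and bc: "\<And>K F. K \<in> \<T> \<Longrightarrow> F facet_of closure K \<Longrightarrow>
      AE x in facet_measure F. x \<in> F \<inter> frontier \<Omega> \<longrightarrow> tr K u x \<bullet> outward_normal K F = 0"
  shows "(LINT x:\<Omega>|lebesgue. div_vec u x) = interface_integral \<Omega> \<T> (\<lambda>F x. jump_vec \<T> F u x)"
proof -
  have u0: "PC0 \<T> u" by (rule PC1_vec_imp_PC0[OF u])
  let ?t = "\<lambda>K F x. tr K u x \<bullet> outward_normal K F"
  let ?J = "\<lambda>K F. LINT x:F \<inter> \<Omega>|facet_measure F. ?t K F x"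
  have tfc: "facet_continuous F (?t K F)" if "K \<in> \<T>" "F facet_of closure K" for K F
  proof -
    have "PC0 {F} (tr K u)"
      by (rule PC0_facet_tr[OF u0 m]) (use that in \<open>simp add: adj_def\<close>)
    then show ?thesis unfolding facet_continuous_PC0 by (intro PC0_inner PC0_const)
  qed
  have int: "set_integrable (facet_measure F) (F \<inter> A) (?t K F)" if "K \<in> \<T>" "F facet_of closure K" "A \<in> sets borel" for K F A
    by (rule facet_continuous_integrable[OF mesh_open_polytope[OF m that(1)] that(2,3) tfc[OF that(1,2)]])
  have \<Omega>b: "\<Omega> \<in> sets borel" using \<Omega> by simp
  have inside: "(LINT x:F|facet_measure F. ?t K F x) = ?J K F" if K: "K \<in> \<T>" and F: "F facet_of closure K" for K F
  proof -
    have sub: "F \<subseteq> closure \<Omega>"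
    proof -
      have "K \<subseteq> \<Omega>" using m K by (simp add: mesh_def)
      then show ?thesis by (rule order_trans[OF facet_of_imp_subset[OF F] closure_mono])
    qed
    have "(LINT x|facet_measure F. indicator F x *\<^sub>R ?t K F x) = (LINT x|facet_measure F. indicator (F \<inter> \<Omega>) x *\<^sub>R ?t K F x)"
    proof (rule integral_cong_AE)
      show "(\<lambda>x. indicator F x *\<^sub>R ?t K F x) \<in> borel_measurable (facet_measure F)"
        using int[OF K F, of UNIV] unfolding set_integrable_def by (simp add: borel_measurable_integrable)
      show "(\<lambda>x. indicator (F \<inter> \<Omega>) x *\<^sub>R ?t K F x) \<in> borel_measurable (facet_measure F)"
        using int[OF K F \<Omega>b] unfolding set_integrable_def by (rule borel_measurable_integrable)
      show "AE x in facet_measure F. indicator F x *\<^sub>R ?t K F x = indicator (F \<inter> \<Omega>) x *\<^sub>R ?t K F x"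
        using bc[OF K F]
      proof eventually_elim
        case (elim x)
        show ?case
        proof (cases "x \<in> F \<and> x \<notin> \<Omega>")
          case True
          then have "x \<in> frontier \<Omega>" using sub \<Omega> by (auto simp: frontier_def interior_open)
          then show ?thesis using elim True by simp
        qed (auto simp: indicator_def)
      qed
    qed
    then show ?thesis unfolding set_lebesgue_integral_def .
  qed
  have outside: "?J K F = 0" if K: "K \<in> \<T>" and F: "F facet_of closure K" and "F \<notin> interfaces \<T>" for K F
  proof -
    have "AE x in facet_measure F. indicator (F \<inter> \<Omega>) x *\<^sub>R ?t K F x = 0"
      using AE_facet_rel_interior[OF mesh_open_polytope[OF m K] F]
    proof eventually_elim
      case (elim x)
      have "x \<notin> F \<inter> \<Omega>" using elim facet_in_domain_is_interface[OF \<Omega> m K F, of x] that(3) by blast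
      then show ?case by simp
    qed
    then show ?thesis unfolding set_lebesgue_integral_def by (rule integral_eq_zero_AE)
  qed
  have div: "PC0 \<T> (div_vec u)" by (rule PC0_div_vec[OF u m])
  have "(LINT x:\<Omega>|lebesgue. div_vec u x) = (\<Sum>K\<in>\<T>. \<Sum>F | F facet_of closure K. LINT x:F|facet_measure F. ?t K F x)"
    unfolding PC0_integral(2)[OF m div] by (intro sum.cong refl divergence_element[OF m _ u])
  also have "\<dots> = (\<Sum>K\<in>\<T>. \<Sum>F | F \<in> facets \<T> \<and> F facet_of closure K. ?J K F)"
    by (intro sum.cong) (auto simp: inside facets_def)
  also have "\<dots> = (\<Sum>F\<in>facets \<T>. \<Sum>K | K \<in> \<T> \<and> F facet_of closure K. ?J K F)"
    by (rule sum.swap_restrict[OF mesh_finite[OF m] finite_facets[OF m]])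
  also have "\<dots> = (\<Sum>F\<in>facets \<T>. \<Sum>K\<in>adj \<T> F. ?J K F)"
    by (simp add: adj_def)
  also have "\<dots> = (\<Sum>F\<in>interfaces \<T>. \<Sum>K\<in>adj \<T> F. ?J K F)"
    by (rule sum.mono_neutral_right[OF finite_facets[OF m] interfaces_subset_facets])
      (auto simp: adj_def outside intro!: sum.neutral)
  also have "\<dots> = interface_integral \<Omega> \<T> (\<lambda>F x. jump_vec \<T> F u x)"
    unfolding interface_integral_def
  proof (rule sum.cong[OF refl])
    fix F assume "F \<in> interfaces \<T>"
    have "integrable (facet_measure F) (\<lambda>x. indicator (F \<inter> \<Omega>) x *\<^sub>R ?t K F x)" if "K \<in> adj \<T> F" for K
      using int[OF _ _ \<Omega>b, of K F] adj_facet[OF that] unfolding set_integrable_def by simp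
    then have "(LINT x|facet_measure F. (\<Sum>K\<in>adj \<T> F. indicator (F \<inter> \<Omega>) x *\<^sub>R ?t K F x)) = (\<Sum>K\<in>adj \<T> F. ?J K F)"
      unfolding set_lebesgue_integral_def by (intro Bochner_Integration.integral_sum)
    then show "(\<Sum>K\<in>adj \<T> F. ?J K F) = (LINT x:F \<inter> \<Omega>|facet_measure F. jump_vec \<T> F u x)"
      unfolding set_lebesgue_integral_def jump_vec_def scaleR_sum_right by simp
  qed
  finally show ?thesis .
qed

text \<open>The divergence theorem for \<open>r w\<close>, with the product rules for the divergence and for the jump. All
  cancellations in the energy balance come from this identity.\<close>
theorem broken_integration_by_parts:
  fixes w :: "real ^ 'd \<Rightarrow> real ^ 'd"
  assumes \<Omega>: "open \<Omega>" and m: "mesh \<Omega> \<T>" and r: "PC1 \<T> r" and w: "PC1_vec \<T> w"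
    and bc: "\<And>K F. K \<in> \<T> \<Longrightarrow> F facet_of closure K \<Longrightarrow>
      AE x in facet_measure F. x \<in> F \<inter> frontier \<Omega> \<longrightarrow> tr K w x \<bullet> outward_normal K F = 0"
  shows "(LINT x:\<Omega>|lebesgue. r x * div_vec w x) + (LINT x:\<Omega>|lebesgue. grad r x \<bullet> w x) =
     interface_integral \<Omega> \<T> (\<lambda>F x. jump_vec \<T> F w x * avg \<T> F r x)
     + interface_integral \<Omega> \<T> (\<lambda>F x. jump \<T> F r x \<bullet> avg \<T> F w x)"
proof -
  note r0 = PC1_imp_PC0[OF r] and w0 = PC1_vec_imp_PC0[OF w]
  have p1: "PC0 \<T> (\<lambda>x. r x * div_vec w x)" by (intro PC0_mult r0 PC0_div_vec[OF w m])
  have p2: "PC0 \<T> (\<lambda>x. grad r x \<bullet> w x)" by (intro PC0_inner w0 PC0_grad[OF r m])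
  have "(LINT x:\<Omega>|lebesgue. r x * div_vec w x) + (LINT x:\<Omega>|lebesgue. grad r x \<bullet> w x)
      = (LINT x:\<Omega>|lebesgue. r x * div_vec w x + grad r x \<bullet> w x)"
    by (rule set_integral_add(2)[symmetric, OF PC0_integral(1)[OF m p1] PC0_integral(1)[OF m p2]])
  also have "\<dots> = (LINT x:\<Omega>|lebesgue. div_vec (\<lambda>y. r y *\<^sub>R w y) x)"
    by (rule domain_integral_cong[OF m PC0_div_vec[OF PC1_scaleR_vec[OF r w] m]])
      (rule div_scaleR[OF PC1_differentiable[OF r m] PC1_vec_differentiable[OF w m], symmetric])
  also have "\<dots> = interface_integral \<Omega> \<T> (\<lambda>F x. jump_vec \<T> F (\<lambda>y. r y *\<^sub>R w y) x)"
  proof (rule divergence_mesh[OF \<Omega> m PC1_scaleR_vec[OF r w]])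
    fix K F assume K: "K \<in> \<T>" and F: "F facet_of closure K"
    show "AE x in facet_measure F. x \<in> F \<inter> frontier \<Omega> \<longrightarrow> tr K (\<lambda>y. r y *\<^sub>R w y) x \<bullet> outward_normal K F = 0"
      using bc[OF K F]
    proof eventually_elim
      case (elim x)
      show ?case
      proof
        assume x: "x \<in> F \<inter> frontier \<Omega>"
        then have "x \<in> closure K" using facet_of_imp_subset[OF F] by blast
        then show "tr K (\<lambda>y. r y *\<^sub>R w y) x \<bullet> outward_normal K F = 0"
          using elim x by (simp add: tr_scaleR[OF r0 w0 m K])
      qed
    qed
  qed
  also have "\<dots> = interface_integral \<Omega> \<T> (\<lambda>F x. jump_vec \<T> F w x * avg \<T> F r x + jump \<T> F r x \<bullet> avg \<T> F w x)"
    by (rule interface_integral_cong[OF m \<Omega>]) (rule jump_vec_product[OF m _ _ r0 w0])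
  also have "\<dots> = interface_integral \<Omega> \<T> (\<lambda>F x. jump_vec \<T> F w x * avg \<T> F r x)
     + interface_integral \<Omega> \<T> (\<lambda>F x. jump \<T> F r x \<bullet> avg \<T> F w x)"
  proof (rule interface_integral_add[OF m \<Omega>])
    fix F
    note fc = facet_continuous_jump_vec[OF w0 m, of F] facet_continuous_avg[OF r0 m, of F]
      facet_continuous_jump[OF r0 m, of F] facet_continuous_avg[OF w0 m, of F]
    show "facet_continuous F (\<lambda>x. jump_vec \<T> F w x * avg \<T> F r x)"
      using fc unfolding facet_continuous_PC0 by (intro PC0_mult)
    show "facet_continuous F (\<lambda>x. jump \<T> F r x \<bullet> avg \<T> F w x)"
      using fc unfolding facet_continuous_PC0 by (intro PC0_inner)
  qed
  finally show ?thesis .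
qed

section \<open>Consistency\<close>

lemma tr_continuous:
  assumes m: "mesh \<Omega> \<T>" and \<Omega>: "open \<Omega>" and K: "K \<in> \<T>" and x: "x \<in> closure K" "x \<in> \<Omega>"
    and f: "continuous_on \<Omega> f"
  shows "tr K f x = f x"
proof (rule tr_eqI[OF mesh_open_polytope[OF m K] x(1)])
  have "isCont f x" using f \<Omega> x(2) by (simp add: continuous_on_eq_continuous_at)
  then show "(f \<longlongrightarrow> f x) (at x within K)" unfolding isCont_def by (rule Lim_at_imp_Lim_at_within)
qed

lemma jump_continuous_zero:
  assumes m: "mesh \<Omega> \<T>" and \<Omega>: "open \<Omega>" and F: "F \<in> interfaces \<T>" "x \<in> F" "x \<in> \<Omega>"
  shows "continuous_on \<Omega> f \<Longrightarrow> jump \<T> F f x = 0"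
    and "continuous_on \<Omega> u \<Longrightarrow> jump_vec \<T> F u x = 0"
proof -
  obtain K L where KL: "K \<in> \<T>" "L \<in> \<T>" "K \<noteq> L" "F facet_of closure K" "F facet_of closure L" "adj \<T> F = {K, L}"
    "outward_normal L F = - outward_normal K F"
    using interface_two_elements[OF m F(1)] by blast
  have x: "x \<in> closure K" "x \<in> closure L" using F(2) KL(4,5) facet_of_imp_subset by blast+
  show "jump \<T> F f x = 0" if f: "continuous_on \<Omega> f"
    using KL(3,7) tr_continuous[OF m \<Omega> KL(1) x(1) F(3) f] tr_continuous[OF m \<Omega> KL(2) x(2) F(3) f]
    by (simp add: jump_def KL(6))
  show "jump_vec \<T> F u x = 0" if u: "continuous_on \<Omega> u"
    using KL(3,7) tr_continuous[OF m \<Omega> KL(1) x(1) F(3) u] tr_continuous[OF m \<Omega> KL(2) x(2) F(3) u]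
    by (simp add: jump_vec_def KL(6))
qed

lemma smooth_L2H1_continuous:
  assumes "smooth_L2H1 T \<Omega> f" "t \<in> {0<..<T}"
  shows "continuous_on \<Omega> (f t)"
proof -
  have "Ck_on 0 ({0<..<T} \<times> \<Omega>) (\<lambda>(t, x). f t x)" using assms(1) unfolding smooth_L2H1_def smooth_on_def by blast
  then have c: "continuous_on ({0<..<T} \<times> \<Omega>) (\<lambda>(t, x). f t x)" by simp
  have "continuous_on \<Omega> (\<lambda>x. (\<lambda>(t, x). f t x) (t, x))"
    by (rule continuous_on_compose2[OF c]) (use assms(2) in \<open>auto intro!: continuous_intros\<close>)
  then show ?thesis by simp
qed

text \<open>The functions involved are continuous in \<open>\<Omega>\<close>, so their traces from both sides agree and
  all jumps vanish.\<close>
lemma scheme_consistent: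
  assumes \<Omega>: "open \<Omega>" and m: "mesh \<Omega> \<T>"
  shows "consistent \<Omega> \<T> p T \<gamma>"
  unfolding consistent_def
proof (intro allI impI ballI, elim conjE)
  fix \<rho> \<tau> v q t F x
  assume s: "smooth_L2H1 T \<Omega> \<rho>" "smooth_L2H1 T \<Omega> \<tau>" "smooth_L2H1_vec T \<Omega> v" "smooth_L2H1_vec T \<Omega> q"
    and t: "t \<in> {0<..<T}" and F: "F \<in> interfaces \<T>" "x \<in> F \<inter> \<Omega>"
  have vc: "continuous_on \<Omega> (u t)" if "smooth_L2H1_vec T \<Omega> u" for u
  proof -
    have "continuous_on \<Omega> (\<lambda>x. u t x $ i)" for i
      using smooth_L2H1_continuous[OF _ t, of \<Omega> "\<lambda>t x. u t x $ i"] that unfolding smooth_L2H1_vec_def by simp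
    then have "continuous_on \<Omega> (\<lambda>x. \<chi> i. u t x $ i)" by (rule continuous_on_vec_lambda)
    then show ?thesis by simp
  qed
  have x: "x \<in> F" "x \<in> \<Omega>" using F by auto
  note J = jump_continuous_zero[OF m \<Omega> F(1) x]
  have "jump_vec \<T> F (\<lambda>y. \<rho> t y *\<^sub>R v t y) x = 0"
    by (intro J(2) continuous_on_scaleR smooth_L2H1_continuous[OF s(1) t] vc s)
  moreover have "jump \<T> F (\<tau> t) x = 0" "jump \<T> F (\<rho> t) x = 0"
    using J(1) smooth_L2H1_continuous[OF s(1) t] smooth_L2H1_continuous[OF s(2) t] by blast+
  moreover have "jump_vec \<T> F (q t) x = 0" using J(2) vc[OF s(4)] .
  ultimately show "(\<forall>\<Psi>\<in>DG \<T> p. flux1 \<T> (\<rho> t) (v t) \<Psi> F x = 0) \<and>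
          (\<forall>X\<in>DG0_vec \<Omega> \<T> p. flux2 \<T> (\<rho> t) (\<tau> t) X F x = 0) \<and>
          (\<forall>\<Xi>\<in>DG \<T> p. flux3 \<T> \<gamma> (q t) \<Xi> F x = 0) \<and>
          (\<forall>Z\<in>DGn \<Omega> \<T> p. flux4 \<T> (\<rho> t) Z F x = 0)"
    by (simp add: flux1_def flux2_def flux3_def flux4_def)
qed

section \<open>Nodes and orthonormal bases\<close>

text \<open>A basis adapted to point evaluations, constructed as in Newton interpolation: if the nodes
  found so far do not determine \<open>b i\<close>, its interpolation error \<open>r\<close> is nonzero at some point, which
  becomes a new node with the multiple of \<open>r\<close> as its basis function.\<close>
lemma nodal_interpolation:
  fixes b :: "'i \<Rightarrow> 'a \<Rightarrow> real"
  assumes "finite I" and P: "\<And>i. i \<in> I \<Longrightarrow> P (b i)"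
    and lin: "\<And>a f g. P f \<Longrightarrow> P g \<Longrightarrow> P (\<lambda>y. a * f y + g y)" and zero: "P (\<lambda>y. 0)"
  shows "\<exists>S e. finite S \<and> S \<subseteq> X \<and> (\<forall>x\<in>S. P (e x)) \<and>
    (\<forall>x\<in>S. \<forall>y\<in>S. e x y = (if x = y then 1 else 0)) \<and>
    (\<forall>i\<in>I. \<forall>y\<in>X. b i y = (\<Sum>x\<in>S. b i x * e x y))"
  using assms(1) P
proof (induction I)
  case empty
  then show ?case by (intro exI[of _ "{}"]) simp
next
  case (insert i I)
  have "\<exists>S e. finite S \<and> S \<subseteq> X \<and> (\<forall>x\<in>S. P (e x)) \<and>
    (\<forall>x\<in>S. \<forall>y\<in>S. e x y = (if x = y then 1 else 0)) \<and>
    (\<forall>i\<in>I. \<forall>y\<in>X. b i y = (\<Sum>x\<in>S. b i x * e x y))"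
    using insert.prems by (intro insert.IH) simp
  then obtain S e where IH: "finite S" "S \<subseteq> X" "\<forall>x\<in>S. P (e x)"
    "\<forall>x\<in>S. \<forall>y\<in>S. e x y = (if x = y then 1 else 0)"
    "\<forall>i\<in>I. \<forall>y\<in>X. b i y = (\<Sum>x\<in>S. b i x * e x y)" by (elim exE conjE)
  define r where "r y = b i y - (\<Sum>x\<in>S. b i x * e x y)" for y
  have Pcomb: "P (\<lambda>y. b i y - (\<Sum>x\<in>A. c x * e x y))" if "finite A" "A \<subseteq> S" for A c
    using that
  proof (induction A)
    case empty then show ?case using insert.prems by simp
  next
    case (insert x A)
    have "P (\<lambda>y. (- c x) * e x y + (b i y - (\<Sum>x\<in>A. c x * e x y)))"
      using insert.IH insert.prems IH(3) by (intro lin) auto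
    then show ?case using insert.hyps by (simp add: algebra_simps)
  qed
  have rS: "r y = 0" if "y \<in> S" for y
  proof -
    have "(\<Sum>x\<in>S. b i x * e x y) = (\<Sum>x\<in>S. if x = y then b i x else 0)"
      by (rule sum.cong) (use IH(4) that in auto)
    then show ?thesis using IH(1) that by (simp add: r_def)
  qed
  show ?case
  proof (cases "\<forall>y\<in>X. r y = 0")
    case True
    then have "\<forall>j\<in>insert i I. \<forall>y\<in>X. b j y = (\<Sum>x\<in>S. b j x * e x y)" using IH(5) by (auto simp: r_def)
    then show ?thesis by (intro exI[of _ S] exI[of _ e] conjI IH(1-4))
  next
    case False
    then obtain x0 where x0: "x0 \<in> X" "r x0 \<noteq> 0" by blast
    then have x0S: "x0 \<notin> S" using rS by blast
    define e0 where "e0 y = r y / r x0" for y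
    \<comment> \<open>The correction by \<open>e0\<close> makes the old basis functions vanish at the new node.\<close>
    define e' where "e' x = (if x \<in> S then (\<lambda>y. e x y - e x x0 * e0 y) else e0)" for x
    have Pr: "P r" unfolding r_def[abs_def] by (rule Pcomb[OF IH(1) order_refl])
    have Pe0: "P e0"
      using lin[OF Pr zero, of "1 / r x0"] by (simp add: e0_def[abs_def])
    have Pe': "P (e' x)" if "x \<in> insert x0 S" for x
    proof (cases "x \<in> S")
      case True
      then show ?thesis using lin[OF Pe0, of "e x" "- e x x0"] IH(3) by (simp add: e'_def algebra_simps)
    qed (simp add: e'_def Pe0)
    have delta: "e' x y = (if x = y then 1 else 0)" if "x \<in> insert x0 S" "y \<in> insert x0 S" for x y
    proof (cases "y = x0")
      case True
      then show ?thesis using that x0S x0(2) by (auto simp: e'_def e0_def)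
    next
      case False
      then have yS: "y \<in> S" using that by simp
      then have "e0 y = 0" by (simp add: e0_def rS)
      then show ?thesis using that yS x0S IH(4) by (auto simp: e'_def)
    qed
    have comb: "b j y = (\<Sum>x\<in>insert x0 S. b j x * e' x y)"
      if y: "y \<in> X" and j: "\<And>y. y \<in> X \<Longrightarrow> b j y = (\<Sum>x\<in>S. b j x * e x y) + c * r y" for j c y
    proof -
      have "(\<Sum>x\<in>S. b j x * e' x y) = (\<Sum>x\<in>S. b j x * e x y) - (\<Sum>x\<in>S. b j x * e x x0) * e0 y"
        unfolding sum_distrib_right sum_subtractf[symmetric]
        by (rule sum.cong) (auto simp: e'_def algebra_simps)
      also have "\<dots> = (b j y - c * r y) - (b j x0 - c * r x0) * e0 y"
        using j[OF y] j[OF x0(1)] by simp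
      finally have "(\<Sum>x\<in>insert x0 S. b j x * e' x y) = b j x0 * e0 y + ((b j y - c * r y) - (b j x0 - c * r x0) * e0 y)"
        using IH(1) x0S by (simp add: e'_def)
      also have "\<dots> = b j y" using x0(2) by (simp add: e0_def field_simps)
      finally show ?thesis ..
    qed
    have "b j y = (\<Sum>x\<in>insert x0 S. b j x * e' x y)" if "j \<in> insert i I" "y \<in> X" for j y
    proof (cases "j = i")
      case True
      show ?thesis unfolding True by (rule comb[OF that(2), of i 1]) (simp add: r_def)
    next
      case False
      then show ?thesis using that IH(5) by (intro comb[OF that(2), of j 0]) auto
    qed
    then show ?thesis using IH(1,2) x0(1) Pe' delta
      by (intro exI[of _ "insert x0 S"] exI[of _ e'] conjI) auto
  qed
qed

lemma finite_multi_indices: "finite {\<alpha> :: 'd::finite \<Rightarrow> nat. (\<Sum>i\<in>UNIV. \<alpha> i) \<le> p}"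
proof (rule finite_subset)
  show "finite (PiE UNIV (\<lambda>_ :: 'd. {..p}))" by (rule finite_PiE) auto
  show "{\<alpha> :: 'd \<Rightarrow> nat. (\<Sum>i\<in>UNIV. \<alpha> i) \<le> p} \<subseteq> PiE UNIV (\<lambda>_. {..p})"
  proof
    fix \<alpha> :: "'d \<Rightarrow> nat" assume a: "\<alpha> \<in> {\<alpha>. (\<Sum>i\<in>UNIV. \<alpha> i) \<le> p}"
    have "\<alpha> i \<le> (\<Sum>i\<in>UNIV. \<alpha> i)" for i by (rule member_le_sum) auto
    then show "\<alpha> \<in> PiE UNIV (\<lambda>_. {..p})" using a by (auto simp: PiE_def intro: order_trans)
  qed
qed

abbreviation monomial :: "('d \<Rightarrow> nat) \<Rightarrow> real ^ 'd \<Rightarrow> real" where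
  "monomial \<alpha> x \<equiv> (\<Prod>i\<in>UNIV. x $ i ^ \<alpha> i)"

lemma DG_lin: "f \<in> DG \<T> p \<Longrightarrow> g \<in> DG \<T> p \<Longrightarrow> (\<lambda>y. a * f y + g y) \<in> DG \<T> p"
  unfolding DG_def mem_Collect_eq
proof
  fix K assume fg: "\<forall>K\<in>\<T>. polynomial_on p K f" "\<forall>K\<in>\<T>. polynomial_on p K g" and K: "K \<in> \<T>"
  obtain c where c: "\<forall>x\<in>K. f x = (\<Sum>\<alpha> | (\<Sum>i\<in>UNIV. \<alpha> i) \<le> p. c \<alpha> * monomial \<alpha> x)"
    using bspec[OF fg(1) K] unfolding polynomial_on_def by (elim exE)
  obtain d where d: "\<forall>x\<in>K. g x = (\<Sum>\<alpha> | (\<Sum>i\<in>UNIV. \<alpha> i) \<le> p. d \<alpha> * monomial \<alpha> x)"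
    using bspec[OF fg(2) K] unfolding polynomial_on_def by (elim exE)
  show "polynomial_on p K (\<lambda>y. a * f y + g y)"
    unfolding polynomial_on_def
  proof (intro exI[of _ "\<lambda>\<alpha>. a * c \<alpha> + d \<alpha>"] ballI)
    fix x assume "x \<in> K"
    then show "a * f x + g x = (\<Sum>\<alpha> | (\<Sum>i\<in>UNIV. \<alpha> i) \<le> p. (a * c \<alpha> + d \<alpha>) * monomial \<alpha> x)"
      using bspec[OF c] bspec[OF d] by (simp add: distrib_right sum.distrib sum_distrib_left mult.assoc)
  qed
qed

lemma DG_indicator_monomial:
  fixes \<T> :: "(real ^ 'd) set set"
  assumes "mesh \<Omega> \<T>" "L \<in> \<T>" "(\<Sum>i\<in>UNIV. \<alpha> i) \<le> p"
  shows "(\<lambda>y. monomial \<alpha> y * indicator L y) \<in> DG \<T> p"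
  unfolding DG_def mem_Collect_eq
proof
  fix K assume K: "K \<in> \<T>"
  show "polynomial_on p K (\<lambda>y. monomial \<alpha> y * indicator L y)"
    unfolding polynomial_on_def
  proof (intro exI[of _ "\<lambda>\<beta>. if \<beta> = \<alpha> \<and> K = L then 1 else 0"] ballI)
    fix x assume x: "x \<in> K"
    have "(\<Sum>\<beta> | (\<Sum>i\<in>UNIV. \<beta> i) \<le> p. (if \<beta> = \<alpha> \<and> K = L then 1 else 0) * monomial \<beta> x)
       = (\<Sum>\<beta> | (\<Sum>i\<in>UNIV. \<beta> i) \<le> p. if \<beta> = \<alpha> then (if K = L then 1 else 0) * monomial \<beta> x else 0)"
      by (rule sum.cong) auto
    also have "\<dots> = (if K = L then 1 else 0) * monomial \<alpha> x"
      unfolding sum.delta[OF finite_multi_indices] using assms(3) by simp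
    also have "\<dots> = monomial \<alpha> x * indicator L x"
      using mesh_disjoint[OF assms(1) K assms(2)] x by (auto simp: indicator_def)
    finally show "monomial \<alpha> x * indicator L x = (\<Sum>\<beta> | (\<Sum>i\<in>UNIV. \<beta> i) \<le> p. (if \<beta> = \<alpha> \<and> K = L then 1 else 0) * monomial \<beta> x)" ..
  qed
qed

lemma DG_zero: "(\<lambda>y. 0) \<in> DG \<T> p"
  unfolding DG_def polynomial_on_def by (auto intro!: exI[of _ "\<lambda>_. 0"])

lemma DG_const: "(\<lambda>y :: real ^ 'd. c) \<in> DG \<T> p"
  unfolding DG_def mem_Collect_eq polynomial_on_def
proof (intro ballI exI[of _ "\<lambda>\<alpha>. if \<alpha> = (\<lambda>_. 0) then c else 0"])
  fix K and x :: "real ^ 'd"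
  have "(\<Sum>\<alpha> | (\<Sum>i\<in>UNIV. \<alpha> i) \<le> p. (if \<alpha> = (\<lambda>_. 0) then c else 0) * monomial \<alpha> x)
    = (\<Sum>\<alpha> | (\<Sum>i\<in>UNIV. \<alpha> i) \<le> p. if \<alpha> = (\<lambda>_. 0) then c * monomial \<alpha> x else 0)" by (rule sum.cong) auto
  also have "\<dots> = c" unfolding sum.delta[OF finite_multi_indices] by simp
  finally show "c = (\<Sum>\<alpha> | (\<Sum>i\<in>UNIV. \<alpha> i) \<le> p. (if \<alpha> = (\<lambda>_. 0) then c else 0) * monomial \<alpha> x)" ..
qed

lemma DG_sum: "finite I \<Longrightarrow> (\<And>i. i \<in> I \<Longrightarrow> f i \<in> DG \<T> p) \<Longrightarrow> (\<lambda>y. \<Sum>i\<in>I. c i * f i y) \<in> DG \<T> p"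
  by (induction I rule: finite_induct) (simp_all add: DG_zero DG_lin)

lemma DG_cong: "g \<in> DG \<T> p \<Longrightarrow> (\<And>x. x \<in> \<Union>\<T> \<Longrightarrow> f x = g x) \<Longrightarrow> f \<in> DG \<T> p"
  unfolding DG_def polynomial_on_def mem_Collect_eq
proof
  fix K assume g: "\<forall>K\<in>\<T>. \<exists>c. \<forall>x\<in>K. g x = (\<Sum>\<alpha> | (\<Sum>i\<in>UNIV. \<alpha> i) \<le> p. c \<alpha> * monomial \<alpha> x)"
    and eq: "\<And>x. x \<in> \<Union>\<T> \<Longrightarrow> f x = g x" and K: "K \<in> \<T>"
  have "f x = g x" if "x \<in> K" for x using that K by (intro eq) blast
  then show "\<exists>c. \<forall>x\<in>K. f x = (\<Sum>\<alpha> | (\<Sum>i\<in>UNIV. \<alpha> i) \<le> p. c \<alpha> * monomial \<alpha> x)"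
    using bspec[OF g K] by simp
qed

lemma DG_PC1:
  assumes "f \<in> DG \<T> p" shows "PC1 \<T> f"
  unfolding PC1_def
proof
  fix K assume K: "K \<in> \<T>"
  obtain c where c: "\<forall>x\<in>K. f x = (\<Sum>\<alpha> | (\<Sum>i\<in>UNIV. \<alpha> i) \<le> p. c \<alpha> * monomial \<alpha> x)"
    using assms K unfolding DG_def polynomial_on_def by blast
  have "C1 (\<lambda>x. \<Sum>\<alpha> | (\<Sum>i\<in>UNIV. \<alpha> i) \<le> p. c \<alpha> * monomial \<alpha> x)"
    by (intro C1_sum C1_mult C1_const C1_prod C1_power C1_coord)
  then show "\<exists>g. C1 g \<and> (\<forall>x\<in>K. f x = g x)" using c by (intro exI conjI)
qed

text \<open>A curve of piecewise polynomials is thereby determined by finitely many real functions of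
  time, which is how pointwise differentiability turns into differentiability of the curve.\<close>
lemma DG_nodal_basis:
  fixes \<T> :: "(real ^ 'd) set set"
  assumes m: "mesh \<Omega> \<T>"
  shows "\<exists>S e. finite S \<and> S \<subseteq> \<Union>\<T> \<and> (\<forall>x\<in>S. e x \<in> DG \<T> p) \<and>
    (\<forall>f\<in>DG \<T> p. \<forall>y\<in>\<Union>\<T>. f y = (\<Sum>x\<in>S. f x * e x y))"
proof -
  let ?A = "{\<alpha> :: 'd \<Rightarrow> nat. (\<Sum>i\<in>UNIV. \<alpha> i) \<le> p}"
  let ?I = "\<T> \<times> ?A"
  define b where "b = (\<lambda>(K :: (real ^ 'd) set, \<alpha>) y. monomial \<alpha> y * indicator K y :: real)"
  have fin: "finite ?I" by (rule finite_cartesian_product[OF mesh_finite[OF m] finite_multi_indices])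
  have bDG: "b i \<in> DG \<T> p" if "i \<in> ?I" for i
    using that DG_indicator_monomial[OF m] by (auto simp: b_def)
  have "\<exists>S e. finite S \<and> S \<subseteq> \<Union>\<T> \<and> (\<forall>x\<in>S. e x \<in> DG \<T> p) \<and>
    (\<forall>x\<in>S. \<forall>y\<in>S. e x y = (if x = y then 1 else 0)) \<and>
    (\<forall>i\<in>?I. \<forall>y\<in>\<Union>\<T>. b i y = (\<Sum>x\<in>S. b i x * e x y))"
    by (rule nodal_interpolation[OF fin, of "\<lambda>f. f \<in> DG \<T> p"]) (rule bDG, assumption, rule DG_lin, assumption+, rule DG_zero)
  then obtain S e where S: "finite S" "S \<subseteq> \<Union>\<T>" "\<forall>x\<in>S. e x \<in> DG \<T> p"
    "\<forall>i\<in>?I. \<forall>y\<in>\<Union>\<T>. b i y = (\<Sum>x\<in>S. b i x * e x y)"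
    by (elim exE conjE)
  have "f y = (\<Sum>x\<in>S. f x * e x y)" if f: "f \<in> DG \<T> p" and y: "y \<in> \<Union>\<T>" for f y
  proof -
    have "\<forall>K\<in>\<T>. \<exists>c. \<forall>x\<in>K. f x = (\<Sum>\<alpha>\<in>?A. c \<alpha> * monomial \<alpha> x)"
      using f unfolding DG_def polynomial_on_def by simp
    from bchoice[OF this] obtain c where c: "\<forall>K\<in>\<T>. \<forall>x\<in>K. f x = (\<Sum>\<alpha>\<in>?A. c K \<alpha> * monomial \<alpha> x)" by (elim exE)
    have rep: "f z = (\<Sum>i\<in>?I. c (fst i) (snd i) * b i z)" if z: "z \<in> \<Union>\<T>" for z
    proof -
      obtain L where L: "L \<in> \<T>" "z \<in> L" using z by blast
      have ind: "indicator K z = (if K = L then 1 else 0 :: real)" if "K \<in> \<T>" for K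
        using mesh_disjoint[OF m that L(1)] L(2) by (auto simp: indicator_def)
      have "(\<Sum>i\<in>?I. c (fst i) (snd i) * b i z) = (\<Sum>K\<in>\<T>. \<Sum>\<alpha>\<in>?A. c K \<alpha> * (monomial \<alpha> z * indicator K z))"
        by (simp add: sum.cartesian_product b_def case_prod_beta')
      also have "\<dots> = (\<Sum>K\<in>\<T>. if K = L then (\<Sum>\<alpha>\<in>?A. c K \<alpha> * monomial \<alpha> z) else 0)"
        by (rule sum.cong) (auto simp: ind)
      also have "\<dots> = f z" using mesh_finite[OF m] L c by simp
      finally show ?thesis ..
    qed
    have "f y = (\<Sum>i\<in>?I. c (fst i) (snd i) * (\<Sum>x\<in>S. b i x * e x y))"
      unfolding rep[OF y] by (rule sum.cong[OF refl]) (simp only: bspec[OF bspec[OF S(4)] y])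
    also have "\<dots> = (\<Sum>x\<in>S. \<Sum>i\<in>?I. c (fst i) (snd i) * (b i x * e x y))"
      unfolding sum_distrib_left by (rule sum.swap)
    also have "\<dots> = (\<Sum>x\<in>S. f x * e x y)"
    proof (rule sum.cong[OF refl])
      fix x assume "x \<in> S"
      then have "f x = (\<Sum>i\<in>?I. c (fst i) (snd i) * b i x)" using S(2) by (intro rep) auto
      then show "(\<Sum>i\<in>?I. c (fst i) (snd i) * (b i x * e x y)) = f x * e x y"
        by (simp add: sum_distrib_right mult.assoc)
    qed
    finally show ?thesis .
  qed
  then show ?thesis using S(1-3) by (intro exI[of _ S] exI[of _ e] conjI ballI) auto
qed

text \<open>The functions in \<open>V\<close> are determined on \<open>X\<close> by finitely many point evaluations \<open>\<Lambda>\<close>. Dropping one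
  evaluation \<open>l\<close> leaves an orthonormal basis of the functions in \<open>V\<close> on which \<open>l\<close> vanishes; any other
  function, made orthogonal to it and normalised, completes the basis. Equality is asserted on
  \<open>X\<close> only, since values elsewhere are invisible to \<open>b\<close>.\<close>
lemma gram_schmidt:
  fixes V :: "('a \<Rightarrow> real ^ 'm) set" and b :: "('a \<Rightarrow> real ^ 'm) \<Rightarrow> ('a \<Rightarrow> real ^ 'm) \<Rightarrow> real"
  assumes "finite \<Lambda>" "\<Lambda> \<subseteq> X \<times> UNIV"
    and "(\<lambda>x. 0) \<in> V" "\<And>a f g. f \<in> V \<Longrightarrow> g \<in> V \<Longrightarrow> (\<lambda>x. a *\<^sub>R f x + g x) \<in> V"
    and "\<And>a f g h. f \<in> V \<Longrightarrow> g \<in> V \<Longrightarrow> h \<in> V \<Longrightarrow> b (\<lambda>x. a *\<^sub>R f x + g x) h = a * b f h + b g h"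
    and "\<And>f g. f \<in> V \<Longrightarrow> g \<in> V \<Longrightarrow> b f g = b g f"
    and "\<And>f. f \<in> V \<Longrightarrow> 0 \<le> b f f" "\<And>f. f \<in> V \<Longrightarrow> b f f = 0 \<Longrightarrow> \<forall>x\<in>X. f x = 0"
    and "\<And>f g. f \<in> V \<Longrightarrow> g \<in> V \<Longrightarrow> \<forall>x\<in>X. f x = 0 \<Longrightarrow> b f g = 0"
    and "\<And>f. f \<in> V \<Longrightarrow> \<forall>(x, i)\<in>\<Lambda>. f x $ i = 0 \<Longrightarrow> \<forall>x\<in>X. f x = 0"
  shows "\<exists>E. finite E \<and> E \<subseteq> V \<and> (\<forall>e\<in>E. \<forall>e'\<in>E. b e e' = (if e = e' then 1 else 0)) \<and>
    (\<forall>f\<in>V. \<forall>x\<in>X. f x = (\<Sum>e\<in>E. b f e *\<^sub>R e x))"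
  using assms
proof (induction \<Lambda> arbitrary: V)
  case empty
  then show ?case by (intro exI[of _ "{}"]) auto
next
  case (insert l \<Lambda>)
  obtain x0 i0 where l: "l = (x0, i0)" by (cases l)
  note lin = insert.prems(3) and blin = insert.prems(4) and sym = insert.prems(5) and pos = insert.prems(6)
    and definite = insert.prems(7) and null = insert.prems(8) and det = insert.prems(9)
  have x0: "x0 \<in> X" using insert.prems(1) l by auto
  define V' where "V' = {f \<in> V. f x0 $ i0 = 0}"
  have "\<exists>E. finite E \<and> E \<subseteq> V' \<and> (\<forall>e\<in>E. \<forall>e'\<in>E. b e e' = (if e = e' then 1 else 0)) \<and>
    (\<forall>f\<in>V'. \<forall>x\<in>X. f x = (\<Sum>e\<in>E. b f e *\<^sub>R e x))"
  proof (rule insert.IH)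
    show "\<Lambda> \<subseteq> X \<times> UNIV" using insert.prems(1) by simp
    show "(\<lambda>x. 0) \<in> V'" using insert.prems(2) by (simp add: V'_def)
    show "(\<lambda>x. a *\<^sub>R f x + g x) \<in> V'" if "f \<in> V'" "g \<in> V'" for a f g
      using lin[of f g a] that by (simp add: V'_def)
    show "b (\<lambda>x. a *\<^sub>R f x + g x) h = a * b f h + b g h" if "f \<in> V'" "g \<in> V'" "h \<in> V'" for a f g h
      using blin that by (simp add: V'_def)
    show "b f g = b g f" if "f \<in> V'" "g \<in> V'" for f g by (rule sym) (use that in \<open>simp_all add: V'_def\<close>)
    show "0 \<le> b f f" if "f \<in> V'" for f using pos that by (simp add: V'_def)
    show "\<forall>x\<in>X. f x = 0" if "f \<in> V'" "b f f = 0" for f by (rule definite) (use that in \<open>simp_all add: V'_def\<close>)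
    show "b f g = 0" if "f \<in> V'" "g \<in> V'" "\<forall>x\<in>X. f x = 0" for f g
      by (rule null[OF _ _ that(3)]) (use that in \<open>simp_all add: V'_def\<close>)
    show "\<forall>x\<in>X. f x = 0" if "f \<in> V'" "\<forall>(x, i)\<in>\<Lambda>. f x $ i = 0" for f
      by (rule det) (use that l in \<open>simp_all add: V'_def\<close>)
  qed
  then obtain E where E: "finite E" "E \<subseteq> V'" "\<forall>e\<in>E. \<forall>e'\<in>E. b e e' = (if e = e' then 1 else 0)"
    "\<forall>f\<in>V'. \<forall>x\<in>X. f x = (\<Sum>e\<in>E. b f e *\<^sub>R e x)" by (elim exE conjE)
  have EV: "e \<in> V" if "e \<in> E" for e using E(2) that by (auto simp: V'_def)
  show ?case
  proof (cases "V \<subseteq> V'")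
    case True
    then have "\<forall>f\<in>V. \<forall>x\<in>X. f x = (\<Sum>e\<in>E. b f e *\<^sub>R e x)" using E(4) by blast
    moreover have "E \<subseteq> V" using EV by blast
    ultimately show ?thesis using E(1,3) by (intro exI[of _ E] conjI)
  next
    case False
    then obtain g where g: "g \<in> V" "g x0 $ i0 \<noteq> 0" by (auto simp: V'_def)
    have comb: "(\<lambda>x. f x - (\<Sum>e\<in>A. c e *\<^sub>R e x)) \<in> V \<and>
        (\<forall>h\<in>V. b (\<lambda>x. f x - (\<Sum>e\<in>A. c e *\<^sub>R e x)) h = b f h - (\<Sum>e\<in>A. c e * b e h))"
      if "finite A" "A \<subseteq> V" "f \<in> V" for A c f
      using that
    proof (induction A)
      case empty then show ?case by simp
    next
      case (insert e A)
      have eq: "(\<lambda>x. f x - (\<Sum>e\<in>insert e A. c e *\<^sub>R e x)) = (\<lambda>x. (- c e) *\<^sub>R e x + (f x - (\<Sum>e\<in>A. c e *\<^sub>R e x)))"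
        using insert.hyps by (simp add: algebra_simps)
      have IH: "(\<lambda>x. f x - (\<Sum>e\<in>A. c e *\<^sub>R e x)) \<in> V"
        "\<forall>h\<in>V. b (\<lambda>x. f x - (\<Sum>e\<in>A. c e *\<^sub>R e x)) h = b f h - (\<Sum>e\<in>A. c e * b e h)"
        using insert by auto
      have eV: "e \<in> V" using insert.prems by simp
      show ?case unfolding eq
      proof (intro conjI ballI)
        show "(\<lambda>x. (- c e) *\<^sub>R e x + (f x - (\<Sum>e\<in>A. c e *\<^sub>R e x))) \<in> V" by (rule lin[OF eV IH(1)])
        fix h assume h: "h \<in> V"
        show "b (\<lambda>x. (- c e) *\<^sub>R e x + (f x - (\<Sum>e\<in>A. c e *\<^sub>R e x))) h = b f h - (\<Sum>e\<in>insert e A. c e * b e h)"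
          unfolding blin[OF eV IH(1) h] bspec[OF IH(2) h] using insert.hyps by simp
      qed
    qed
    define g' where "g' x = g x - (\<Sum>e\<in>E. b g e *\<^sub>R e x)" for x
    have ES: "E \<subseteq> V" using EV by blast
    have g'V: "g' \<in> V" and bg': "b g' h = b g h - (\<Sum>e\<in>E. b g e * b e h)" if "h \<in> V" for h
      using comb[OF E(1) ES g(1), of "b g"] that unfolding g'_def[abs_def] by auto
    have g'V: "g' \<in> V" using comb[OF E(1) ES g(1), of "b g"] unfolding g'_def[abs_def] by (rule conjunct1)
    have delta: "(\<Sum>e\<in>E. c e * b e e') = c e'" if "e' \<in> E" for c e'
    proof -
      have "(\<Sum>e\<in>E. c e * b e e') = (\<Sum>e\<in>E. if e = e' then c e else 0)"
        by (rule sum.cong[OF refl]) (use E(3) that in auto)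
      then show ?thesis using E(1) that by simp
    qed
    have orth: "b g' e = 0" if "e \<in> E" for e
      using bg'[OF EV[OF that]] delta[OF that, of "b g"] by simp
    have E0: "e x0 $ i0 = 0" if "e \<in> E" for e using E(2) that by (auto simp: V'_def)
    have g'0: "g' x0 $ i0 = g x0 $ i0"
      by (simp add: g'_def E0)
    have "b g' g' \<noteq> 0" using definite[OF g'V] x0 g'0 g(2) by (metis zero_index)
    then have bpos: "b g' g' > 0" using pos[OF g'V] by simp
    define s where "s = 1 / sqrt (b g' g')"
    have s: "s > 0" "s * s * b g' g' = 1" using bpos by (simp_all add: s_def)
    define e0 where "e0 x = s *\<^sub>R g' x" for x
    have e0eq: "e0 = (\<lambda>x. s *\<^sub>R g' x + (0 :: real ^ 'm))" by (simp add: e0_def fun_eq_iff)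
    have e0V: "e0 \<in> V" unfolding e0eq by (rule lin[OF g'V insert.prems(2)])
    have b0: "b (\<lambda>x. 0) h = 0" if "h \<in> V" for h by (rule null[OF insert.prems(2) that]) simp
    have be0: "b e0 h = s * b g' h" if "h \<in> V" for h
      unfolding e0eq blin[OF g'V insert.prems(2) that] by (simp add: b0[OF that])
    have e01: "b e0 e0 = 1"
      using be0[OF e0V] sym[OF g'V e0V] be0[OF g'V] s(2) by (simp add: mult.assoc)
    have e0E: "b e0 e = 0" "b e e0 = 0" if "e \<in> E" for e
      using be0[OF EV[OF that]] orth[OF that] sym[OF EV[OF that] e0V] by simp_all
    have e0nz: "e0 x0 $ i0 \<noteq> 0" using g'0 g(2) s(1) by (simp add: e0_def)
    have e0n: "e0 \<notin> E" using E0 e0nz by blast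
    show ?thesis
    proof (intro exI[of _ "insert e0 E"] conjI ballI)
      show "finite (insert e0 E)" "insert e0 E \<subseteq> V" using E(1) ES e0V by auto
      show "b e e' = (if e = e' then 1 else 0)" if "e \<in> insert e0 E" "e' \<in> insert e0 E" for e e'
        using that e01 e0E e0n E(3) by auto
      fix f x assume f: "f \<in> V" and x: "x \<in> X"
      define c where "c = f x0 $ i0 / e0 x0 $ i0"
      let ?f = "\<lambda>x. (- c) *\<^sub>R e0 x + f x"
      have fV: "?f \<in> V" by (rule lin[OF e0V f])
      then have "?f \<in> V'" using e0nz by (simp add: V'_def c_def)
      have coef: "b ?f e = b f e" if "e \<in> E" for e
        unfolding blin[OF e0V f EV[OF that]] using e0E[OF that] by simp
      have exp: "f y - c *\<^sub>R e0 y - (\<Sum>e\<in>E. b f e *\<^sub>R e y) = 0" if "y \<in> X" for y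
      proof -
        have "?f y = (\<Sum>e\<in>E. b ?f e *\<^sub>R e y)" by (rule bspec[OF bspec[OF E(4) \<open>?f \<in> V'\<close>] that])
        also have "\<dots> = (\<Sum>e\<in>E. b f e *\<^sub>R e y)" by (rule sum.cong[OF refl]) (simp only: coef)
        finally show ?thesis by simp
      qed
      let ?c = "\<lambda>e. if e = e0 then c else b f e"
      have sum_ins: "(\<Sum>e\<in>insert e0 E. ?c e *\<^sub>R e y) = c *\<^sub>R e0 y + (\<Sum>e\<in>E. b f e *\<^sub>R e y)" for y
      proof -
        have "(\<Sum>e\<in>E. ?c e *\<^sub>R e y) = (\<Sum>e\<in>E. b f e *\<^sub>R e y)" by (rule sum.cong[OF refl]) (use e0n in auto)
        then show ?thesis using E(1) e0n by simp
      qed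
      have insV: "insert e0 E \<subseteq> V" "finite (insert e0 E)" using E(1) ES e0V by auto
      let ?k = "\<lambda>y. f y - (\<Sum>e\<in>insert e0 E. ?c e *\<^sub>R e y)"
      have k: "?k \<in> V" "\<forall>h\<in>V. b ?k h = b f h - (\<Sum>e\<in>insert e0 E. ?c e * b e h)"
        using comb[OF insV(2,1) f, of ?c] by simp_all
      have "\<forall>y\<in>X. ?k y = 0" unfolding sum_ins using exp by (simp add: algebra_simps)
      then have "b ?k e0 = 0" by (rule null[OF k(1) e0V])
      moreover have "(\<Sum>e\<in>insert e0 E. ?c e * b e e0) = c"
        using E(1) e0n e01 e0E(2) by (simp add: sum.neutral)
      ultimately have c: "b f e0 = c" using k(2) e0V by simp
      have "f x = c *\<^sub>R e0 x + (\<Sum>e\<in>E. b f e *\<^sub>R e x)" using exp[OF x] by (simp add: algebra_simps)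
      then show "f x = (\<Sum>e\<in>insert e0 E. b f e *\<^sub>R e x)" using E(1) e0n c by simp
    qed
  qed
qed

section \<open>Differentiation in time under the integral\<close>

text \<open>Pointwise differentiability at time \<open>t\<close> with a Lipschitz bound at \<open>t\<close> that is uniform in space: what
  dominated convergence needs, and stable under products and composition with smooth
  functions.\<close>
definition time_diff :: "real \<Rightarrow> 'a set \<Rightarrow> (real \<Rightarrow> 'a \<Rightarrow> real) \<Rightarrow> real \<Rightarrow> ('a \<Rightarrow> real) \<Rightarrow> bool" where
  "time_diff T U h t h' \<longleftrightarrow>
     (\<forall>x\<in>U. ((\<lambda>s. h s x) has_real_derivative h' x) (at t within {0..T})) \<and>
     (\<exists>C. \<forall>s\<in>{0..T}. \<forall>x\<in>U. \<bar>h s x - h t x\<bar> \<le> C * \<bar>s - t\<bar>) \<and>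
     (\<exists>M. \<forall>x\<in>U. \<bar>h t x\<bar> \<le> M)"

lemma time_diffD: "time_diff T U h t h' \<Longrightarrow> x \<in> U \<Longrightarrow> ((\<lambda>s. h s x) has_real_derivative h' x) (at t within {0..T})"
  by (simp add: time_diff_def)

lemma time_diff_bounds:
  assumes "time_diff T U h t h'" "t \<in> {0..T}"
  obtains C M where "C \<ge> 0" "M \<ge> 0" "\<And>s x. s \<in> {0..T} \<Longrightarrow> x \<in> U \<Longrightarrow> \<bar>h s x - h t x\<bar> \<le> C * \<bar>s - t\<bar>"
    "\<And>s x. s \<in> {0..T} \<Longrightarrow> x \<in> U \<Longrightarrow> \<bar>h s x\<bar> \<le> M"
proof -
  obtain C M where CM: "\<forall>s\<in>{0..T}. \<forall>x\<in>U. \<bar>h s x - h t x\<bar> \<le> C * \<bar>s - t\<bar>" "\<forall>x\<in>U. \<bar>h t x\<bar> \<le> M"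
    using assms(1) unfolding time_diff_def by (elim conjE exE)
  let ?C = "\<bar>C\<bar>" and ?M = "\<bar>M\<bar> + \<bar>C\<bar> * T"
  have lip: "\<bar>h s x - h t x\<bar> \<le> ?C * \<bar>s - t\<bar>" if "s \<in> {0..T}" "x \<in> U" for s x
    using bspec[OF bspec[OF CM(1) that(1)] that(2)] mult_right_mono[OF abs_ge_self[of C] abs_ge_zero[of "s - t"]] by linarith
  have "\<bar>h s x\<bar> \<le> ?M" if s: "s \<in> {0..T}" "x \<in> U" for s x
  proof -
    have "?C * \<bar>s - t\<bar> \<le> ?C * T" using s(1) assms(2) by (intro mult_left_mono) auto
    then show ?thesis using lip[OF s] bspec[OF CM(2) s(2)] by linarith
  qed
  moreover have "0 \<le> ?M" using assms(2) by simp
  ultimately show ?thesis using that[of ?C ?M] lip by simp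
qed

lemma time_diffI:
  assumes "\<And>x. x \<in> U \<Longrightarrow> ((\<lambda>s. h s x) has_real_derivative h' x) (at t within {0..T})"
    and "\<And>s x. s \<in> {0..T} \<Longrightarrow> x \<in> U \<Longrightarrow> \<bar>h s x - h t x\<bar> \<le> C * \<bar>s - t\<bar>"
    and "\<And>x. x \<in> U \<Longrightarrow> \<bar>h t x\<bar> \<le> M"
  shows "time_diff T U h t h'"
  unfolding time_diff_def using assms by blast

lemma time_diff_const: "(\<And>x. x \<in> U \<Longrightarrow> \<bar>f x\<bar> \<le> M) \<Longrightarrow> time_diff T U (\<lambda>s. f) t (\<lambda>x. 0)"
  by (rule time_diffI[where C=0 and M=M]) auto

lemma time_diff_add:
  assumes f: "time_diff T U f t f'" and g: "time_diff T U g t g'" and t: "t \<in> {0..T}"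
  shows "time_diff T U (\<lambda>s x. f s x + g s x) t (\<lambda>x. f' x + g' x)"
proof -
  obtain C M where 1: "\<And>s x. s \<in> {0..T} \<Longrightarrow> x \<in> U \<Longrightarrow> \<bar>f s x - f t x\<bar> \<le> C * \<bar>s - t\<bar>"
    "\<And>s x. s \<in> {0..T} \<Longrightarrow> x \<in> U \<Longrightarrow> \<bar>f s x\<bar> \<le> M" using time_diff_bounds[OF f t] by metis
  obtain D N where 2: "\<And>s x. s \<in> {0..T} \<Longrightarrow> x \<in> U \<Longrightarrow> \<bar>g s x - g t x\<bar> \<le> D * \<bar>s - t\<bar>"
    "\<And>s x. s \<in> {0..T} \<Longrightarrow> x \<in> U \<Longrightarrow> \<bar>g s x\<bar> \<le> N" using time_diff_bounds[OF g t] by metis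
  show ?thesis
  proof (rule time_diffI[where C="C + D" and M="M + N"])
    show "((\<lambda>s. f s x + g s x) has_real_derivative f' x + g' x) (at t within {0..T})" if "x \<in> U" for x
      by (intro DERIV_add time_diffD[OF f that] time_diffD[OF g that])
    show "\<bar>f s x + g s x - (f t x + g t x)\<bar> \<le> (C + D) * \<bar>s - t\<bar>" if "s \<in> {0..T}" "x \<in> U" for s x
      using 1(1)[OF that] 2(1)[OF that] by (simp add: distrib_right)
    show "\<bar>f t x + g t x\<bar> \<le> M + N" if "x \<in> U" for x
      using 1(2)[OF t that] 2(2)[OF t that] by simp
  qed
qed

lemma time_diff_mult:
  assumes f: "time_diff T U f t f'" and g: "time_diff T U g t g'" and t: "t \<in> {0..T}"
  shows "time_diff T U (\<lambda>s x. f s x * g s x) t (\<lambda>x. f' x * g t x + g' x * f t x)"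
proof -
  obtain C M where 1: "C \<ge> 0" "M \<ge> 0" "\<And>s x. s \<in> {0..T} \<Longrightarrow> x \<in> U \<Longrightarrow> \<bar>f s x - f t x\<bar> \<le> C * \<bar>s - t\<bar>"
    "\<And>s x. s \<in> {0..T} \<Longrightarrow> x \<in> U \<Longrightarrow> \<bar>f s x\<bar> \<le> M" using time_diff_bounds[OF f t] by metis
  obtain D N where 2: "D \<ge> 0" "N \<ge> 0" "\<And>s x. s \<in> {0..T} \<Longrightarrow> x \<in> U \<Longrightarrow> \<bar>g s x - g t x\<bar> \<le> D * \<bar>s - t\<bar>"
    "\<And>s x. s \<in> {0..T} \<Longrightarrow> x \<in> U \<Longrightarrow> \<bar>g s x\<bar> \<le> N" using time_diff_bounds[OF g t] by metis
  show ?thesis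
  proof (rule time_diffI[where C="C * N + M * D" and M="M * N"])
    show "((\<lambda>s. f s x * g s x) has_real_derivative f' x * g t x + g' x * f t x) (at t within {0..T})" if "x \<in> U" for x
      by (intro DERIV_mult time_diffD[OF f that] time_diffD[OF g that])
    show "\<bar>f s x * g s x - f t x * g t x\<bar> \<le> (C * N + M * D) * \<bar>s - t\<bar>" if s: "s \<in> {0..T}" "x \<in> U" for s x
    proof -
      have "f s x * g s x - f t x * g t x = (f s x - f t x) * g s x + f t x * (g s x - g t x)" by (simp add: algebra_simps)
      then have "\<bar>f s x * g s x - f t x * g t x\<bar> \<le> \<bar>f s x - f t x\<bar> * \<bar>g s x\<bar> + \<bar>f t x\<bar> * \<bar>g s x - g t x\<bar>"
        by (metis abs_mult abs_triangle_ineq)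
      also have "\<dots> \<le> (C * \<bar>s - t\<bar>) * N + M * (D * \<bar>s - t\<bar>)"
        using 1 2 s t by (intro add_mono mult_mono) auto
      finally show ?thesis by (simp add: algebra_simps)
    qed
    show "\<bar>f t x * g t x\<bar> \<le> M * N" if "x \<in> U" for x
      unfolding abs_mult using 1 2 t that by (intro mult_mono) auto
  qed
qed

lemma time_diff_sum:
  assumes "finite I" "\<And>i. i \<in> I \<Longrightarrow> time_diff T U (f i) t (f' i)" "t \<in> {0..T}"
  shows "time_diff T U (\<lambda>s x. \<Sum>i\<in>I. f i s x) t (\<lambda>x. \<Sum>i\<in>I. f' i x)"
  using assms(1,2)
proof (induction I)
  case empty show ?case using time_diff_const[of U "\<lambda>x. 0" 0 T t] by simp
next
  case (insert i I)
  have "time_diff T U (\<lambda>s x. f i s x + (\<Sum>i\<in>I. f i s x)) t (\<lambda>x. f' i x + (\<Sum>i\<in>I. f' i x))"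
    using insert by (intro time_diff_add assms(3)) auto
  then show ?case using insert.hyps by simp
qed

lemma time_diff_compose:
  assumes f: "time_diff T U f t f'" and t: "t \<in> {0..T}"
    and W: "\<And>r. (W has_real_derivative W' r) (at r)" "continuous_on UNIV W'"
  shows "time_diff T U (\<lambda>s x. W (f s x)) t (\<lambda>x. W' (f t x) * f' x)"
proof -
  obtain C M where 1: "C \<ge> 0" "M \<ge> 0" "\<And>s x. s \<in> {0..T} \<Longrightarrow> x \<in> U \<Longrightarrow> \<bar>f s x - f t x\<bar> \<le> C * \<bar>s - t\<bar>"
    "\<And>s x. s \<in> {0..T} \<Longrightarrow> x \<in> U \<Longrightarrow> \<bar>f s x\<bar> \<le> M" using time_diff_bounds[OF f t] by metis
  have "compact (W' ` {-M..M})" by (intro compact_continuous_image continuous_on_subset[OF W(2)]) auto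
  then obtain L where "\<forall>y\<in>W' ` {-M..M}. norm y \<le> L" using compact_imp_bounded bounded_iff by metis
  then have L: "\<And>r. r \<in> {-M..M} \<Longrightarrow> \<bar>W' r\<bar> \<le> L" by auto
  have cW: "continuous_on {-M..M} W"
    using W(1) by (intro DERIV_continuous_on) (rule has_field_derivative_at_within)
  have "compact (W ` {-M..M})" by (intro compact_continuous_image cW) auto
  then obtain N where "\<forall>y\<in>W ` {-M..M}. norm y \<le> N" using compact_imp_bounded bounded_iff by metis
  then have N: "\<And>r. r \<in> {-M..M} \<Longrightarrow> \<bar>W r\<bar> \<le> N" by auto
  have L0: "0 \<le> L" using L[of 0] 1(2) by simp
  show ?thesis
  proof (rule time_diffI[where C="L * C" and M=N])
    show "((\<lambda>s. W (f s x)) has_real_derivative W' (f t x) * f' x) (at t within {0..T})" if "x \<in> U" for x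
      by (rule DERIV_chain2[OF W(1) time_diffD[OF f that]])
    have in_M: "f s x \<in> {-M..M}" if "s \<in> {0..T}" "x \<in> U" for s x using 1(4)[OF that] by auto
    show "\<bar>W (f s x) - W (f t x)\<bar> \<le> L * C * \<bar>s - t\<bar>" if s: "s \<in> {0..T}" "x \<in> U" for s x
    proof -
      have "norm (W (f s x) - W (f t x)) \<le> L * norm (f s x - f t x)"
        by (rule field_differentiable_bound[where S="{-M..M}" and f'=W'])
          (use W(1) L in_M[OF s] in_M[OF t s(2)] in \<open>auto intro: has_field_derivative_at_within\<close>)
      also have "\<dots> \<le> L * (C * \<bar>s - t\<bar>)" using 1(3)[OF s] L0 by (intro mult_left_mono) auto
      finally show ?thesis by (simp add: mult.assoc)
    qed
    show "\<bar>W (f t x)\<bar> \<le> N" if "x \<in> U" for x using N in_M[OF t that] by blast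
  qed
qed

text \<open>Near \<open>t\<close> the difference quotient is bounded because it converges, and away from \<open>t\<close> because
  \<open>f\<close> is bounded.\<close>
lemma lipschitz_at_differentiable_point:
  fixes f :: "real \<Rightarrow> real"
  assumes c: "continuous_on {0..T} f" and t: "t \<in> {0..T}" and d: "(f has_real_derivative d) (at t within {0..T})"
  shows "\<exists>C\<ge>0. \<forall>s\<in>{0..T}. \<bar>f s - f t\<bar> \<le> C * \<bar>s - t\<bar>"
proof -
  have "((\<lambda>s. (f s - f t) / (s - t)) \<longlongrightarrow> d) (at t within {0..T})"
    using d by (simp add: has_field_derivative_iff)
  then have "eventually (\<lambda>s. dist ((f s - f t) / (s - t)) d < 1) (at t within {0..T})"
    by (rule tendstoD) simp
  then obtain \<delta> where \<delta>: "\<delta> > 0" "\<And>s. s \<in> {0..T} \<Longrightarrow> s \<noteq> t \<Longrightarrow> dist s t < \<delta> \<Longrightarrow> dist ((f s - f t) / (s - t)) d < 1"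
    unfolding eventually_at by blast
  have "compact (f ` {0..T})" by (intro compact_continuous_image c) auto
  then obtain B where "\<forall>y\<in>f ` {0..T}. norm y \<le> B" using compact_imp_bounded bounded_iff by metis
  then have B: "\<And>s. s \<in> {0..T} \<Longrightarrow> \<bar>f s\<bar> \<le> B" by auto
  have B0: "B \<ge> 0" using B[OF t] by linarith
  let ?C = "(\<bar>d\<bar> + 1) + 2 * B / \<delta>"
  have nn: "0 \<le> 2 * B / \<delta>" using B0 \<delta>(1) by simp
  have "\<bar>f s - f t\<bar> \<le> ?C * \<bar>s - t\<bar>" if s: "s \<in> {0..T}" for s
  proof (cases "s = t")
    case True then show ?thesis by simp
  next
    case ne: False
    show ?thesis
    proof (cases "dist s t < \<delta>")
      case True
      then have "\<bar>(f s - f t) / (s - t)\<bar> \<le> \<bar>d\<bar> + 1" using \<delta>(2)[OF s ne] unfolding dist_real_def by linarith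
      then have "\<bar>f s - f t\<bar> \<le> (\<bar>d\<bar> + 1) * \<bar>s - t\<bar>" using ne by (simp add: abs_divide divide_le_eq)
      also have "\<dots> \<le> ?C * \<bar>s - t\<bar>" using nn by (intro mult_right_mono) auto
      finally show ?thesis .
    next
      case False
      have "\<bar>f s - f t\<bar> \<le> 2 * B" using B[OF s] B[OF t] by linarith
      also have "\<dots> = 2 * B / \<delta> * \<delta>" using \<delta>(1) by simp
      also have "\<dots> \<le> ?C * \<bar>s - t\<bar>" using False nn \<delta>(1) by (intro mult_mono) (auto simp: dist_real_def)
      finally show ?thesis .
    qed
  qed
  moreover have "?C \<ge> 0" using nn by simp
  ultimately show ?thesis by blast
qed

lemma PC0_bounded:
  assumes m: "mesh \<Omega> \<T>" and f: "PC0 \<T> f"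
  shows "\<exists>M. \<forall>x\<in>\<Union>\<T>. norm (f x) \<le> M"
proof -
  have "bounded (f ` K)" if K: "K \<in> \<T>" for K
  proof -
    note P = mesh_open_polytope[OF m K]
    obtain g where g: "continuous_on UNIV g" "\<forall>x\<in>K. f x = g x" using f K unfolding PC0_def by blast
    have "compact (closure K)" using open_polytope_bounded[OF P] by (simp add: compact_eq_bounded_closed)
    then have "bounded (g ` closure K)"
      by (intro compact_imp_bounded compact_continuous_image continuous_on_subset[OF g(1)]) auto
    moreover have "f ` K \<subseteq> g ` closure K" using g(2) closure_subset[of K] by auto
    ultimately show ?thesis by (rule bounded_subset)
  qed
  then have "bounded (\<Union>K\<in>\<T>. f ` K)" using mesh_finite[OF m] by (intro bounded_UN) auto
  then show ?thesis unfolding bounded_iff by auto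
qed

lemma integral_time_derivative:
  fixes h :: "real \<Rightarrow> real ^ 'd \<Rightarrow> real"
  assumes m: "mesh \<Omega> \<T>" and t: "t \<in> {0..T}" and h: "time_diff T (\<Union>\<T>) h t h'"
    and p: "\<And>s. s \<in> {0..T} \<Longrightarrow> PC0 \<T> (h s)" and p': "PC0 \<T> h'"
  shows "((\<lambda>s. LINT x:\<Omega>|lebesgue. h s x) has_real_derivative (LINT x:\<Omega>|lebesgue. h' x)) (at t within {0..T})"
  unfolding has_field_derivative_iff
proof (subst tendsto_at_iff_sequentially, intro allI impI)
  fix X assume X: "\<forall>i. X i \<in> {0..T} - {t}" "X \<longlonglongrightarrow> t"
  obtain C where C: "\<And>s x. s \<in> {0..T} \<Longrightarrow> x \<in> \<Union>\<T> \<Longrightarrow> \<bar>h s x - h t x\<bar> \<le> C * \<bar>s - t\<bar>"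
    using time_diff_bounds[OF h t] by metis
  let ?q = "\<lambda>i x. (h (X i) x - h t x) / (X i - t)"
  have qP: "PC0 \<T> (?q i)" for i
    unfolding divide_inverse using X(1) by (intro PC0_mult PC0_diff p t PC0_const) auto
  have lin: "((LINT x:\<Omega>|lebesgue. h (X i) x) - (LINT x:\<Omega>|lebesgue. h t x)) / (X i - t) = (LINT x:\<Omega>|lebesgue. ?q i x)" for i
  proof -
    have "set_integrable lebesgue \<Omega> (h (X i))" "set_integrable lebesgue \<Omega> (h t)"
      using PC0_integral(1)[OF m p] X(1) t by auto
    then show ?thesis by (simp add: set_integral_diff)
  qed
  have AEU: "AE x in lebesgue. x \<notin> \<Omega> - \<Union>\<T>"
    using negligible_off_elements[OF m] by (intro AE_not_in) (simp add: negligible_iff_null_sets)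
  have "(\<lambda>i. LINT x|lebesgue. indicator \<Omega> x *\<^sub>R ?q i x) \<longlonglongrightarrow> (LINT x|lebesgue. indicator \<Omega> x *\<^sub>R h' x)"
  proof (rule integral_dominated_convergence)
    show "(\<lambda>x. indicator \<Omega> x *\<^sub>R h' x) \<in> borel_measurable lebesgue"
      using PC0_integral(1)[OF m p'] unfolding set_integrable_def by (rule borel_measurable_integrable)
    show "(\<lambda>x. indicator \<Omega> x *\<^sub>R ?q i x) \<in> borel_measurable lebesgue" for i
      using PC0_integral(1)[OF m qP[of i]] unfolding set_integrable_def by (rule borel_measurable_integrable)
    show "integrable lebesgue (\<lambda>x. indicator \<Omega> x *\<^sub>R C)"
      using PC0_integral(1)[OF m PC0_const] unfolding set_integrable_def .
    show "AE x in lebesgue. norm (indicator \<Omega> x *\<^sub>R ?q i x) \<le> indicator \<Omega> x *\<^sub>R C" for i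
      using AEU
    proof eventually_elim
      case (elim x)
      show ?case
      proof (cases "x \<in> \<Omega>")
        case True
        then have "x \<in> \<Union>\<T>" using elim by blast
        moreover have "X i \<in> {0..T}" "X i \<noteq> t" using X(1) by auto
        ultimately show ?thesis using C[of "X i" x] True by (simp add: abs_divide divide_le_eq)
      qed simp
    qed
    show "AE x in lebesgue. (\<lambda>i. indicator \<Omega> x *\<^sub>R ?q i x) \<longlonglongrightarrow> indicator \<Omega> x *\<^sub>R h' x"
      using AEU
    proof eventually_elim
      case (elim x)
      show ?case
      proof (cases "x \<in> \<Omega>")
        case True
        then have "x \<in> \<Union>\<T>" using elim by blast
        then have "((\<lambda>s. (h s x - h t x) / (s - t)) \<longlongrightarrow> h' x) (at t within {0..T})"
          using time_diffD[OF h] by (simp add: has_field_derivative_iff)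
        then have "((\<lambda>s. (h s x - h t x) / (s - t)) \<circ> X) \<longlonglongrightarrow> h' x"
          using X unfolding tendsto_at_iff_sequentially by blast
        then show ?thesis using True by (simp add: o_def)
      qed simp
    qed
  qed
  then show "((\<lambda>s. ((LINT x:\<Omega>|lebesgue. h s x) - (LINT x:\<Omega>|lebesgue. h t x)) / (s - t)) \<circ> X) \<longlonglongrightarrow> (LINT x:\<Omega>|lebesgue. h' x)"
    unfolding o_def lin by (simp add: set_lebesgue_integral_def)
qed

text \<open>The nodal basis expresses the values at all points through those at finitely many nodes, and
  with them the Lipschitz bounds and the time derivatives.\<close>
lemma DG_time_derivative:
  fixes f :: "real \<Rightarrow> real ^ 'd \<Rightarrow> real"
  assumes m: "mesh \<Omega> \<T>" and T: "0 < T" and t: "t \<in> {0..T}"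
    and f: "\<And>s. s \<in> {0..T} \<Longrightarrow> f s \<in> DG \<T> p"
    and d: "\<And>s x. s \<in> {0..T} \<Longrightarrow> x \<in> \<Union>\<T> \<Longrightarrow> (\<lambda>s. f s x) differentiable (at s within {0..T})"
  shows "time_diff T (\<Union>\<T>) f t (time_deriv T f t)" "time_deriv T f t \<in> DG \<T> p"
proof -
  obtain S e where S: "finite S" "S \<subseteq> \<Union>\<T>" "\<forall>x\<in>S. e x \<in> DG \<T> p"
    "\<forall>f\<in>DG \<T> p. \<forall>y\<in>\<Union>\<T>. f y = (\<Sum>x\<in>S. f x * e x y)"
    using DG_nodal_basis[OF m, of p] by (elim exE conjE)
  have nod: "f s y = (\<Sum>x\<in>S. f s x * e x y)" if "s \<in> {0..T}" "y \<in> \<Union>\<T>" for s y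
    by (rule bspec[OF bspec[OF S(4) f[OF that(1)]] that(2)])
  have der: "((\<lambda>s. f s x) has_real_derivative time_deriv T f t x) (at t within {0..T})" if "x \<in> \<Union>\<T>" for x
    unfolding has_real_derivative_iff_has_vector_derivative time_deriv_def
    using d[OF t that] by (simp add: vector_derivative_works)
  have cont: "continuous_on {0..T} (\<lambda>s. f s x)" if "x \<in> \<Union>\<T>" for x
    by (rule differentiable_imp_continuous_on) (use d[OF _ that] in \<open>simp add: differentiable_on_def\<close>)
  have "\<forall>x\<in>S. \<exists>C. C \<ge> 0 \<and> (\<forall>s\<in>{0..T}. \<bar>f s x - f t x\<bar> \<le> C * \<bar>s - t\<bar>)"
  proof
    fix x assume "x \<in> S"
    then have "x \<in> \<Union>\<T>" using S(2) by blast
    from lipschitz_at_differentiable_point[OF cont[OF this] t der[OF this]]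
    show "\<exists>C. C \<ge> 0 \<and> (\<forall>s\<in>{0..T}. \<bar>f s x - f t x\<bar> \<le> C * \<bar>s - t\<bar>)" .
  qed
  from bchoice[OF this] obtain C where C: "\<forall>x\<in>S. C x \<ge> 0 \<and> (\<forall>s\<in>{0..T}. \<bar>f s x - f t x\<bar> \<le> C x * \<bar>s - t\<bar>)" by (elim exE)
  have "\<forall>x\<in>S. \<exists>M. \<forall>y\<in>\<Union>\<T>. norm (e x y) \<le> M"
    using PC0_bounded[OF m PC1_imp_PC0[OF DG_PC1]] S(3) by blast
  from bchoice[OF this] obtain M where M: "\<forall>x\<in>S. \<forall>y\<in>\<Union>\<T>. norm (e x y) \<le> M x" by (elim exE)
  obtain B where B: "\<forall>x\<in>\<Union>\<T>. norm (f t x) \<le> B"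
    using PC0_bounded[OF m PC1_imp_PC0[OF DG_PC1[OF f[OF t]]]] by (elim exE)
  show "time_diff T (\<Union>\<T>) f t (time_deriv T f t)"
  proof (rule time_diffI[OF der])
    show "\<bar>f s y - f t y\<bar> \<le> (\<Sum>x\<in>S. C x * M x) * \<bar>s - t\<bar>" if s: "s \<in> {0..T}" "y \<in> \<Union>\<T>" for s y
    proof -
      have "f s y - f t y = (\<Sum>x\<in>S. (f s x - f t x) * e x y)"
        unfolding nod[OF s] nod[OF t s(2)] by (simp add: sum_subtractf left_diff_distrib)
      then have "\<bar>f s y - f t y\<bar> \<le> (\<Sum>x\<in>S. \<bar>(f s x - f t x) * e x y\<bar>)" by simp
      also have "\<dots> \<le> (\<Sum>x\<in>S. (C x * \<bar>s - t\<bar>) * M x)"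
      proof (rule sum_mono)
        fix x assume x: "x \<in> S"
        have 1: "\<bar>f s x - f t x\<bar> \<le> C x * \<bar>s - t\<bar>" "C x \<ge> 0" using C x s(1) by auto
        have 2: "\<bar>e x y\<bar> \<le> M x" using M x s(2) by fastforce
        show "\<bar>(f s x - f t x) * e x y\<bar> \<le> (C x * \<bar>s - t\<bar>) * M x"
          unfolding abs_mult by (rule mult_mono) (use 1 2 in auto)
      qed
      also have "\<dots> = (\<Sum>x\<in>S. C x * M x) * \<bar>s - t\<bar>" unfolding sum_distrib_right by (rule sum.cong[OF refl]) (simp add: ac_simps)
      finally show ?thesis .
    qed
    show "\<bar>f t x\<bar> \<le> B" if "x \<in> \<Union>\<T>" for x using bspec[OF B that] by simp
  qed
  have "time_deriv T f t y = (\<Sum>x\<in>S. time_deriv T f t x * e x y)" if y: "y \<in> \<Union>\<T>" for y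
  proof (rule vector_derivative_unique_within)
    show "((\<lambda>s. f s y) has_vector_derivative time_deriv T f t y) (at t within {0..T})"
      using der[OF y] by (simp add: has_real_derivative_iff_has_vector_derivative)
    have "((\<lambda>s. \<Sum>x\<in>S. f s x * e x y) has_real_derivative (\<Sum>x\<in>S. time_deriv T f t x * e x y)) (at t within {0..T})"
      by (intro DERIV_sum DERIV_cmult_right der) (use S(2) in blast)
    then have "((\<lambda>s. f s y) has_real_derivative (\<Sum>x\<in>S. time_deriv T f t x * e x y)) (at t within {0..T})"
      by (rule has_field_derivative_transform_within[OF _ zero_less_one t]) (rule nod[OF _ y, symmetric])
    then show "((\<lambda>s. f s y) has_vector_derivative (\<Sum>x\<in>S. time_deriv T f t x * e x y)) (at t within {0..T})"
      by (simp add: has_real_derivative_iff_has_vector_derivative)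
    show "at t within {0..T} \<noteq> bot" using T t by (simp add: trivial_limit_within islimpt_Icc)
  qed
  moreover have "(\<lambda>y. \<Sum>x\<in>S. time_deriv T f t x * e x y) \<in> DG \<T> p"
    by (rule DG_sum[OF S(1)]) (use S(3) in blast)
  ultimately show "time_deriv T f t \<in> DG \<T> p" by (rule DG_cong[rotated])
qed

section \<open>The auxiliary variable in time\<close>

lemma domain_integral_add:
  fixes f g :: "real ^ 'd \<Rightarrow> real"
  assumes "mesh \<Omega> \<T>" "PC0 \<T> f" "PC0 \<T> g"
  shows "(LINT x:\<Omega>|lebesgue. f x + g x) = (LINT x:\<Omega>|lebesgue. f x) + (LINT x:\<Omega>|lebesgue. g x)"
  by (rule set_integral_add(2)[OF PC0_integral(1)[OF assms(1,2)] PC0_integral(1)[OF assms(1,3)]])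

lemma domain_integral_diff:
  fixes f g :: "real ^ 'd \<Rightarrow> real"
  assumes "mesh \<Omega> \<T>" "PC0 \<T> f" "PC0 \<T> g"
  shows "(LINT x:\<Omega>|lebesgue. f x - g x) = (LINT x:\<Omega>|lebesgue. f x) - (LINT x:\<Omega>|lebesgue. g x)"
  by (rule set_integral_diff(2)[OF PC0_integral(1)[OF assms(1,2)] PC0_integral(1)[OF assms(1,3)]])

lemma domain_integral_sum:
  fixes f :: "'i \<Rightarrow> real ^ 'd \<Rightarrow> real"
  assumes m: "mesh \<Omega> \<T>" and "finite I" "\<And>i. i \<in> I \<Longrightarrow> PC0 \<T> (f i)"
  shows "(LINT x:\<Omega>|lebesgue. (\<Sum>i\<in>I. f i x)) = (\<Sum>i\<in>I. LINT x:\<Omega>|lebesgue. f i x)"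
  using assms(2,3)
proof (induction I)
  case empty show ?case by (simp add: set_lebesgue_integral_def)
next
  case (insert i I)
  have "PC0 \<T> (\<lambda>x. \<Sum>i\<in>I. f i x)" using insert.prems by (intro PC0_sum) auto
  then show ?case using insert by (simp add: domain_integral_add[OF m])
qed

text \<open>Zero integral forces a nonnegative \<open>f\<close> to vanish almost everywhere, and a nonempty open set,
  such as the set in an element where the continuous extension of \<open>f\<close> does not vanish, is not
  null.\<close>
lemma domain_integral_definite:
  fixes f :: "real ^ 'd \<Rightarrow> real"
  assumes m: "mesh \<Omega> \<T>" and f: "PC0 \<T> f" and pos: "\<And>x. x \<in> \<Union>\<T> \<Longrightarrow> 0 \<le> f x"
    and zero: "(LINT x:\<Omega>|lebesgue. f x) = 0"
  shows "\<forall>x\<in>\<Union>\<T>. f x = 0"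
proof -
  have nn: "0 \<le> (LINT x:K|lebesgue. f x)" if "K \<in> \<T>" for K
    unfolding set_lebesgue_integral_def
  proof (rule Bochner_Integration.integral_nonneg)
    show "0 \<le> indicator K x *\<^sub>R f x" for x using pos that by (cases "x \<in> K") auto
  qed
  have z: "(LINT x:K|lebesgue. f x) = 0" if "K \<in> \<T>" for K
    using zero nn that mesh_finite[OF m] unfolding PC0_integral(2)[OF m f]
    by (subst (asm) sum_nonneg_eq_0_iff) auto
  have "f x = 0" if K: "K \<in> \<T>" and x: "x \<in> K" for K x
  proof -
    have oK: "open K" by (rule open_polytopeD(4)[OF mesh_open_polytope[OF m K]])
    obtain g where g: "continuous_on UNIV g" "\<forall>x\<in>K. f x = g x" using f K unfolding PC0_def by blast
    let ?N = "K \<inter> g -` (- {0})"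
    have oN: "open ?N" by (intro open_Int oK continuous_open_vimage) (use g(1) in \<open>auto simp: continuous_on_eq_continuous_at\<close>)
    have "integrable lebesgue (\<lambda>x. indicator K x *\<^sub>R f x)"
      using PC0_integrable_element[OF m K f] unfolding set_integrable_def .
    moreover have "AE x in lebesgue. 0 \<le> indicator K x *\<^sub>R f x"
      using pos K by (intro AE_I2) (auto simp: indicator_def)
    ultimately have "AE x in lebesgue. indicator K x *\<^sub>R f x = 0"
      using z[OF K] unfolding set_lebesgue_integral_def by (subst (asm) integral_nonneg_eq_0_iff_AE) auto
    then have "AE x in lebesgue. x \<notin> ?N"
    proof eventually_elim
      case (elim x)
      show ?case
      proof
        assume "x \<in> ?N"
        then show False using elim bspec[OF g(2), of x] by simp
      qed
    qed
    then have "?N \<in> null_sets lebesgue" using oN by (subst AE_iff_null_sets) auto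
    then have "negligible ?N" by (simp add: negligible_iff_null_sets)
    then have "?N = {}" using open_not_negligible[OF oN] by blast
    then show ?thesis using x g(2) by auto
  qed
  then show ?thesis by blast
qed

lemma DG_vec_PC1: "u \<in> DG_vec \<T> p \<Longrightarrow> PC1_vec \<T> u"
  using DG_PC1 unfolding DG_vec_def by blast

lemma DG0_vec_PC1: "v \<in> DG0_vec \<Omega> \<T> p \<Longrightarrow> PC1_vec \<T> v"
  using DG_PC1 unfolding DG0_vec_def DG0_def by blast

lemma DG0_vec_boundary:
  fixes v :: "real ^ 'd \<Rightarrow> real ^ 'd"
  assumes v: "v \<in> DG0_vec \<Omega> \<T> p" and m: "mesh \<Omega> \<T>" and K: "K \<in> \<T>" and F: "F facet_of closure K"
  shows "AE x in facet_measure F. x \<in> F \<inter> frontier \<Omega> \<longrightarrow> tr K v x = 0"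
proof -
  have v0: "PC0 \<T> v" by (rule PC1_vec_imp_PC0[OF DG0_vec_PC1[OF v]])
  have "AE x in facet_measure F. \<forall>i\<in>UNIV. x \<in> F \<inter> frontier \<Omega> \<longrightarrow> tr K (\<lambda>x. v x $ i) x = 0"
    by (rule AE_finite_allI) (use v K F in \<open>auto simp: DG0_vec_def DG0_def\<close>)
  then show ?thesis
  proof eventually_elim
    case (elim x)
    show ?case
    proof
      assume x: "x \<in> F \<inter> frontier \<Omega>"
      then have "x \<in> closure K" using facet_of_imp_subset[OF F] by blast
      then show "tr K v x = 0" using elim x tr_vec_nth[OF v0 m K] by (simp add: vec_eq_iff)
    qed
  qed
qed

lemma DGn_PC1: "q \<in> DGn \<Omega> \<T> p \<Longrightarrow> PC1_vec \<T> q"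
  using DG_vec_PC1[of q \<T> p] by (simp add: DGn_def)

lemma DGn_boundary:
  assumes "q \<in> DGn \<Omega> \<T> p" "K \<in> \<T>" "F facet_of closure K"
  shows "AE x in facet_measure F. x \<in> F \<inter> frontier \<Omega> \<longrightarrow> tr K q x \<bullet> outward_normal K F = 0"
  using assms unfolding DGn_def by simp

lemma DGn_lin:
  assumes m: "mesh \<Omega> \<T>" and f: "f \<in> DGn \<Omega> \<T> p" and g: "g \<in> DGn \<Omega> \<T> p"
  shows "(\<lambda>x. a *\<^sub>R f x + g x) \<in> DGn \<Omega> \<T> p"
  unfolding DGn_def mem_Collect_eq
proof (intro conjI ballI allI impI)
  show "(\<lambda>x. a *\<^sub>R f x + g x) \<in> DG_vec \<T> p"
    unfolding DG_vec_def mem_Collect_eq vector_add_component vector_scaleR_component real_scaleR_def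
  proof (intro allI DG_lin)
    show "(\<lambda>x. f x $ i) \<in> DG \<T> p" "(\<lambda>x. g x $ i) \<in> DG \<T> p" for i
      using f g by (simp_all add: DGn_def DG_vec_def)
  qed
  fix K F assume K: "K \<in> \<T>" and F: "F facet_of closure K"
  note f0 = PC1_vec_imp_PC0[OF DGn_PC1[OF f]] and g0 = PC1_vec_imp_PC0[OF DGn_PC1[OF g]]
  show "AE x in facet_measure F. x \<in> F \<inter> frontier \<Omega> \<longrightarrow> tr K (\<lambda>x. a *\<^sub>R f x + g x) x \<bullet> outward_normal K F = 0"
    using DGn_boundary[OF f K F] DGn_boundary[OF g K F]
  proof eventually_elim
    case (elim x)
    show ?case
    proof
      assume x: "x \<in> F \<inter> frontier \<Omega>"
      then have xK: "x \<in> closure K" using facet_of_imp_subset[OF F] by blast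
      have "tr K (\<lambda>x. a *\<^sub>R f x + g x) x = a *\<^sub>R tr K f x + tr K g x"
        by (intro tr_eqI[OF mesh_open_polytope[OF m K] xK] tendsto_add tendsto_scaleR tendsto_const
            tendsto_tr[OF f0 m K xK] tendsto_tr[OF g0 m K xK])
      then show "tr K (\<lambda>x. a *\<^sub>R f x + g x) x \<bullet> outward_normal K F = 0"
        using elim x by (simp add: inner_add_left)
    qed
  qed
qed

lemma DGn_zero:
  assumes m: "mesh \<Omega> \<T>"
  shows "(\<lambda>x. 0) \<in> DGn \<Omega> \<T> p"
  unfolding DGn_def mem_Collect_eq
proof (intro conjI ballI allI impI)
  show "(\<lambda>x. 0) \<in> DG_vec \<T> p" unfolding DG_vec_def by (simp add: DG_zero)
  fix K F assume K: "K \<in> \<T>" and F: "F facet_of closure K"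
  have "tr K (\<lambda>x. 0 :: real^'a) x = 0" if "x \<in> F" for x
    using facet_of_imp_subset[OF F] that by (intro tr_eqI[OF mesh_open_polytope[OF m K]] tendsto_const) blast
  then show "AE x in facet_measure F. x \<in> F \<inter> frontier \<Omega> \<longrightarrow> tr K (\<lambda>x. 0) x \<bullet> outward_normal K F = 0"
    by (intro AE_I2) simp
qed

text \<open>The functional \<open>Z \<mapsto> \<integral> grad r \<bullet> Z\<close> with the interface correction, which defines \<open>q\<close> as
  its representative with respect to the \<open>L\<^sup>2\<close> inner product.\<close>
definition gradient_form :: "(real ^ 'd) set \<Rightarrow> (real ^ 'd) set set \<Rightarrow> (real ^ 'd \<Rightarrow> real) \<Rightarrow> (real ^ 'd \<Rightarrow> real ^ 'd) \<Rightarrow> real" where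
  "gradient_form \<Omega> \<T> r Z = (LINT x:\<Omega>|lebesgue. grad r x \<bullet> Z x)
     - interface_integral \<Omega> \<T> (\<lambda>F x. jump \<T> F r x \<bullet> avg \<T> F Z x)"

lemma facet_continuous_jump_avg:
  assumes "PC0 \<T> r" "PC0 \<T> Z" "mesh \<Omega> \<T>"
  shows "facet_continuous F (\<lambda>x. jump \<T> F r x \<bullet> avg \<T> F Z x)"
  using facet_continuous_jump[OF assms(1,3), of F] facet_continuous_avg[OF assms(2,3), of F]
  unfolding facet_continuous_PC0 by (intro PC0_inner)

lemma gradient_form_sum_left:
  assumes m: "mesh \<Omega> \<T>" and \<Omega>: "open \<Omega>" and S: "finite S" and e: "\<And>i. i \<in> S \<Longrightarrow> PC1 \<T> (e i)"
    and Z: "PC0 \<T> Z" and r: "\<And>y. y \<in> \<Union>\<T> \<Longrightarrow> r y = (\<Sum>i\<in>S. c i * e i y)"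
  shows "gradient_form \<Omega> \<T> r Z = (\<Sum>i\<in>S. c i * gradient_form \<Omega> \<T> (e i) Z)"
proof -
  have ce: "PC1 \<T> (\<lambda>y. c i * e i y)" if "i \<in> S" for i by (intro PC1_mult PC1_const e that)
  have gr: "grad r x = (\<Sum>i\<in>S. c i *\<^sub>R grad (e i) x)" if x: "x \<in> \<Union>\<T>" for x
  proof -
    obtain K where K: "K \<in> \<T>" "x \<in> K" using x by blast
    have oK: "open K" by (rule open_polytopeD(4)[OF mesh_open_polytope[OF m K(1)]])
    let ?s = "\<lambda>y. \<Sum>i\<in>S. c i * e i y"
    have ed: "e i differentiable (at x)" if "i \<in> S" for i by (rule PC1_differentiable[OF e[OF that] m x])
    have ced: "(\<lambda>y. c i * e i y) differentiable (at x)" if "i \<in> S" for i by (rule PC1_differentiable[OF ce[OF that] m x])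
    have sd: "?s differentiable (at x)" using ced S by (intro differentiable_sum) auto
    have "frechet_derivative ?s (at x) = frechet_derivative r (at x)"
      by (rule frechet_derivative_transform_within_open[OF sd oK K(2)]) (rule r[symmetric], use K(1) in blast)
    moreover have "frechet_derivative ?s (at x) v = (\<Sum>i\<in>S. c i * frechet_derivative (e i) (at x) v)" for v
    proof -
      have "frechet_derivative ?s (at x) v = (\<Sum>i\<in>S. frechet_derivative (\<lambda>y. c i * e i y) (at x) v)"
        by (rule frechet_sum[OF ced])
      also have "\<dots> = (\<Sum>i\<in>S. c i * frechet_derivative (e i) (at x) v)"
        using ed by (intro sum.cong refl) (simp add: frechet_mult frechet_derivative_const)
      finally show ?thesis .
    qed
    ultimately show ?thesis by (simp add: grad_def vec_eq_iff)
  qed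
  have jr: "jump \<T> F r x = (\<Sum>i\<in>S. c i *\<^sub>R jump \<T> F (e i) x)" if x: "x \<in> F" for F x
  proof -
    have "tr K r x = (\<Sum>i\<in>S. c i * tr K (e i) x)" if K: "K \<in> adj \<T> F" for K
    proof -
      have KT: "K \<in> \<T>" and xK: "x \<in> closure K" using adj_facet[OF K] x by auto
      have "tr K r x = tr K (\<lambda>y. \<Sum>i\<in>S. c i * e i y) x" by (rule tr_cong) (use r KT in blast)
      also have "\<dots> = (\<Sum>i\<in>S. tr K (\<lambda>y. c i * e i y) x)"
        by (rule tr_sum[OF PC1_imp_PC0[OF ce] m KT xK])
      also have "\<dots> = (\<Sum>i\<in>S. c i * tr K (e i) x)"
      proof (rule sum.cong[OF refl])
        fix i assume i: "i \<in> S"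
        show "tr K (\<lambda>y. c i * e i y) x = c i * tr K (e i) x"
          by (intro tr_eqI[OF mesh_open_polytope[OF m KT] xK] tendsto_mult tendsto_const
              tendsto_tr[OF PC1_imp_PC0[OF e[OF i]] m KT xK])
      qed
      finally show ?thesis .
    qed
    then have "jump \<T> F r x = (\<Sum>K\<in>adj \<T> F. \<Sum>i\<in>S. (c i * tr K (e i) x) *\<^sub>R outward_normal K F)"
      by (simp add: jump_def scaleR_sum_left)
    also have "\<dots> = (\<Sum>i\<in>S. \<Sum>K\<in>adj \<T> F. (c i * tr K (e i) x) *\<^sub>R outward_normal K F)" by (rule sum.swap)
    finally show ?thesis by (simp add: jump_def scaleR_sum_right)
  qed
  have pg: "PC0 \<T> (\<lambda>x. c i * (grad (e i) x \<bullet> Z x))" if "i \<in> S" for i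
    by (intro PC0_mult PC0_const PC0_inner PC0_grad[OF e[OF that] m] Z)
  have "(LINT x:\<Omega>|lebesgue. grad r x \<bullet> Z x) = (LINT x:\<Omega>|lebesgue. (\<Sum>i\<in>S. c i * (grad (e i) x \<bullet> Z x)))"
    by (rule domain_integral_cong[OF m PC0_sum[OF pg]]) (simp_all add: gr inner_sum_left)
  also have "\<dots> = (\<Sum>i\<in>S. c i * (LINT x:\<Omega>|lebesgue. grad (e i) x \<bullet> Z x))"
    by (simp add: domain_integral_sum[OF m S pg])
  finally have 1: "(LINT x:\<Omega>|lebesgue. grad r x \<bullet> Z x) = (\<Sum>i\<in>S. c i * (LINT x:\<Omega>|lebesgue. grad (e i) x \<bullet> Z x))" .
  have "interface_integral \<Omega> \<T> (\<lambda>F x. jump \<T> F r x \<bullet> avg \<T> F Z x)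
      = interface_integral \<Omega> \<T> (\<lambda>F x. \<Sum>i\<in>S. c i * (jump \<T> F (e i) x \<bullet> avg \<T> F Z x))"
    by (rule interface_integral_cong[OF m \<Omega>]) (simp add: jr inner_sum_left)
  also have "\<dots> = (\<Sum>i\<in>S. interface_integral \<Omega> \<T> (\<lambda>F x. c i * (jump \<T> F (e i) x \<bullet> avg \<T> F Z x)))"
  proof (rule interface_integral_sum[OF m \<Omega> S])
    fix F i assume "i \<in> S"
    then have "facet_continuous F (\<lambda>x. jump \<T> F (e i) x \<bullet> avg \<T> F Z x)"
      by (intro facet_continuous_jump_avg[OF PC1_imp_PC0[OF e] Z m])
    then show "facet_continuous F (\<lambda>x. c i * (jump \<T> F (e i) x \<bullet> avg \<T> F Z x))"
      unfolding facet_continuous_PC0 by (intro PC0_mult PC0_const)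
  qed
  finally have 2: "interface_integral \<Omega> \<T> (\<lambda>F x. jump \<T> F r x \<bullet> avg \<T> F Z x)
     = (\<Sum>i\<in>S. c i * interface_integral \<Omega> \<T> (\<lambda>F x. jump \<T> F (e i) x \<bullet> avg \<T> F Z x))"
    by (simp add: interface_integral_cmult)
  show ?thesis unfolding gradient_form_def 1 2 by (simp add: right_diff_distrib sum_subtractf)
qed

lemma gradient_form_sum_right:
  assumes m: "mesh \<Omega> \<T>" and \<Omega>: "open \<Omega>" and S: "finite S" and e: "\<And>i. i \<in> S \<Longrightarrow> PC0 \<T> (e i)"
    and r: "PC1 \<T> r" and Z: "\<And>y. y \<in> \<Union>\<T> \<Longrightarrow> Z y = (\<Sum>i\<in>S. c i *\<^sub>R e i y)"
  shows "gradient_form \<Omega> \<T> r Z = (\<Sum>i\<in>S. c i * gradient_form \<Omega> \<T> r (e i))"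
proof -
  have ce: "PC0 \<T> (\<lambda>y. c i *\<^sub>R e i y)" if "i \<in> S" for i by (intro PC0_scaleR PC0_const e that)
  have az: "avg \<T> F Z x = (\<Sum>i\<in>S. c i *\<^sub>R avg \<T> F (e i) x)" if x: "x \<in> F" for F x
  proof -
    have "tr K Z x = (\<Sum>i\<in>S. c i *\<^sub>R tr K (e i) x)" if K: "K \<in> adj \<T> F" for K
    proof -
      have KT: "K \<in> \<T>" and xK: "x \<in> closure K" using adj_facet[OF K] x by auto
      have "tr K Z x = tr K (\<lambda>y. \<Sum>i\<in>S. c i *\<^sub>R e i y) x" by (rule tr_cong) (use Z KT in blast)
      also have "\<dots> = (\<Sum>i\<in>S. tr K (\<lambda>y. c i *\<^sub>R e i y) x)" by (rule tr_sum[OF ce m KT xK])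
      also have "\<dots> = (\<Sum>i\<in>S. c i *\<^sub>R tr K (e i) x)"
      proof (rule sum.cong[OF refl])
        fix i assume i: "i \<in> S"
        show "tr K (\<lambda>y. c i *\<^sub>R e i y) x = c i *\<^sub>R tr K (e i) x"
          by (intro tr_eqI[OF mesh_open_polytope[OF m KT] xK] tendsto_scaleR tendsto_const
              tendsto_tr[OF e[OF i] m KT xK])
      qed
      finally show ?thesis .
    qed
    then have "avg \<T> F Z x = (\<Sum>K\<in>adj \<T> F. \<Sum>i\<in>S. c i *\<^sub>R tr K (e i) x) /\<^sub>R real (card (adj \<T> F))"
      by (simp add: avg_def)
    also have "(\<Sum>K\<in>adj \<T> F. \<Sum>i\<in>S. c i *\<^sub>R tr K (e i) x) = (\<Sum>i\<in>S. \<Sum>K\<in>adj \<T> F. c i *\<^sub>R tr K (e i) x)" by (rule sum.swap)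
    finally show ?thesis by (simp add: avg_def scaleR_sum_right ac_simps)
  qed
  have pg: "PC0 \<T> (\<lambda>x. c i * (grad r x \<bullet> e i x))" if "i \<in> S" for i
    by (intro PC0_mult PC0_const PC0_inner PC0_grad[OF r m] e that)
  have "(LINT x:\<Omega>|lebesgue. grad r x \<bullet> Z x) = (LINT x:\<Omega>|lebesgue. (\<Sum>i\<in>S. c i * (grad r x \<bullet> e i x)))"
    by (rule domain_integral_cong[OF m PC0_sum[OF pg]]) (simp_all add: Z inner_sum_right)
  also have "\<dots> = (\<Sum>i\<in>S. c i * (LINT x:\<Omega>|lebesgue. grad r x \<bullet> e i x))"
    by (simp add: domain_integral_sum[OF m S pg])
  finally have 1: "(LINT x:\<Omega>|lebesgue. grad r x \<bullet> Z x) = (\<Sum>i\<in>S. c i * (LINT x:\<Omega>|lebesgue. grad r x \<bullet> e i x))" .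
  have "interface_integral \<Omega> \<T> (\<lambda>F x. jump \<T> F r x \<bullet> avg \<T> F Z x)
      = interface_integral \<Omega> \<T> (\<lambda>F x. \<Sum>i\<in>S. c i * (jump \<T> F r x \<bullet> avg \<T> F (e i) x))"
    by (rule interface_integral_cong[OF m \<Omega>]) (simp add: az inner_sum_right)
  also have "\<dots> = (\<Sum>i\<in>S. interface_integral \<Omega> \<T> (\<lambda>F x. c i * (jump \<T> F r x \<bullet> avg \<T> F (e i) x)))"
  proof (rule interface_integral_sum[OF m \<Omega> S])
    fix F i assume "i \<in> S"
    then have "facet_continuous F (\<lambda>x. jump \<T> F r x \<bullet> avg \<T> F (e i) x)"
      by (intro facet_continuous_jump_avg[OF PC1_imp_PC0[OF r] e m])
    then show "facet_continuous F (\<lambda>x. c i * (jump \<T> F r x \<bullet> avg \<T> F (e i) x))"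
      unfolding facet_continuous_PC0 by (intro PC0_mult PC0_const)
  qed
  finally have 2: "interface_integral \<Omega> \<T> (\<lambda>F x. jump \<T> F r x \<bullet> avg \<T> F Z x)
     = (\<Sum>i\<in>S. c i * interface_integral \<Omega> \<T> (\<lambda>F x. jump \<T> F r x \<bullet> avg \<T> F (e i) x))"
    by (simp add: interface_integral_cmult)
  show ?thesis unfolding gradient_form_def 1 2 by (simp add: right_diff_distrib sum_subtractf)
qed

text \<open>No differentiability of \<open>q\<close> in time is assumed. Since \<open>q s\<close> represents the functional
  \<open>gradient_form\<close> of \<open>r s\<close>, its coefficients in an orthonormal basis of the test space are
  linear in the nodal values of \<open>r s\<close>. The square of its norm is the sum of the squares of the
  coefficients, and so it is differentiable.\<close>
lemma gradient_energy_derivative: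
  fixes q :: "real \<Rightarrow> real ^ 'd \<Rightarrow> real ^ 'd"
  assumes m: "mesh \<Omega> \<T>" and \<Omega>: "open \<Omega>" and T: "0 < T" and t: "t \<in> {0..T}"
    and r: "\<And>s. s \<in> {0..T} \<Longrightarrow> r s \<in> DG \<T> p"
    and d: "\<And>s x. s \<in> {0..T} \<Longrightarrow> x \<in> \<Union>\<T> \<Longrightarrow> (\<lambda>s. r s x) differentiable (at s within {0..T})"
    and q: "\<And>s. s \<in> {0..T} \<Longrightarrow> q s \<in> DGn \<Omega> \<T> p"
    and eq: "\<And>s Z. s \<in> {0..T} \<Longrightarrow> Z \<in> DGn \<Omega> \<T> p \<Longrightarrow> (LINT x:\<Omega>|lebesgue. q s x \<bullet> Z x) = gradient_form \<Omega> \<T> (r s) Z"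
  shows "((\<lambda>s. LINT x:\<Omega>|lebesgue. (norm (q s x))\<^sup>2) has_real_derivative
     2 * gradient_form \<Omega> \<T> (time_deriv T r t) (q t)) (at t within {0..T})"
proof -
  let ?V = "DGn \<Omega> \<T> p" and ?b = "\<lambda>f g. LINT x:\<Omega>|lebesgue. f x \<bullet> g x"
  let ?r' = "time_deriv T r t"
  have r'DG: "?r' \<in> DG \<T> p" and rtd: "time_diff T (\<Union>\<T>) r t ?r'"
    using DG_time_derivative[OF m T t r d] by blast+
  obtain S e where S: "finite S" "S \<subseteq> \<Union>\<T>" "\<forall>x\<in>S. e x \<in> DG \<T> p"
    "\<forall>f\<in>DG \<T> p. \<forall>y\<in>\<Union>\<T>. f y = (\<Sum>x\<in>S. f x * e x y)"
    using DG_nodal_basis[OF m, of p] by (elim exE conjE)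
  have V0: "PC0 \<T> Z" if "Z \<in> ?V" for Z by (rule PC1_vec_imp_PC0[OF DGn_PC1[OF that]])
  have "\<exists>E. finite E \<and> E \<subseteq> ?V \<and> (\<forall>e\<in>E. \<forall>e'\<in>E. ?b e e' = (if e = e' then 1 else 0)) \<and>
    (\<forall>f\<in>?V. \<forall>x\<in>\<Union>\<T>. f x = (\<Sum>e\<in>E. ?b f e *\<^sub>R e x))"
  proof (rule gram_schmidt[where \<Lambda>="S \<times> UNIV"])
    show "finite (S \<times> (UNIV :: 'd set))" using S(1) by simp
    show "S \<times> UNIV \<subseteq> \<Union>\<T> \<times> (UNIV :: 'd set)" using S(2) by blast
    show "(\<lambda>x. 0) \<in> ?V" by (rule DGn_zero[OF m])
    show "(\<lambda>x. a *\<^sub>R f x + g x) \<in> ?V" if "f \<in> ?V" "g \<in> ?V" for a f g by (rule DGn_lin[OF m that])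
    show "?b (\<lambda>x. a *\<^sub>R f x + g x) h = a * ?b f h + ?b g h" if "f \<in> ?V" "g \<in> ?V" "h \<in> ?V" for a f g h
    proof -
      have "(LINT x:\<Omega>|lebesgue. (a *\<^sub>R f x + g x) \<bullet> h x) = (LINT x:\<Omega>|lebesgue. a * (f x \<bullet> h x) + g x \<bullet> h x)"
        by (simp add: inner_add_left)
      also have "\<dots> = (LINT x:\<Omega>|lebesgue. a * (f x \<bullet> h x)) + ?b g h"
        by (rule domain_integral_add[OF m]) (intro PC0_mult PC0_const PC0_inner V0 that)+
      finally show ?thesis by simp
    qed
    show "?b f g = ?b g f" for f g by (simp add: inner_commute)
    show "0 \<le> ?b f f" for f
      unfolding set_lebesgue_integral_def by (rule Bochner_Integration.integral_nonneg) simp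
    show "\<forall>x\<in>\<Union>\<T>. f x = 0" if "f \<in> ?V" "?b f f = 0" for f
    proof -
      have "\<forall>x\<in>\<Union>\<T>. f x \<bullet> f x = 0"
        by (rule domain_integral_definite[OF m PC0_inner[OF V0[OF that(1)] V0[OF that(1)]] _ that(2)]) simp
      then show ?thesis by simp
    qed
    show "?b f g = 0" if "f \<in> ?V" "g \<in> ?V" "\<forall>x\<in>\<Union>\<T>. f x = 0" for f g
    proof -
      have "?b f g = (LINT x:\<Omega>|lebesgue. 0)"
        by (rule domain_integral_cong[OF m PC0_const]) (simp only: bspec[OF that(3)] inner_zero_left)
      then show ?thesis by (simp add: set_lebesgue_integral_def)
    qed
    show "\<forall>x\<in>\<Union>\<T>. f x = 0" if f: "f \<in> ?V" "\<forall>(x, i)\<in>S \<times> UNIV. f x $ i = 0" for f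
    proof
      fix y assume y: "y \<in> \<Union>\<T>"
      have "f y $ i = 0" for i
      proof -
        have "(\<lambda>x. f x $ i) \<in> DG \<T> p" using f(1) by (simp add: DGn_def DG_vec_def)
        from bspec[OF bspec[OF S(4) this] y] show ?thesis using f(2) by simp
      qed
      then show "f y = 0" by (simp add: vec_eq_iff)
    qed
  qed
  then obtain E where E: "finite E" "E \<subseteq> ?V" "\<forall>f\<in>?V. \<forall>x\<in>\<Union>\<T>. f x = (\<Sum>e\<in>E. ?b f e *\<^sub>R e x)" by (elim exE conjE)
  have EV: "Z \<in> ?V" if "Z \<in> E" for Z using E(2) that by blast
  let ?g = "\<lambda>f Z. gradient_form \<Omega> \<T> f Z"
  have nodal: "?g f Z = (\<Sum>x\<in>S. f x * ?g (e x) Z)" if "f \<in> DG \<T> p" "Z \<in> ?V" for f Z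
    by (rule gradient_form_sum_left[OF m \<Omega> S(1) _ V0[OF that(2)]])
      (use S(3) DG_PC1 bspec[OF S(4) that(1)] in blast)+
  have psi: "(LINT x:\<Omega>|lebesgue. (norm (q s x))\<^sup>2) = (\<Sum>Z\<in>E. (\<Sum>x\<in>S. r s x * ?g (e x) Z)\<^sup>2)" if s: "s \<in> {0..T}" for s
  proof -
    have p: "PC0 \<T> (\<lambda>x. ?b (q s) Z * (q s x \<bullet> Z x))" if "Z \<in> E" for Z
      by (intro PC0_mult PC0_const PC0_inner V0 q[OF s] EV[OF that])
    have "(LINT x:\<Omega>|lebesgue. (norm (q s x))\<^sup>2) = (LINT x:\<Omega>|lebesgue. (\<Sum>Z\<in>E. ?b (q s) Z * (q s x \<bullet> Z x)))"
    proof (rule domain_integral_cong[OF m PC0_sum[OF p]])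
      fix x assume x: "x \<in> \<Union>\<T>"
      have "(norm (q s x))\<^sup>2 = q s x \<bullet> (\<Sum>Z\<in>E. ?b (q s) Z *\<^sub>R Z x)"
        using bspec[OF bspec[OF E(3) q[OF s]] x] by (simp add: power2_norm_eq_inner)
      then show "(norm (q s x))\<^sup>2 = (\<Sum>Z\<in>E. ?b (q s) Z * (q s x \<bullet> Z x))" by (simp add: inner_sum_right)
    qed
    also have "\<dots> = (\<Sum>Z\<in>E. ?b (q s) Z * ?b (q s) Z)" by (simp add: domain_integral_sum[OF m E(1) p])
    also have "\<dots> = (\<Sum>Z\<in>E. (\<Sum>x\<in>S. r s x * ?g (e x) Z)\<^sup>2)"
      by (rule sum.cong[OF refl]) (simp only: eq[OF s EV] nodal[OF r[OF s] EV] power2_eq_square)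
    finally show ?thesis .
  qed
  have "((\<lambda>s. \<Sum>Z\<in>E. (\<Sum>x\<in>S. r s x * ?g (e x) Z)\<^sup>2) has_real_derivative
      (\<Sum>Z\<in>E. 2 * (?g (r t) Z * ?g ?r' Z))) (at t within {0..T})"
  proof (rule DERIV_sum)
    fix Z assume Z: "Z \<in> E"
    have "((\<lambda>s. \<Sum>x\<in>S. r s x * ?g (e x) Z) has_real_derivative (\<Sum>x\<in>S. ?r' x * ?g (e x) Z)) (at t within {0..T})"
      by (intro DERIV_sum DERIV_cmult_right time_diffD[OF rtd]) (use S(2) in blast)
    from DERIV_power[OF this, of 2] show "((\<lambda>s. (\<Sum>x\<in>S. r s x * ?g (e x) Z)\<^sup>2) has_real_derivative 2 * (?g (r t) Z * ?g ?r' Z)) (at t within {0..T})"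
      unfolding nodal[OF r[OF t] EV[OF Z]] nodal[OF r'DG EV[OF Z]] by (simp add: ac_simps)
  qed
  also have "(\<Sum>Z\<in>E. 2 * (?g (r t) Z * ?g ?r' Z)) = 2 * (\<Sum>Z\<in>E. ?b (q t) Z * ?g ?r' Z)"
    unfolding sum_distrib_left by (rule sum.cong[OF refl]) (simp add: eq[OF t EV])
  also have "(\<Sum>Z\<in>E. ?b (q t) Z * ?g ?r' Z) = ?g ?r' (q t)"
    by (rule gradient_form_sum_right[OF m \<Omega> E(1) _ DG_PC1[OF r'DG], symmetric])
      (use V0 EV bspec[OF E(3) q[OF t]] in blast)+
  finally show ?thesis
    by (rule has_field_derivative_transform_within[OF _ zero_less_one t]) (rule psi[symmetric])
qed

section \<open>Mass and energy balance\<close>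

lemma smooth_potential:
  assumes "smooth_on UNIV (W :: real \<Rightarrow> real)"
  shows "(W has_real_derivative deriv W r) (at r)" "continuous_on UNIV (deriv W)"
proof -
  have "Ck_on (Suc 0) UNIV W" using assms unfolding smooth_on_def by blast
  then have d: "W differentiable (at x)" and c: "continuous_on UNIV (\<lambda>x. frechet_derivative W (at x) 1)" for x
    by simp_all
  show D: "(W has_real_derivative deriv W r) (at r)" for r
    using d[of r] by (simp add: DERIV_deriv_iff_real_differentiable)
  have "frechet_derivative W (at x) = (*) (deriv W x)" for x
    using D[of x] unfolding has_field_derivative_def by (rule frechet_derivative_unique)
  then show "continuous_on UNIV (deriv W)" using c by simp
qed

lemma avg_const:
  assumes m: "mesh \<Omega> \<T>" and F: "F \<in> interfaces \<T>" "x \<in> F"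
  shows "avg \<T> F (\<lambda>y. c :: real) x = c"
proof -
  obtain K where "K \<in> \<T>" "F facet_of closure K" using interface_facet[OF m F(1)] by blast
  then have ne: "adj \<T> F \<noteq> {}" by (auto simp: adj_def)
  have "finite (adj \<T> F)" using mesh_finite[OF m] by (simp add: adj_def)
  then have card: "card (adj \<T> F) \<noteq> 0" using ne by simp
  have "tr K (\<lambda>y. c) x = c" if "K \<in> adj \<T> F" for K
    using adj_facet[OF that] F(2) by (intro tr_eqI[OF mesh_open_polytope[OF m]] tendsto_const) auto
  then show ?thesis using card by (simp add: avg_def)
qed

lemma interface_integral_minus: "interface_integral \<Omega> \<T> (\<lambda>F x. - f F x) = - interface_integral \<Omega> \<T> f"
  using interface_integral_cmult[of \<Omega> \<T> "-1" f] by simp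

locale scheme =
  fixes \<Omega> :: "(real ^ 'd) set" and \<T> :: "(real ^ 'd) set set" and p :: nat and T \<gamma> \<mu> :: real
    and W :: "real \<Rightarrow> real" and B \<rho> \<tau> v q
  assumes \<Omega>: "open \<Omega>" and m: "mesh \<Omega> \<T>" and T: "0 < T" and W: "smooth_on UNIV W"
    and sol: "scheme_solution \<Omega> \<T> p T W \<gamma> \<mu> B \<rho> \<tau> v q"
begin

lemma spaces:
  assumes "t \<in> {0..T}"
  shows "\<rho> t \<in> DG \<T> p" "\<tau> t \<in> DG \<T> p" "v t \<in> DG0_vec \<Omega> \<T> p" "q t \<in> DGn \<Omega> \<T> p"
  using assms sol unfolding scheme_solution_def by blast+

lemma differentiable_in_time:
  assumes "t \<in> {0..T}" "x \<in> \<Union>\<T>"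
  shows "(\<lambda>s. \<rho> s x) differentiable (at t within {0..T})" "(\<lambda>s. v s x) differentiable (at t within {0..T})"
  using assms sol unfolding scheme_solution_def by blast+

lemma equations:
  assumes "t \<in> {0..T}"
  shows "\<Psi> \<in> DG \<T> p \<Longrightarrow> 0 = (LINT x:\<Omega>|lebesgue. (time_deriv T \<rho> t x + div_vec (\<lambda>y. \<rho> t y *\<^sub>R v t y) x) * \<Psi> x)
              + interface_integral \<Omega> \<T> (flux1 \<T> (\<rho> t) (v t) \<Psi>)"
    and "X \<in> DG0_vec \<Omega> \<T> p \<Longrightarrow> 0 = (LINT x:\<Omega>|lebesgue.
                 (\<rho> t x *\<^sub>R time_deriv T v t x
                  + div_mat (\<lambda>y. \<rho> t y *\<^sub>R tensor (v t y) (v t y)) x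
                  - div_vec (\<lambda>y. \<rho> t y *\<^sub>R v t y) x *\<^sub>R v t x
                  + \<rho> t x *\<^sub>R grad (\<tau> t) x
                  - (1 / 2 * \<rho> t x) *\<^sub>R grad (\<lambda>y. (norm (v t y))\<^sup>2) x) \<bullet> X x)
              + interface_integral \<Omega> \<T> (flux2 \<T> (\<rho> t) (\<tau> t) X)
              + \<mu> * B (v t) X"
    and "\<Xi> \<in> DG \<T> p \<Longrightarrow> 0 = (LINT x:\<Omega>|lebesgue.
                 (\<tau> t x - deriv W (\<rho> t x) + \<gamma> * div_vec (q t) x
                  - 1 / 2 * (norm (v t x))\<^sup>2) * \<Xi> x)
              + interface_integral \<Omega> \<T> (flux3 \<T> \<gamma> (q t) \<Xi>)"
    and "Z \<in> DGn \<Omega> \<T> p \<Longrightarrow> 0 = (LINT x:\<Omega>|lebesgue. (q t x - grad (\<rho> t) x) \<bullet> Z x)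
              + interface_integral \<Omega> \<T> (flux4 \<T> (\<rho> t) Z)"
  using assms sol unfolding scheme_solution_def by blast+

lemma density_in_time:
  assumes t: "t \<in> {0..T}"
  shows "time_diff T (\<Union>\<T>) \<rho> t (time_deriv T \<rho> t)" "time_deriv T \<rho> t \<in> DG \<T> p"
  by (rule DG_time_derivative[OF m T t spaces(1) differentiable_in_time(1)]; assumption)+

lemma velocity_deriv_component:
  assumes t: "t \<in> {0..T}" and x: "x \<in> \<Union>\<T>"
  shows "time_deriv T (\<lambda>s x. v s x $ i) t x = time_deriv T v t x $ i"
proof -
  have "((\<lambda>s. v s x) has_vector_derivative time_deriv T v t x) (at t within {0..T})"
    using differentiable_in_time(2)[OF t x] unfolding time_deriv_def by (simp add: vector_derivative_works)
  then have "((\<lambda>s. v s x $ i) has_vector_derivative time_deriv T v t x $ i) (at t within {0..T})"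
    by (rule bounded_linear.has_vector_derivative[OF bounded_linear_vec_nth])
  moreover have "at t within {0..T} \<noteq> bot" using T t by (simp add: trivial_limit_within islimpt_Icc)
  ultimately show ?thesis unfolding time_deriv_def by (intro vector_derivative_within)
qed

lemma velocity_component_in_time:
  assumes t: "t \<in> {0..T}"
  shows "time_diff T (\<Union>\<T>) (\<lambda>s x. v s x $ i) t (time_deriv T (\<lambda>s x. v s x $ i) t)"
    "time_deriv T (\<lambda>s x. v s x $ i) t \<in> DG \<T> p"
proof -
  have 1: "(\<lambda>x. v s x $ i) \<in> DG \<T> p" if "s \<in> {0..T}" for s
    using spaces(3)[OF that] by (simp add: DG0_vec_def DG0_def)
  have 2: "(\<lambda>s. v s x $ i) differentiable (at s within {0..T})" if "s \<in> {0..T}" "x \<in> \<Union>\<T>" for s x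
    using differentiable_in_time(2)[OF that] bounded_linear_vec_nth
    by (rule differentiable_compose[OF bounded_linear_imp_differentiable, rotated])
  show "time_diff T (\<Union>\<T>) (\<lambda>s x. v s x $ i) t (time_deriv T (\<lambda>s x. v s x $ i) t)"
    "time_deriv T (\<lambda>s x. v s x $ i) t \<in> DG \<T> p"
    by (rule DG_time_derivative[OF m T t 1 2]; assumption)+
qed

lemma velocity_deriv_PC0:
  assumes t: "t \<in> {0..T}" shows "PC0 \<T> (time_deriv T v t)"
proof (rule PC0_vec)
  fix i
  show "PC0 \<T> (\<lambda>x. time_deriv T v t x $ i)"
    by (rule PC0_cong[OF PC1_imp_PC0[OF DG_PC1[OF velocity_component_in_time(2)[OF t]]]]) (rule velocity_deriv_component[OF t, symmetric])
qed

lemma momentum_boundary: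
  assumes t: "t \<in> {0..T}" and K: "K \<in> \<T>" and F: "F facet_of closure K"
  shows "AE x in facet_measure F. x \<in> F \<inter> frontier \<Omega> \<longrightarrow> tr K (\<lambda>y. \<rho> t y *\<^sub>R v t y) x \<bullet> outward_normal K F = 0"
  using DG0_vec_boundary[OF spaces(3)[OF t] m K F]
proof eventually_elim
  case (elim x)
  show ?case
  proof
    assume x: "x \<in> F \<inter> frontier \<Omega>"
    then have "x \<in> closure K" using facet_of_imp_subset[OF F] by blast
    then show "tr K (\<lambda>y. \<rho> t y *\<^sub>R v t y) x \<bullet> outward_normal K F = 0"
      using elim x tr_scaleR[OF PC1_imp_PC0[OF DG_PC1[OF spaces(1)[OF t]]] PC1_vec_imp_PC0[OF DG0_vec_PC1[OF spaces(3)[OF t]]] m K] by simp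
  qed
qed

lemma momentum_PC1: "t \<in> {0..T} \<Longrightarrow> PC1_vec \<T> (\<lambda>y. \<rho> t y *\<^sub>R v t y)"
  by (intro PC1_scaleR_vec DG_PC1[OF spaces(1)] DG0_vec_PC1[OF spaces(3)])

text \<open>The constant one is a test function, with which the flux terms are the divergence theorem for
  \<open>\<rho> v\<close>.\<close>
lemma mass_conservation:
  assumes t: "t \<in> {0..T}"
  shows "((\<lambda>s. mass \<Omega> (\<rho> s)) has_real_derivative 0) (at t within {0..T})"
proof -
  let ?r' = "time_deriv T \<rho> t" and ?w = "\<lambda>y. \<rho> t y *\<^sub>R v t y"
  have r'0: "PC0 \<T> ?r'" by (rule PC1_imp_PC0[OF DG_PC1[OF density_in_time(2)[OF t]]])
  have d0: "PC0 \<T> (div_vec ?w)" by (rule PC0_div_vec[OF momentum_PC1[OF t] m])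
  have "interface_integral \<Omega> \<T> (flux1 \<T> (\<rho> t) (v t) (\<lambda>_. 1)) = interface_integral \<Omega> \<T> (\<lambda>F x. - jump_vec \<T> F ?w x)"
    by (rule interface_integral_cong[OF m \<Omega>]) (simp add: flux1_def avg_const[OF m])
  also have "\<dots> = - (LINT x:\<Omega>|lebesgue. div_vec ?w x)"
    unfolding interface_integral_minus
    by (simp only: divergence_mesh[OF \<Omega> m momentum_PC1[OF t] momentum_boundary[OF t]])
  finally have "0 = (LINT x:\<Omega>|lebesgue. ?r' x + div_vec ?w x) - (LINT x:\<Omega>|lebesgue. div_vec ?w x)"
    using equations(1)[OF t DG_const[of 1]] by simp
  then have "(LINT x:\<Omega>|lebesgue. ?r' x) = 0" by (simp add: domain_integral_add[OF m r'0 d0])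
  moreover have "((\<lambda>s. LINT x:\<Omega>|lebesgue. \<rho> s x) has_real_derivative (LINT x:\<Omega>|lebesgue. ?r' x)) (at t within {0..T})"
    by (rule integral_time_derivative[OF m t density_in_time(1)[OF t] PC1_imp_PC0[OF DG_PC1[OF spaces(1)]] r'0])
  ultimately show ?thesis by (simp add: mass_def)
qed

lemma gradient_equation:
  assumes s: "s \<in> {0..T}" and Z: "Z \<in> DGn \<Omega> \<T> p"
  shows "(LINT x:\<Omega>|lebesgue. q s x \<bullet> Z x) = gradient_form \<Omega> \<T> (\<rho> s) Z"
proof -
  note q0 = PC1_vec_imp_PC0[OF DGn_PC1[OF spaces(4)[OF s]]] and Z0 = PC1_vec_imp_PC0[OF DGn_PC1[OF Z]]
  have "(LINT x:\<Omega>|lebesgue. (q s x - grad (\<rho> s) x) \<bullet> Z x)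
     = (LINT x:\<Omega>|lebesgue. q s x \<bullet> Z x) - (LINT x:\<Omega>|lebesgue. grad (\<rho> s) x \<bullet> Z x)"
    unfolding inner_diff_left
    by (rule domain_integral_diff[OF m PC0_inner[OF q0 Z0] PC0_inner[OF PC0_grad[OF DG_PC1[OF spaces(1)[OF s]] m] Z0]])
  then show ?thesis
    using equations(4)[OF s Z] by (simp add: gradient_form_def flux4_def[abs_def])
qed

text \<open>Test the mass equation with \<open>\<tau>\<close> and the momentum equation with \<open>v\<close>. The convective terms
  cancel pointwise, and integration by parts for \<open>\<tau>\<close> and \<open>\<rho> v\<close> turns the remaining volume terms into
  the interface terms of the two equations.\<close>
lemma transport_balance:
  assumes t: "t \<in> {0..T}"
  shows "(LINT x:\<Omega>|lebesgue. time_deriv T \<rho> t x * \<tau> t x)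
     + (LINT x:\<Omega>|lebesgue. \<rho> t x * (time_deriv T v t x \<bullet> v t x)) = - \<mu> * B (v t) (v t)"
proof -
  let ?r' = "time_deriv T \<rho> t" and ?v' = "time_deriv T v t" and ?w = "\<lambda>y. \<rho> t y *\<^sub>R v t y"
  let ?I = "\<lambda>f. LINT x:\<Omega>|lebesgue. f x"
  note \<rho>1 = DG_PC1[OF spaces(1)[OF t]] and \<tau>1 = DG_PC1[OF spaces(2)[OF t]] and v1 = DG0_vec_PC1[OF spaces(3)[OF t]]
  note \<rho>0 = PC1_imp_PC0[OF \<rho>1] and \<tau>0 = PC1_imp_PC0[OF \<tau>1] and v0 = PC1_vec_imp_PC0[OF v1]
  have r'0: "PC0 \<T> ?r'" by (rule PC1_imp_PC0[OF DG_PC1[OF density_in_time(2)[OF t]]])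
  note v'0 = velocity_deriv_PC0[OF t]
  note d0 = PC0_div_vec[OF momentum_PC1[OF t] m] and g0 = PC0_grad[OF \<tau>1 m]
  let ?E1 = "interface_integral \<Omega> \<T> (\<lambda>F x. jump_vec \<T> F ?w x * avg \<T> F (\<tau> t) x)"
  let ?E2 = "interface_integral \<Omega> \<T> (\<lambda>F x. jump \<T> F (\<tau> t) x \<bullet> avg \<T> F ?w x)"
  have i1: "?I (\<lambda>x. (?r' x + div_vec ?w x) * \<tau> t x) = ?I (\<lambda>x. ?r' x * \<tau> t x) + ?I (\<lambda>x. \<tau> t x * div_vec ?w x)"
  proof -
    have "?I (\<lambda>x. (?r' x + div_vec ?w x) * \<tau> t x) = ?I (\<lambda>x. ?r' x * \<tau> t x + \<tau> t x * div_vec ?w x)"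
      by (rule arg_cong[where f="set_lebesgue_integral lebesgue \<Omega>"], rule ext) (simp add: algebra_simps)
    also have "\<dots> = ?I (\<lambda>x. ?r' x * \<tau> t x) + ?I (\<lambda>x. \<tau> t x * div_vec ?w x)"
      by (rule domain_integral_add[OF m PC0_mult[OF r'0 \<tau>0] PC0_mult[OF \<tau>0 d0]])
    finally show ?thesis .
  qed
  have e1: "0 = ?I (\<lambda>x. ?r' x * \<tau> t x) + ?I (\<lambda>x. \<tau> t x * div_vec ?w x) - ?E1"
  proof -
    have "interface_integral \<Omega> \<T> (flux1 \<T> (\<rho> t) (v t) (\<tau> t)) = - ?E1"
      unfolding flux1_def[abs_def] by (rule interface_integral_minus)
    then show ?thesis using equations(1)[OF t spaces(2)[OF t]] i1 by linarith
  qed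
  have i2: "?I (\<lambda>x. (\<rho> t x *\<^sub>R ?v' x
                  + div_mat (\<lambda>y. \<rho> t y *\<^sub>R tensor (v t y) (v t y)) x
                  - div_vec ?w x *\<^sub>R v t x
                  + \<rho> t x *\<^sub>R grad (\<tau> t) x
                  - (1 / 2 * \<rho> t x) *\<^sub>R grad (\<lambda>y. (norm (v t y))\<^sup>2) x) \<bullet> v t x)
     = ?I (\<lambda>x. \<rho> t x * (?v' x \<bullet> v t x)) + ?I (\<lambda>x. grad (\<tau> t) x \<bullet> ?w x)" (is "set_lebesgue_integral _ _ ?f = _")
  proof -
    have p: "PC0 \<T> (\<lambda>x. \<rho> t x * (?v' x \<bullet> v t x))" "PC0 \<T> (\<lambda>x. grad (\<tau> t) x \<bullet> ?w x)"
      by (intro PC0_mult PC0_inner PC0_scaleR \<rho>0 v0 v'0 g0)+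
    have "?I ?f = ?I (\<lambda>x. \<rho> t x * (?v' x \<bullet> v t x) + grad (\<tau> t) x \<bullet> ?w x)"
    proof (rule domain_integral_cong[OF m PC0_add[OF p]])
      fix x assume x: "x \<in> \<Union>\<T>"
      have "(div_mat (\<lambda>y. \<rho> t y *\<^sub>R tensor (v t y) (v t y)) x - div_vec ?w x *\<^sub>R v t x
         - (1 / 2 * \<rho> t x) *\<^sub>R grad (\<lambda>y. (norm (v t y))\<^sup>2) x) \<bullet> v t x = 0"
        by (rule convective_term_identity[OF PC1_differentiable[OF \<rho>1 m x] PC1_vec_differentiable[OF v1 m x]])
      then show "?f x = \<rho> t x * (?v' x \<bullet> v t x) + grad (\<tau> t) x \<bullet> ?w x"
        by (simp add: inner_diff_left inner_add_left)
    qed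
    also have "\<dots> = ?I (\<lambda>x. \<rho> t x * (?v' x \<bullet> v t x)) + ?I (\<lambda>x. grad (\<tau> t) x \<bullet> ?w x)"
      by (rule domain_integral_add[OF m p])
    finally show ?thesis .
  qed
  have e2: "0 = ?I (\<lambda>x. \<rho> t x * (?v' x \<bullet> v t x)) + ?I (\<lambda>x. grad (\<tau> t) x \<bullet> ?w x) - ?E2 + \<mu> * B (v t) (v t)"
  proof -
    have "interface_integral \<Omega> \<T> (flux2 \<T> (\<rho> t) (\<tau> t) (v t)) = - ?E2"
      unfolding flux2_def[abs_def] by (rule interface_integral_minus)
    then show ?thesis using equations(2)[OF t spaces(3)[OF t]] i2 by linarith
  qed
  have "?I (\<lambda>x. \<tau> t x * div_vec ?w x) + ?I (\<lambda>x. grad (\<tau> t) x \<bullet> ?w x) = ?E1 + ?E2"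
    by (rule broken_integration_by_parts[OF \<Omega> m \<tau>1 momentum_PC1[OF t] momentum_boundary[OF t]])
  then show ?thesis using e1 e2 by linarith
qed

text \<open>Test the third equation with the time derivative of \<open>\<rho>\<close>, which belongs to the space of
  piecewise polynomials. Integration by parts for it and \<open>q\<close> replaces the divergence of \<open>q\<close> with its
  interface term by \<open>gradient_form\<close>.\<close>
lemma potential_balance:
  assumes t: "t \<in> {0..T}"
  shows "(LINT x:\<Omega>|lebesgue. deriv W (\<rho> t x) * time_deriv T \<rho> t x + 1 / 2 * (time_deriv T \<rho> t x * (norm (v t x))\<^sup>2))
    = (LINT x:\<Omega>|lebesgue. time_deriv T \<rho> t x * \<tau> t x) - \<gamma> * gradient_form \<Omega> \<T> (time_deriv T \<rho> t) (q t)"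
proof -
  let ?r' = "time_deriv T \<rho> t" and ?I = "\<lambda>f. LINT x:\<Omega>|lebesgue. f x"
  note \<rho>1 = DG_PC1[OF spaces(1)[OF t]] and \<tau>1 = DG_PC1[OF spaces(2)[OF t]] and v1 = DG0_vec_PC1[OF spaces(3)[OF t]]
  note \<rho>0 = PC1_imp_PC0[OF \<rho>1] and \<tau>0 = PC1_imp_PC0[OF \<tau>1] and v0 = PC1_vec_imp_PC0[OF v1]
  note r'1 = DG_PC1[OF density_in_time(2)[OF t]] and q1 = DGn_PC1[OF spaces(4)[OF t]]
  note r'0 = PC1_imp_PC0[OF r'1] and d0 = PC0_div_vec[OF q1 m]
  have W0: "PC0 \<T> (\<lambda>x. deriv W (\<rho> t x))" by (rule PC0_compose[OF smooth_potential(2)[OF W] \<rho>0])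
  let ?a = "\<lambda>x. deriv W (\<rho> t x) * ?r' x + 1 / 2 * (?r' x * (norm (v t x))\<^sup>2)"
  let ?c = "\<lambda>x. ?r' x * \<tau> t x" and ?d = "\<lambda>x. \<gamma> * (?r' x * div_vec (q t) x)"
  have p: "PC0 \<T> ?a" "PC0 \<T> ?c" "PC0 \<T> ?d"
    by (intro PC0_add PC0_mult PC0_const PC0_power PC0_norm W0 r'0 v0 \<tau>0 d0)+
  have "?I (\<lambda>x. (\<tau> t x - deriv W (\<rho> t x) + \<gamma> * div_vec (q t) x - 1 / 2 * (norm (v t x))\<^sup>2) * ?r' x)
      = ?I (\<lambda>x. (?c x - ?a x) + ?d x)"
    by (rule arg_cong[where f="set_lebesgue_integral lebesgue \<Omega>"], rule ext) (simp add: algebra_simps)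
  also have "\<dots> = ?I (\<lambda>x. ?c x - ?a x) + ?I ?d" by (rule domain_integral_add[OF m PC0_diff[OF p(2,1)] p(3)])
  also have "?I (\<lambda>x. ?c x - ?a x) = ?I ?c - ?I ?a" by (rule domain_integral_diff[OF m p(2,1)])
  finally have i3: "?I (\<lambda>x. (\<tau> t x - deriv W (\<rho> t x) + \<gamma> * div_vec (q t) x - 1 / 2 * (norm (v t x))\<^sup>2) * ?r' x)
      = ?I ?c - ?I ?a + \<gamma> * ?I (\<lambda>x. ?r' x * div_vec (q t) x)" by simp
  let ?E3 = "interface_integral \<Omega> \<T> (\<lambda>F x. jump_vec \<T> F (q t) x * avg \<T> F ?r' x)"
  have "interface_integral \<Omega> \<T> (flux3 \<T> \<gamma> (q t) ?r') = - (\<gamma> * ?E3)"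
    unfolding flux3_def[abs_def] interface_integral_minus mult.assoc interface_integral_cmult ..
  then have e3: "0 = ?I ?c - ?I ?a + \<gamma> * ?I (\<lambda>x. ?r' x * div_vec (q t) x) - \<gamma> * ?E3"
    using equations(3)[OF t density_in_time(2)[OF t]] i3 by linarith
  have "?I (\<lambda>x. ?r' x * div_vec (q t) x) + ?I (\<lambda>x. grad ?r' x \<bullet> q t x)
     = ?E3 + interface_integral \<Omega> \<T> (\<lambda>F x. jump \<T> F ?r' x \<bullet> avg \<T> F (q t) x)"
    by (rule broken_integration_by_parts[OF \<Omega> m r'1 q1 DGn_boundary[OF spaces(4)[OF t]]])
  then have "?I (\<lambda>x. ?r' x * div_vec (q t) x) = ?E3 - gradient_form \<Omega> \<T> ?r' (q t)"
    unfolding gradient_form_def by linarith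
  then have "\<gamma> * ?I (\<lambda>x. ?r' x * div_vec (q t) x) = \<gamma> * ?E3 - \<gamma> * gradient_form \<Omega> \<T> ?r' (q t)"
    by (simp only: right_diff_distrib)
  then show ?thesis using e3 by linarith
qed

text \<open>The first two terms of the energy are differentiated under the integral, the third by
  \<open>gradient_energy_derivative\<close>; its derivative cancels \<open>gradient_form\<close> in \<open>potential_balance\<close>, and
  what is left is the left-hand side of \<open>transport_balance\<close>.\<close>
lemma energy_balance:
  assumes t: "t \<in> {0..T}"
  shows "((\<lambda>s. energy \<Omega> W \<gamma> (\<rho> s) (v s) (q s)) has_real_derivative - \<mu> * B (v t) (v t)) (at t within {0..T})"
proof -
  let ?r' = "time_deriv T \<rho> t" and ?v' = "time_deriv T v t" and ?I = "\<lambda>f. LINT x:\<Omega>|lebesgue. f x"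
  let ?h = "\<lambda>s x. W (\<rho> s x) + 1 / 2 * (\<rho> s x * (\<Sum>i\<in>UNIV. v s x $ i * v s x $ i))"
  let ?vi' = "\<lambda>i. time_deriv T (\<lambda>s x. v s x $ i) t"
  \<comment> \<open>The form that the sum and product rules produce. The summand with the factor zero comes from the constant \<open>1 / 2\<close>.\<close>
  let ?h' = "\<lambda>x. deriv W (\<rho> t x) * ?r' x + (0 * (\<rho> t x * (\<Sum>i\<in>UNIV. v t x $ i * v t x $ i))
      + (?r' x * (\<Sum>i\<in>UNIV. v t x $ i * v t x $ i)
         + (\<Sum>i\<in>UNIV. ?vi' i x * v t x $ i + ?vi' i x * v t x $ i) * \<rho> t x) * (1 / 2))"
  have td: "time_diff T (\<Union>\<T>) ?h t ?h'"
    by (intro time_diff_add time_diff_mult time_diff_sum time_diff_compose[OF density_in_time(1)[OF t] t smooth_potential[OF W]]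
        density_in_time(1) velocity_component_in_time(1) t finite time_diff_const[where M="1 / 2"]) simp
  have \<rho>0: "PC0 \<T> (\<rho> s)" if "s \<in> {0..T}" for s
    by (rule PC1_imp_PC0[OF DG_PC1[OF spaces(1)[OF that]]])
  have v0: "PC0 \<T> (v s)" if "s \<in> {0..T}" for s
    by (rule PC1_vec_imp_PC0[OF DG0_vec_PC1[OF spaces(3)[OF that]]])
  have q0: "PC0 \<T> (q s)" if "s \<in> {0..T}" for s
    by (rule PC1_vec_imp_PC0[OF DGn_PC1[OF spaces(4)[OF that]]])
  have Wc: "continuous_on UNIV W"
    by (rule DERIV_continuous_on) (rule has_field_derivative_at_within[OF smooth_potential(1)[OF W]])
  have nrm: "(\<Sum>i\<in>UNIV. u $ i * u $ i) = (norm u)\<^sup>2" for u :: "real ^ 'd"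
    by (simp add: power2_norm_eq_inner inner_vec_def)
  have p: "PC0 \<T> (?h s)" if "s \<in> {0..T}" for s
    unfolding nrm by (intro PC0_add PC0_mult PC0_const PC0_power PC0_norm PC0_compose[OF Wc] \<rho>0 v0 that)
  note r'0 = PC1_imp_PC0[OF DG_PC1[OF density_in_time(2)[OF t]]]
  have W0: "PC0 \<T> (\<lambda>x. deriv W (\<rho> t x))" by (rule PC0_compose[OF smooth_potential(2)[OF W] \<rho>0[OF t]])
  let ?a = "\<lambda>x. deriv W (\<rho> t x) * ?r' x + 1 / 2 * (?r' x * (norm (v t x))\<^sup>2)" and ?b = "\<lambda>x. \<rho> t x * (?v' x \<bullet> v t x)"
  have pab: "PC0 \<T> ?a" "PC0 \<T> ?b"
    by (intro PC0_add PC0_mult PC0_const PC0_power PC0_norm PC0_inner W0 r'0 \<rho>0 v0 t velocity_deriv_PC0)+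
  have h'eq: "?h' x = ?a x + ?b x" if x: "x \<in> \<Union>\<T>" for x
  proof -
    have "(\<Sum>i\<in>UNIV. ?vi' i x * v t x $ i + ?vi' i x * v t x $ i) = 2 * (?v' x \<bullet> v t x)"
      unfolding velocity_deriv_component[OF t x] inner_vec_def inner_real_def sum_distrib_left
      by (rule sum.cong[OF refl]) simp
    then show ?thesis unfolding nrm by (simp add: algebra_simps)
  qed
  have h'0: "PC0 \<T> ?h'" by (rule PC0_cong[OF PC0_add[OF pab]]) (rule h'eq)
  have D1: "((\<lambda>s. ?I (?h s)) has_real_derivative ?I ?h') (at t within {0..T})"
    by (rule integral_time_derivative[OF m t td p h'0])
  have D2: "((\<lambda>s. ?I (\<lambda>x. (norm (q s x))\<^sup>2)) has_real_derivative 2 * gradient_form \<Omega> \<T> ?r' (q t)) (at t within {0..T})"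
    by (rule gradient_energy_derivative[OF m \<Omega> T t spaces(1) differentiable_in_time(1) spaces(4) gradient_equation])
  have E: "energy \<Omega> W \<gamma> (\<rho> s) (v s) (q s) = ?I (?h s) + \<gamma> / 2 * ?I (\<lambda>x. (norm (q s x))\<^sup>2)" if s: "s \<in> {0..T}" for s
  proof -
    have "energy \<Omega> W \<gamma> (\<rho> s) (v s) (q s) = ?I (\<lambda>x. ?h s x + \<gamma> / 2 * (norm (q s x))\<^sup>2)"
      unfolding energy_def nrm by (simp add: mult.assoc)
    also have "\<dots> = ?I (?h s) + ?I (\<lambda>x. \<gamma> / 2 * (norm (q s x))\<^sup>2)"
      by (rule domain_integral_add[OF m p[OF s] PC0_mult[OF PC0_const PC0_power[OF PC0_norm[OF q0[OF s]]]]])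
    finally show ?thesis by simp
  qed
  have "?I ?h' = ?I (\<lambda>x. ?a x + ?b x)" by (rule domain_integral_cong[OF m PC0_add[OF pab] h'eq])
  also have "\<dots> = ?I ?a + ?I ?b" by (rule domain_integral_add[OF m pab])
  finally have "?I ?h' + \<gamma> / 2 * (2 * gradient_form \<Omega> \<T> ?r' (q t)) = - \<mu> * B (v t) (v t)"
    using potential_balance[OF t] transport_balance[OF t] by simp
  with DERIV_add[OF D1 DERIV_cmult[OF D2, of "\<gamma> / 2"]]
  have "((\<lambda>s. ?I (?h s) + \<gamma> / 2 * ?I (\<lambda>x. (norm (q s x))\<^sup>2)) has_real_derivative - \<mu> * B (v t) (v t)) (at t within {0..T})"
    by simp
  then show ?thesis
    by (rule has_field_derivative_transform_within[OF _ zero_less_one t]) (rule E[symmetric])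
qed

end

lemma coercive_nonneg:
  assumes "coercive \<Omega> \<T> p B" "w \<in> DG0_vec \<Omega> \<T> p"
  shows "0 \<le> B w w"
proof -
  obtain c N where "c > 0" "\<forall>w\<in>DG0_vec \<Omega> \<T> p. B w w \<ge> c * (N w)\<^sup>2"
    using assms(1) unfolding coercive_def by blast
  then have "0 \<le> c * (N w)\<^sup>2" "c * (N w)\<^sup>2 \<le> B w w" using assms(2) by auto
  then show ?thesis by linarith
qed

theorem corollary3p5:
  fixes \<Omega> :: "(real ^ 'd) set" and \<T> :: "(real ^ 'd) set set"
    and p :: nat and T \<gamma> \<kappa> :: real and W :: "real \<Rightarrow> real"
  assumes "CARD('d) \<in> {1, 2, 3}"
    and "bounded_domain \<Omega>"
    and "mesh \<Omega> \<T>"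
    and "shape_regular \<kappa> \<T>"
    and "0 < T"
    and "smooth_on UNIV W"
  shows
    "(consistent \<Omega> \<T> p T \<gamma> \<and>
      (\<forall>B \<rho> \<tau> v q. scheme_solution \<Omega> \<T> p T W \<gamma> 0 B \<rho> \<tau> v q \<longrightarrow>
        (\<forall>t\<in>{0..T}.
          ((\<lambda>s. mass \<Omega> (\<rho> s)) has_real_derivative 0) (at t within {0..T}) \<and>
          ((\<lambda>s. energy \<Omega> W \<gamma> (\<rho> s) (v s) (q s)) has_real_derivative 0) (at t within {0..T}))))
     \<and>
     (\<forall>\<sigma> \<mu>. coercive \<Omega> \<T> p (sipg \<Omega> \<T> \<sigma>) \<and> 0 < \<mu> \<longrightarrow>
       consistent \<Omega> \<T> p T \<gamma> \<and>
       (\<forall>\<rho> \<tau> v q. scheme_solution \<Omega> \<T> p T W \<gamma> \<mu> (sipg \<Omega> \<T> \<sigma>) \<rho> \<tau> v q \<longrightarrow>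
         (\<forall>t\<in>{0..T}.
           ((\<lambda>s. mass \<Omega> (\<rho> s)) has_real_derivative 0) (at t within {0..T}) \<and>
           ((\<lambda>s. energy \<Omega> W \<gamma> (\<rho> s) (v s) (q s)) has_real_derivative
              - \<mu> * sipg \<Omega> \<T> \<sigma> (v t) (v t)) (at t within {0..T}) \<and>
           - \<mu> * sipg \<Omega> \<T> \<sigma> (v t) (v t) \<le> 0)))"
proof (intro conjI allI impI ballI; (elim conjE)?)
  have \<Omega>: "open \<Omega>" using assms(2) by (simp add: bounded_domain_def)
  show cons: "consistent \<Omega> \<T> p T \<gamma>" by (rule scheme_consistent[OF \<Omega> assms(3)])
  then show "consistent \<Omega> \<T> p T \<gamma>" .
  {
    fix B \<rho> \<tau> v q t
    assume "scheme_solution \<Omega> \<T> p T W \<gamma> 0 B \<rho> \<tau> v q" and t: "t \<in> {0..T}"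
    then interpret scheme \<Omega> \<T> p T \<gamma> 0 W B \<rho> \<tau> v q
      using \<Omega> assms by unfold_locales
    show "((\<lambda>s. mass \<Omega> (\<rho> s)) has_real_derivative 0) (at t within {0..T})" by (rule mass_conservation[OF t])
    show "((\<lambda>s. energy \<Omega> W \<gamma> (\<rho> s) (v s) (q s)) has_real_derivative 0) (at t within {0..T})"
      using energy_balance[OF t] by simp
  }
  fix \<sigma> \<mu> \<rho> \<tau> v q t
  assume c: "coercive \<Omega> \<T> p (sipg \<Omega> \<T> \<sigma>)" "0 < \<mu>"
    and "scheme_solution \<Omega> \<T> p T W \<gamma> \<mu> (sipg \<Omega> \<T> \<sigma>) \<rho> \<tau> v q" and t: "t \<in> {0..T}"
  then interpret scheme \<Omega> \<T> p T \<gamma> \<mu> W "sipg \<Omega> \<T> \<sigma>" \<rho> \<tau> v q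
    using \<Omega> assms by unfold_locales
  show "((\<lambda>s. mass \<Omega> (\<rho> s)) has_real_derivative 0) (at t within {0..T})" by (rule mass_conservation[OF t])
  show "((\<lambda>s. energy \<Omega> W \<gamma> (\<rho> s) (v s) (q s)) has_real_derivative - \<mu> * sipg \<Omega> \<T> \<sigma> (v t) (v t)) (at t within {0..T})"
    by (rule energy_balance[OF t])
  show "- \<mu> * sipg \<Omega> \<T> \<sigma> (v t) (v t) \<le> 0"
    using coercive_nonneg[OF c(1) spaces(3)[OF t]] c(2) by simp
qed

end
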